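(* Let $\chi\in\widehat{\mathcal O_{\mathbb E}^\times}$ with $\chi^2=1$ and $\eta=\chi|_{\mathcal O_{\mathbb F}^\times}$. (1) For $s\in(\frac14,\frac12)$ and $t=2s-\frac12$, the restriction of the irreducible unitary representation $\pi_{\chi,s}$ of $G=\mathrm{PGL}(2,\mathbb E)$ to $G'=\mathrm{PGL}(2,\mathbb F)$ contains $\tau_{\eta,t}$ as a direct summand. (2) For $s=t=\frac12$, the restriction of the irreducible unitary representation $\pi^0_{\chi,\frac12}$ of $G$ to $G'$ contains $\tau^0_{\eta,\frac12}$ as a direct summand.
   Context: Fields. $\mathbb E/\mathbb F$ is a quadratic extension of non-archimedean local fields. For $k\in\{\mathbb E,\mathbb F\}$: $\mathcal O_k$ is the ring of integers, $\mathcal O_k^\times$ its units, $\varpi_k$ a chosen uniformizer, $q_k$ the residue cardinality, $\nu_k$ the valuation, $|\cdot|_k$ the absolute value with $d(ax)=|a|_k\,dx$ for Haar measure $dx$ on $k$ (so $|\varpi_k|_k=q_k^{-1}$). $\widehat{\mathcal O_k^\times}$ is the set of (continuous) characters of $\mathcal O_k^\times$; for $\chi\in\widehat{\mathcal O_k^\times}$, $s\in\mathbb C$, $\chi_s(x)=\chi(\varpi_k^{-\nu_k(x)}x)|x|_k^s$ ($x\in k^\times$). Representations. Let $B$ be the upper triangular Borel subgroup of $G$ and $\chi_s\begin{pmatrix}a&b\\ 0&1\end{pmatrix}=\chi_s(a)$. $\pi_{\chi,s}$ is left translation on $\operatorname{Ind}_B^G(\chi_s)=\{f:G\to\mathbb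 C\text{ locally constant}:f(gb)=\chi_{s+\frac12}(b)^{-1}f(g)\ \forall g\in G,b\in B\}$. Write $\overline n_x=\begin{pmatrix}1&0\\ x&1\end{pmatrix}$. Unitary structures. For $\chi^2=1$ and $s\in(0,\frac12)$, $\pi_{\chi,s}$ is irreducible and the form $\langle f_1,f_2\rangle_{\chi,s}=\int_{\mathbb E}\int_{\mathbb E}|x-x'|_{\mathbb E}^{2s-1}f_1(\overline n_x)\overline{f_2(\overline n_{x'})}\,dx\,dx'$ is a $G$-invariant inner product (complementary series); $\pi_{\chi,s}$ also denotes the unitary representation on the Hilbert space completion. For $s=\frac12$, $\pi^0_{\chi,\frac12}$ is the subrepresentation of $\pi_{\chi,\frac12}$ on $\{f:\int_{\mathbb E}f(\overline n_x)\,dx=0\}$ (Steinberg representation), which is irreducible and carries, up to a positive constant, the $G$-invariant inner product $\int_{\mathbb E}\widehat{f_1}(x)\overline{\widehat{f_2}(x)}|x|_{\mathbb E}^{-1}\,dx$, where $\widehat f$ is the Fourier transform on $\mathbb E$ of $x\mapsto f(\overline n_x)$ with respect to a fixed non-trivial additive character; $\pi^0_{\chi,\frac12}$ also denotes its Hilbert completion. $\tau_{\eta,t}$ (for $\eta^2=1$, $t\in(0,\frac12)$) and $\tau^0_{\eta,\frac12}$ are the analogous unitary representations of $G'$, with $\mathbb E$ replaced by $\mathbb F$. "Contains as a direct summand" is meant in the sense of unitary representations on Hilbert spaces: there is a closed $G'$-invariant subspace unitarily equivalent to the given representation.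
   Formalization: The chosen uniformizers are additionally assumed compatible, χ(ϖ_E^{-ν_E(ϖ_F)}ϖ_F)=1, so that χ_s restricts to η_{2s} on F^×; for independent choices (e.g. E/F unramified, q odd, χ tame quadratic, ϖ_E=uϖ_F with χ(u)=-1) part (1) is false. *)

theory Defs
  imports "HOL-Analysis.Analysis"
begin

section \<open>Non-archimedean local fields\<close>

class discretely_valued_field = field +
  fixes val :: "'a \<Rightarrow> int"  \<comment> \<open>the value at 0 is irrelevant and never used\<close>
  assumes val_mult: "x \<noteq> 0 \<Longrightarrow> y \<noteq> 0 \<Longrightarrow> val (x * y) = val x + val y"
    and val_add: "x \<noteq> 0 \<Longrightarrow> y \<noteq> 0 \<Longrightarrow> x + y \<noteq> 0 \<Longrightarrow> min (val x) (val y) \<le> val (x + y)"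
    and val_surj: "\<exists>x. x \<noteq> 0 \<and> val x = 1"

context discretely_valued_field
begin

definition ring_of_integers :: "'a set" where
  "ring_of_integers = {x. x = 0 \<or> 0 \<le> val x}"

definition maximal_ideal :: "'a set" where
  "maximal_ideal = {x. x = 0 \<or> 1 \<le> val x}"

definition integer_units :: "'a set" where
  "integer_units = {x. x \<noteq> 0 \<and> val x = 0}"

definition uniformizer :: "'a \<Rightarrow> bool" where
  "uniformizer \<pi> \<longleftrightarrow> \<pi> \<noteq> 0 \<and> val \<pi> = 1"

definition residue_classes :: "'a set set" where
  "residue_classes = ring_of_integers //
     {(x, y). x \<in> ring_of_integers \<and> y \<in> ring_of_integers \<and> x - y \<in> maximal_ideal}"

definition absval :: "'a \<Rightarrow> real" where
  "absval x = (if x = 0 then 0 else real (card residue_classes) powi (- val x))"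

end

text \<open>A field that is complete for a normalized discrete valuation and has finite residue field;
  the metric is the one of the normalized absolute value.\<close>

class nonarch_local_field = discretely_valued_field + complete_space +
  assumes finite_residue_classes: "finite residue_classes"
    and dist_absval: "dist x y = absval (x - y)"

definition quadratic_extension ::
    "('f::nonarch_local_field \<Rightarrow> 'e::nonarch_local_field) \<Rightarrow> bool" where
  "quadratic_extension \<iota> \<longleftrightarrow>
     \<iota> 1 = 1 \<and> (\<forall>x y. \<iota> (x + y) = \<iota> x + \<iota> y) \<and> (\<forall>x y. \<iota> (x * y) = \<iota> x * \<iota> y) \<and>
     continuous_on UNIV \<iota> \<and>
     vector_space.dim (\<lambda>a x. \<iota> a * x) (UNIV :: 'e set) = 2"

definition haar_measure :: "'k::nonarch_local_field measure \<Rightarrow> bool" where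
  "haar_measure M \<longleftrightarrow>
     sets M = sets borel \<and>
     (\<forall>A\<in>sets M. \<forall>x. emeasure M ((+) x ` A) = emeasure M A) \<and>
     (\<forall>K. compact K \<longrightarrow> emeasure M K < \<infinity>) \<and>
     (\<forall>U. open U \<longrightarrow> U \<noteq> {} \<longrightarrow> emeasure M U > 0)"

definition nontrivial_additive_character :: "('k::nonarch_local_field \<Rightarrow> complex) \<Rightarrow> bool" where
  "nontrivial_additive_character \<psi> \<longleftrightarrow>
     continuous_on UNIV \<psi> \<and> (\<forall>x. cmod (\<psi> x) = 1) \<and>
     (\<forall>x y. \<psi> (x + y) = \<psi> x * \<psi> y) \<and> (\<exists>x. \<psi> x \<noteq> 1)"

text \<open>Only the values on the units matter.\<close>

definition unit_character :: "('k::nonarch_local_field \<Rightarrow> complex) \<Rightarrow> bool" where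
  "unit_character chi \<longleftrightarrow>
     continuous_on integer_units chi \<and> (\<forall>u\<in>integer_units. chi u \<noteq> 0) \<and>
     (\<forall>u\<in>integer_units. \<forall>v\<in>integer_units. chi (u * v) = chi u * chi v)"

text \<open>The character \<open>chi_s\<close> of the multiplicative group; it depends on the chosen uniformizer \<open>\<pi>\<close>.\<close>

definition char_twist ::
    "'k::nonarch_local_field \<Rightarrow> ('k \<Rightarrow> complex) \<Rightarrow> complex \<Rightarrow> 'k \<Rightarrow> complex" where
  "char_twist \<pi> chi s x = chi (\<pi> powi (- val x) * x) * complex_of_real (absval x) powr s"

text \<open>The extensions of \<open>chi\<close> and of its restriction \<open>eta\<close> to the smaller field are normalized by
  \<open>chi_s \<pi>E > 0\<close> and \<open>eta_t \<pi>F > 0\<close> for real \<open>s\<close>, \<open>t\<close>. They match, i.e. \<open>chi_s\<close> restricts to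
  \<open>eta_t\<close> with \<open>t = 2 s\<close>, precisely under the following condition on the chosen uniformizers. It
  holds for every \<open>chi\<close> if \<open>\<iota> \<pi>F = \<pi>E ^ e\<close>, where \<open>e\<close> is the ramification index.\<close>

definition compatible_uniformizers ::
    "('f::nonarch_local_field \<Rightarrow> 'e::nonarch_local_field) \<Rightarrow> ('e \<Rightarrow> complex) \<Rightarrow> 'e \<Rightarrow> 'f \<Rightarrow> bool" where
  "compatible_uniformizers \<iota> chi \<pi>E \<pi>F \<longleftrightarrow> chi (\<pi>E powi (- val (\<iota> \<pi>F)) * \<iota> \<pi>F) = 1"


section \<open>The group PGL(2)\<close>

lemma mat_times_nth: "(mat c ** A) $ i $ j = c * A $ i $ j"
  for A :: "'k::comm_semiring_1 ^ 'n ^ 'n"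
proof -
  have "(mat c ** A) $ i $ j = (\<Sum>k\<in>UNIV. if i = k then c * A $ k $ j else 0)"
    unfolding matrix_matrix_mult_def mat_def vec_lambda_beta by (rule sum.cong) auto
  then show ?thesis by simp
qed

lemma times_mat_nth: "(A ** mat c) $ i $ j = A $ i $ j * c"
  for A :: "'k::comm_semiring_1 ^ 'n ^ 'n"
proof -
  have "(A ** mat c) $ i $ j = (\<Sum>k\<in>UNIV. if k = j then A $ i $ k * c else 0)"
    unfolding matrix_matrix_mult_def mat_def vec_lambda_beta by (rule sum.cong) auto
  then show ?thesis by simp
qed

lemma mat_mult_mat: "mat a ** mat b = (mat (a * b) :: 'k::comm_semiring_1 ^ 'n ^ 'n)"
  by (simp add: vec_eq_iff mat_times_nth) (simp add: mat_def)

lemma mat_commute: "mat c ** A = A ** mat c"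
  for A :: "'k::comm_semiring_1 ^ 'n ^ 'n"
  by (simp add: vec_eq_iff mat_times_nth times_mat_nth ac_simps)

lemma matrix_inv_inverse:
  fixes A :: "'k::field ^ 'n ^ 'n"
  assumes "invertible A"
  shows "A ** matrix_inv A = mat 1 \<and> matrix_inv A ** A = mat 1"
  using assms unfolding invertible_def matrix_inv_def by (rule someI_ex)

lemmas matrix_inv_right = matrix_inv_inverse[THEN conjunct1]
  and matrix_inv_left = matrix_inv_inverse[THEN conjunct2]

lemma invertible_matrix_inv: "invertible A \<Longrightarrow> invertible (matrix_inv A)"
  for A :: "'k::field ^ 'n ^ 'n"
  using matrix_inv_inverse[of A] unfolding invertible_def[of "matrix_inv A"] by blast

definition proj_eq :: "'k::field ^ 2 ^ 2 \<Rightarrow> 'k ^ 2 ^ 2 \<Rightarrow> bool" where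
  "proj_eq A B \<longleftrightarrow> invertible A \<and> invertible B \<and> (\<exists>c. c \<noteq> 0 \<and> A = mat c ** B)"

lemma proj_eq_refl: "invertible A \<Longrightarrow> proj_eq A A"
  unfolding proj_eq_def by (metis matrix_mul_lid zero_neq_one)

lemma invertible_mat_1: "invertible (mat 1 :: 'k::field ^ 'n ^ 'n)"
  unfolding invertible_def by (metis matrix_mul_lid)

lemma part_equivp_proj_eq: "part_equivp (proj_eq :: 'k::field ^ 2 ^ 2 \<Rightarrow> _)"
proof (rule part_equivpI)
  have "proj_eq (mat 1 :: 'k^2^2) (mat 1)"
    by (simp add: proj_eq_refl invertible_mat_1)
  then show "\<exists>A :: 'k^2^2. proj_eq A A" ..
  show "symp (proj_eq :: 'k^2^2 \<Rightarrow> _)"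
  proof (rule sympI)
    fix A B :: "'k^2^2"
    assume "proj_eq A B"
    then obtain c where c: "invertible A" "invertible B" "c \<noteq> 0" "A = mat c ** B"
      unfolding proj_eq_def by blast
    then have "B = mat (inverse c) ** A"
      by (simp add: matrix_mul_assoc mat_mult_mat)
    with c show "proj_eq B A"
      unfolding proj_eq_def by (metis nonzero_imp_inverse_nonzero)
  qed
  show "transp (proj_eq :: 'k^2^2 \<Rightarrow> _)"
    unfolding proj_eq_def by (rule transpI) (metis matrix_mul_assoc mat_mult_mat mult_eq_0_iff)
qed

quotient_type (overloaded) 'k pgl2 = "'k::field ^ 2 ^ 2" / partial: proj_eq
  by (rule part_equivp_proj_eq)

text \<open>The class of an invertible matrix; junk value 1 on singular matrices.\<close>

lift_definition pgl2_class :: "'k::field ^ 2 ^ 2 \<Rightarrow> 'k pgl2"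
  is "\<lambda>A. if invertible A then A else mat 1"
  by (simp add: proj_eq_refl invertible_mat_1)

lemma pgl2_class_eq_abs: "invertible A \<Longrightarrow> pgl2_class A = abs_pgl2 A"
  by (simp add: pgl2_class_def)

instantiation pgl2 :: (field) "{monoid_mult, inverse}"
begin

lift_definition one_pgl2 :: "'a pgl2" is "mat 1"
  by (simp add: proj_eq_refl invertible_mat_1)

lift_definition times_pgl2 :: "'a pgl2 \<Rightarrow> 'a pgl2 \<Rightarrow> 'a pgl2" is "(**)"
proof -
  fix A B C D :: "'a^2^2"
  assume "proj_eq A B" "proj_eq C D"
  then obtain c d where *: "invertible A" "invertible B" "c \<noteq> 0" "A = mat c ** B"
    "invertible C" "invertible D" "d \<noteq> 0" "C = mat d ** D"
    unfolding proj_eq_def by blast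
  have "A ** C = mat c ** ((B ** mat d) ** D)"
    using * by (simp add: matrix_mul_assoc)
  also have "\<dots> = (mat c ** mat d) ** (B ** D)"
    unfolding mat_commute[of d B, symmetric] by (simp add: matrix_mul_assoc)
  finally have "A ** C = mat (c * d) ** (B ** D)"
    by (simp add: mat_mult_mat)
  moreover have "c * d \<noteq> 0" "invertible (A ** C)" "invertible (B ** D)"
    using * invertible_mult by auto
  ultimately show "proj_eq (A ** C) (B ** D)"
    unfolding proj_eq_def by blast
qed

lift_definition inverse_pgl2 :: "'a pgl2 \<Rightarrow> 'a pgl2" is matrix_inv
proof -
  fix A B :: "'a^2^2"
  assume "proj_eq A B"
  then obtain c where *: "invertible A" "invertible B" "c \<noteq> 0" "A = mat c ** B"
    unfolding proj_eq_def by blast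
  let ?C = "mat (inverse c) ** matrix_inv B"
  have "A ** ?C = mat c ** ((B ** mat (inverse c)) ** matrix_inv B)"
    using * by (simp add: matrix_mul_assoc)
  also have "\<dots> = (mat c ** mat (inverse c)) ** (B ** matrix_inv B)"
    unfolding mat_commute[of "inverse c" B, symmetric] by (simp add: matrix_mul_assoc)
  also have "\<dots> = mat 1"
    using * by (simp add: matrix_inv_right mat_mult_mat)
  finally have AC: "A ** ?C = mat 1" .
  have "matrix_inv A = matrix_inv A ** (A ** ?C)"
    by (simp add: AC)
  also have "\<dots> = (matrix_inv A ** A) ** ?C"
    by (simp only: matrix_mul_assoc)
  also have "\<dots> = ?C"
    using * by (simp add: matrix_inv_left)
  finally have "matrix_inv A = ?C" .
  moreover have "inverse c \<noteq> 0" "invertible (matrix_inv A)" "invertible (matrix_inv B)"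
    using * by (auto intro: invertible_matrix_inv)
  ultimately show "proj_eq (matrix_inv A) (matrix_inv B)"
    unfolding proj_eq_def by blast
qed

definition divide_pgl2 :: "'a pgl2 \<Rightarrow> 'a pgl2 \<Rightarrow> 'a pgl2" where
  "divide_pgl2 g h = g * inverse h"

instance
proof
  fix a b c :: "'a pgl2"
  show "a * b * c = a * (b * c)"
  proof transfer
    fix A B C :: "'a^2^2"
    assume "proj_eq A A" "proj_eq B B" "proj_eq C C"
    then have "invertible (A ** (B ** C))"
      by (simp add: proj_eq_def invertible_mult)
    then show "proj_eq (A ** B ** C) (A ** (B ** C))"
      by (simp add: proj_eq_refl matrix_mul_assoc)
  qed
  show "1 * a = a" by transfer simp
  show "a * 1 = a" by transfer simp
qed

end

lemma pgl2_left_inverse: "inverse g * g = 1" for g :: "'k::field pgl2"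
proof transfer
  fix A :: "'k^2^2"
  assume "proj_eq A A"
  then have "matrix_inv A ** A = mat 1"
    by (simp add: proj_eq_def matrix_inv_left)
  then show "proj_eq (matrix_inv A ** A) (mat 1)"
    by (simp add: proj_eq_refl invertible_mat_1)
qed

text \<open>The quotient topology coming from GL(2).\<close>

instantiation pgl2 :: ("{field, topological_space}") topological_space
begin

definition open_pgl2 :: "'a pgl2 set \<Rightarrow> bool" where
  "open_pgl2 U \<longleftrightarrow>
     openin (top_of_set {A. invertible A}) {A. invertible A \<and> pgl2_class A \<in> U}"

instance
proof
  show "open (UNIV :: 'a pgl2 set)"
    unfolding open_pgl2_def using openin_topspace[of "top_of_set {A :: 'a^2^2. invertible A}"] by simp
  show "open (S \<inter> T)" if "open S" "open T" for S T :: "'a pgl2 set"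
  proof -
    have "{A. invertible A \<and> pgl2_class A \<in> S \<inter> T} =
        {A. invertible A \<and> pgl2_class A \<in> S} \<inter> {A. invertible A \<and> pgl2_class A \<in> T}"
      by blast
    then show ?thesis
      using openin_Int[OF that[unfolded open_pgl2_def]] unfolding open_pgl2_def by (simp only:)
  qed
  show "open (\<Union>K)" if "\<forall>S\<in>K. open S" for K :: "'a pgl2 set set"
  proof -
    have "{A. invertible A \<and> pgl2_class A \<in> \<Union>K} =
        \<Union> ((\<lambda>S. {A. invertible A \<and> pgl2_class A \<in> S}) ` K)"
      by blast
    moreover have "openin (top_of_set {A. invertible A})
        (\<Union> ((\<lambda>S. {A. invertible A \<and> pgl2_class A \<in> S}) ` K))"
      using that unfolding open_pgl2_def by (intro openin_Union) blast
    ultimately show ?thesis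
      unfolding open_pgl2_def by (simp only:)
  qed
qed

end

text \<open>The map induced by a field embedding; by the lemma below it does not depend on the
  representing matrix.\<close>

definition pgl2_map :: "('f::field \<Rightarrow> 'e::field) \<Rightarrow> 'f pgl2 \<Rightarrow> 'e pgl2" where
  "pgl2_map \<iota> g = pgl2_class (map_matrix \<iota> (rep_pgl2 g))"

lemma pgl2_map_class:
  fixes \<iota> :: "'f::field \<Rightarrow> 'e::field"
  assumes one: "\<iota> 1 = 1" and add: "\<And>x y. \<iota> (x + y) = \<iota> x + \<iota> y"
    and mult: "\<And>x y. \<iota> (x * y) = \<iota> x * \<iota> y" and A: "invertible A"
  shows "pgl2_map \<iota> (pgl2_class A) = pgl2_class (map_matrix \<iota> A)"
proof -
  have zero: "\<iota> 0 = 0"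
    using add[of 0 0] by (metis add_0 add_cancel_right_right)
  have map_mult: "map_matrix \<iota> (B ** C) = map_matrix \<iota> B ** map_matrix \<iota> C" for B C :: "'f^2^2"
    by (simp add: vec_eq_iff matrix_matrix_mult_def sum_2 add mult)
  have map_mat: "map_matrix \<iota> (mat c) = (mat (\<iota> c) :: 'e^2^2)" for c
    by (simp add: vec_eq_iff mat_def zero)
  have map_inv: "invertible (map_matrix \<iota> B)" if "invertible B" for B :: "'f^2^2"
    using that unfolding invertible_def by (metis map_mult map_mat one)
  have "proj_eq (rep_pgl2 (pgl2_class A)) A"
    unfolding pgl2_class_eq_abs[OF A]
    by (rule Quotient_rep_abs[OF Quotient_pgl2 proj_eq_refl[OF A]])
  then obtain c where c: "c \<noteq> 0" "invertible (rep_pgl2 (pgl2_class A))"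
      "rep_pgl2 (pgl2_class A) = mat c ** A"
    unfolding proj_eq_def by blast
  have "\<iota> c \<noteq> 0"
    using c(1) by (metis mult one right_inverse mult_zero_left zero_neq_one)
  moreover have "map_matrix \<iota> (rep_pgl2 (pgl2_class A)) = mat (\<iota> c) ** map_matrix \<iota> A"
    unfolding c(3) map_mult map_mat ..
  ultimately have *: "proj_eq (map_matrix \<iota> (rep_pgl2 (pgl2_class A))) (map_matrix \<iota> A)"
    unfolding proj_eq_def using map_inv[OF c(2)] map_inv[OF A] by blast
  have "abs_pgl2 (map_matrix \<iota> (rep_pgl2 (pgl2_class A))) = abs_pgl2 (map_matrix \<iota> A)"
    using * by (rule Quotient_rel_abs[OF Quotient_pgl2])
  then show ?thesis
    unfolding pgl2_map_def pgl2_class_eq_abs[OF map_inv[OF c(2)]] pgl2_class_eq_abs[OF map_inv[OF A]] .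
qed


section \<open>Unitary representations\<close>

class complex_hilbert = banach +
  fixes scaleC :: "complex \<Rightarrow> 'a \<Rightarrow> 'a" (infixr \<open>*\<^sub>C\<close> 75)
    and cinner :: "'a \<Rightarrow> 'a \<Rightarrow> complex"
  assumes scaleC_add_right: "c *\<^sub>C (x + y) = c *\<^sub>C x + c *\<^sub>C y"
    and scaleC_add_left: "(c + d) *\<^sub>C x = c *\<^sub>C x + d *\<^sub>C x"
    and scaleC_scaleC: "c *\<^sub>C (d *\<^sub>C x) = (c * d) *\<^sub>C x"
    and scaleC_of_real: "complex_of_real r *\<^sub>C x = r *\<^sub>R x"
    and cinner_add_left: "cinner (x + y) z = cinner x z + cinner y z"
    and cinner_scaleC_left: "cinner (c *\<^sub>C x) y = c * cinner x y"
    and cinner_commute: "cinner y x = cnj (cinner x y)"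
    and cinner_self: "cinner x x = complex_of_real ((norm x)\<^sup>2)"

instantiation complex :: complex_hilbert
begin
definition scaleC_complex :: "complex \<Rightarrow> complex \<Rightarrow> complex" where
  "scaleC_complex c x = c * x"
definition cinner_complex :: "complex \<Rightarrow> complex \<Rightarrow> complex" where
  "cinner_complex x y = x * cnj y"
instance
proof
  fix x y z c d :: complex and r :: real
  show "c *\<^sub>C (x + y) = c *\<^sub>C x + c *\<^sub>C y" "(c + d) *\<^sub>C x = c *\<^sub>C x + d *\<^sub>C x"
    "c *\<^sub>C (d *\<^sub>C x) = (c * d) *\<^sub>C x"
    by (simp_all add: scaleC_complex_def distrib_left distrib_right)
  show "complex_of_real r *\<^sub>C x = r *\<^sub>R x"
    by (simp add: scaleC_complex_def scaleR_conv_of_real)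
  show "cinner (x + y) z = cinner x z + cinner y z" "cinner (c *\<^sub>C x) y = c * cinner x y"
    "cinner y x = cnj (cinner x y)"
    by (simp_all add: cinner_complex_def scaleC_complex_def algebra_simps)
  show "cinner x x = complex_of_real ((norm x)\<^sup>2)"
    unfolding cinner_complex_def by (rule complex_norm_square[symmetric])
qed
end

definition isometric_map :: "('h::complex_hilbert \<Rightarrow> 'k::complex_hilbert) \<Rightarrow> bool" where
  "isometric_map T \<longleftrightarrow>
     (\<forall>x y. T (x + y) = T x + T y) \<and> (\<forall>c x. T (c *\<^sub>C x) = c *\<^sub>C T x) \<and>
     (\<forall>x y. cinner (T x) (T y) = cinner x y)"

definition unitary_rep ::
    "('g::{monoid_mult, topological_space} \<Rightarrow> 'h::complex_hilbert \<Rightarrow> 'h) \<Rightarrow> bool" where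
  "unitary_rep \<rho> \<longleftrightarrow>
     (\<forall>g. isometric_map (\<rho> g) \<and> surj (\<rho> g)) \<and>
     \<rho> 1 = id \<and> (\<forall>g h. \<rho> (g * h) = \<rho> g \<circ> \<rho> h) \<and>
     (\<forall>v. continuous_on UNIV (\<lambda>g. \<rho> g v))"

definition left_translation ::
    "'g::{monoid_mult, inverse} \<Rightarrow> ('g \<Rightarrow> complex) \<Rightarrow> 'g \<Rightarrow> complex" where
  "left_translation g f h = f (inverse g * h)"

text \<open>\<open>\<rho>\<close> is the extension of left translation on the function space \<open>V\<close> to the Hilbert space
  completion of \<open>V\<close> with respect to the inner product \<open>B\<close>; the completion is characterized by the
  isometric linear map \<open>j\<close> from \<open>V\<close> onto a dense subspace.\<close>

definition hilbert_completion ::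
    "('g::{monoid_mult, inverse, topological_space} \<Rightarrow> complex) set \<Rightarrow>
     (('g \<Rightarrow> complex) \<Rightarrow> ('g \<Rightarrow> complex) \<Rightarrow> complex) \<Rightarrow>
     ('g \<Rightarrow> 'h::complex_hilbert \<Rightarrow> 'h) \<Rightarrow> bool" where
  "hilbert_completion V B \<rho> \<longleftrightarrow>
     unitary_rep \<rho> \<and>
     (\<exists>j :: ('g \<Rightarrow> complex) \<Rightarrow> 'h.
        (\<forall>f1\<in>V. \<forall>f2\<in>V. j (\<lambda>g. f1 g + f2 g) = j f1 + j f2) \<and>
        (\<forall>c. \<forall>f\<in>V. j (\<lambda>g. c * f g) = c *\<^sub>C j f) \<and>
        (\<forall>f1\<in>V. \<forall>f2\<in>V. cinner (j f1) (j f2) = B f1 f2) \<and>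
        closure (j ` V) = UNIV \<and>
        (\<forall>g. \<forall>f\<in>V. \<rho> g (j f) = j (left_translation g f)))"

definition contains_direct_summand ::
    "('g \<Rightarrow> 'h::complex_hilbert \<Rightarrow> 'h) \<Rightarrow> ('g \<Rightarrow> 'k::complex_hilbert \<Rightarrow> 'k) \<Rightarrow> bool" where
  "contains_direct_summand \<rho> T \<longleftrightarrow>
     (\<exists>W. closed W \<and> 0 \<in> W \<and> (\<forall>v\<in>W. \<forall>w\<in>W. v + w \<in> W) \<and> (\<forall>c. \<forall>v\<in>W. c *\<^sub>C v \<in> W) \<and>
        (\<forall>g. \<forall>v\<in>W. \<rho> g v \<in> W) \<and>
        (\<exists>U. isometric_map U \<and> range U = W \<and> (\<forall>g v. U (T g v) = \<rho> g (U v))))"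


section \<open>Complementary series and Steinberg representations of PGL(2)\<close>

definition borel_elt :: "'k::field \<Rightarrow> 'k \<Rightarrow> 'k pgl2" where
  "borel_elt a b = pgl2_class (vector [vector [a, b], vector [0, 1]])"

definition nbar :: "'k::field \<Rightarrow> 'k pgl2" where
  "nbar x = pgl2_class (vector [vector [1, 0], vector [x, 1]])"

definition locally_constant :: "('g::topological_space \<Rightarrow> complex) \<Rightarrow> bool" where
  "locally_constant f \<longleftrightarrow> (\<forall>g. \<exists>U. open U \<and> g \<in> U \<and> f constant_on U)"

definition induced_space ::
    "'k::nonarch_local_field \<Rightarrow> ('k \<Rightarrow> complex) \<Rightarrow> complex \<Rightarrow> ('k pgl2 \<Rightarrow> complex) set" where
  "induced_space \<pi> chi s =
     {f. locally_constant f \<and>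
         (\<forall>g a b. a \<noteq> 0 \<longrightarrow> f (g * borel_elt a b) = inverse (char_twist \<pi> chi (s + 1/2) a) * f g)}"

definition complementary_form ::
    "'k::nonarch_local_field measure \<Rightarrow> real \<Rightarrow>
     ('k pgl2 \<Rightarrow> complex) \<Rightarrow> ('k pgl2 \<Rightarrow> complex) \<Rightarrow> complex" where
  "complementary_form M s f1 f2 =
     (LINT x|M. LINT x'|M.
        complex_of_real (absval (x - x') powr (2 * s - 1)) * f1 (nbar x) * cnj (f2 (nbar x')))"

definition complementary_series ::
    "'k::nonarch_local_field \<Rightarrow> 'k measure \<Rightarrow> ('k \<Rightarrow> complex) \<Rightarrow> real \<Rightarrow>
     ('k pgl2 \<Rightarrow> 'h::complex_hilbert \<Rightarrow> 'h) \<Rightarrow> bool" where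
  "complementary_series \<pi> M chi s \<rho> \<longleftrightarrow>
     hilbert_completion (induced_space \<pi> chi (complex_of_real s)) (complementary_form M s) \<rho>"

definition steinberg_space ::
    "'k::nonarch_local_field \<Rightarrow> 'k measure \<Rightarrow> ('k \<Rightarrow> complex) \<Rightarrow> ('k pgl2 \<Rightarrow> complex) set" where
  "steinberg_space \<pi> M chi = {f \<in> induced_space \<pi> chi (1/2). (LINT x|M. f (nbar x)) = 0}"

definition fourier_nbar ::
    "'k::nonarch_local_field measure \<Rightarrow> ('k \<Rightarrow> complex) \<Rightarrow> ('k pgl2 \<Rightarrow> complex) \<Rightarrow> 'k \<Rightarrow> complex" where
  "fourier_nbar M \<psi> f y = (LINT x|M. f (nbar x) * \<psi> (x * y))"

definition steinberg_form ::
    "'k::nonarch_local_field measure \<Rightarrow> ('k \<Rightarrow> complex) \<Rightarrow>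
     ('k pgl2 \<Rightarrow> complex) \<Rightarrow> ('k pgl2 \<Rightarrow> complex) \<Rightarrow> complex" where
  "steinberg_form M \<psi> f1 f2 =
     (LINT x|M. fourier_nbar M \<psi> f1 x * cnj (fourier_nbar M \<psi> f2 x) *
        complex_of_real (inverse (absval x)))"

definition steinberg_rep ::
    "'k::nonarch_local_field \<Rightarrow> 'k measure \<Rightarrow> ('k \<Rightarrow> complex) \<Rightarrow> ('k \<Rightarrow> complex) \<Rightarrow>
     ('k pgl2 \<Rightarrow> 'h::complex_hilbert \<Rightarrow> 'h) \<Rightarrow> bool" where
  "steinberg_rep \<pi> M \<psi> chi \<rho> \<longleftrightarrow>
     hilbert_completion (steinberg_space \<pi> M chi) (steinberg_form M \<psi>) \<rho>"

end

theory Submission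
  imports Defs
begin

text \<open>
  Restricting a function from the projective line over the larger field \<open>E\<close> to the one over the
  smaller field \<open>F\<close> intertwines the parameters \<open>s\<close> and \<open>2 s + 1/2\<close>. The embedding in question is dual to this:
  a function \<open>\<phi>\<close> on \<open>F\<close> is sent to the measure \<open>\<phi> dF\<close> on \<open>E\<close> supported on \<open>F\<close>. It is isometric because
  the invariant form has kernel \<open>|x - x'|\<close> to the power \<open>2 s - 1\<close>, the absolute value of \<open>E\<close> restricts to
  the square of that of \<open>F\<close>, and \<open>2 (2 s - 1) = 2 t - 1\<close>. In the Steinberg case the kernel is
  \<open>- log |x - x'|\<close> up to a positive factor, on functions of mean zero, and the embedding is isometric
  up to a scalar.

  The measure is a limit of locally constant functions: \<open>\<phi>\<close> is written as a combination of
  indicators of small balls in \<open>F\<close>, and each ball is replaced by a ball in \<open>E\<close> with the square of its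
  radius, weighted to the same mass. Disjoint balls then interact in \<open>E\<close> exactly as in \<open>F\<close>, and the
  nested pairs contribute an error tending to 0 since \<open>t > 0\<close>. As the radii may vary from ball to
  ball, the generators of the group map such approximations exactly to such approximations, which
  gives equivariance.
\<close>

section \<open>Balls in a valued field\<close>

text \<open>Two obstacles shape the proof. The generators \<open>nbar a\<close> and
  \<open>borel_elt a 0\<close> act affinely on the coordinate and carry balls to balls, but
  \<open>weyl\<close> inverts the coordinate: a ball around 0 becomes a neighbourhood of infinity,
  and only balls avoiding 0 have balls as images. Equivariance under \<open>weyl\<close> is
  therefore tested on functions that vanish near 0 and near infinity. These are dense because a
  point has capacity zero: the indicator of a small ball has norm tending to 0, so the value of a
  function at one point can be removed at arbitrarily small cost. The Steinberg form lives on the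
  Fourier side. For mean zero the transform vanishes near the origin, and the transform of 1/|x| is
  a logarithm up to a constant depending on a cutoff, which mean zero removes. In both cases the
  form becomes a finite matrix indexed by pairs of balls, and one argument serves both. That the
  absolute value is squared under the embedding amounts to q_E^e = q_F^2, with e the ramification
  index; it is read off from the growth of Haar volumes of lattices and balls.\<close>

definition vge :: "int \<Rightarrow> 'k::discretely_valued_field \<Rightarrow> bool" where
  "vge n x \<longleftrightarrow> x = 0 \<or> n \<le> val x"

text \<open>Balls are indexed by the exponent n of the radius, so a larger n means a smaller ball.
  Membership goes through \<open>vge\<close> because \<open>val 0\<close> carries no information;
  \<open>vge n\<close> describes the n-th power of the maximal ideal, with 0 included.\<close>

definition vball :: "'k::discretely_valued_field \<Rightarrow> int \<Rightarrow> 'k set" where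
  "vball x n = {y. vge n (y - x)}"

abbreviation resq :: "'k::discretely_valued_field itself \<Rightarrow> real" where
  "resq _ \<equiv> real (card (residue_classes :: 'k set set))"

section \<open>Valuations and the ultrametric inequality\<close>

lemma val_one [simp]: "val (1 :: 'k::discretely_valued_field) = 0"
  using val_mult[of "1 :: 'k" 1] by simp

lemma val_minus [simp]: "val (- x) = val x" for x :: "'k::discretely_valued_field"
proof (cases "x = 0")
  case False
  have "val (-1 :: 'k) + val (-1 :: 'k) = 0"
    using val_mult[of "-1 :: 'k" "-1"] by simp
  then have "val (-1 :: 'k) = 0" by simp
  then show ?thesis using val_mult[of "-1" x] False by simp
qed simp

lemma val_minus_commute: "val (x - y) = val (y - x)" for x :: "'k::discretely_valued_field"
  using val_minus[of "x - y"] by simp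

lemma val_inverse: "x \<noteq> 0 \<Longrightarrow> val (inverse x) = - val x" for x :: "'k::discretely_valued_field"
  using val_mult[of x "inverse x"] by simp

lemma val_divide: "x \<noteq> 0 \<Longrightarrow> y \<noteq> 0 \<Longrightarrow> val (x / y) = val x - val y" for x :: "'k::discretely_valued_field"
  by (simp add: divide_inverse val_mult val_inverse)

lemma val_power: "x \<noteq> 0 \<Longrightarrow> val (x ^ n) = int n * val x" for x :: "'k::discretely_valued_field"
  by (induction n) (auto simp: val_mult algebra_simps)

lemma val_powi: "x \<noteq> 0 \<Longrightarrow> val (x powi n) = n * val x" for x :: "'k::discretely_valued_field"
  using val_power[of x "nat n"] val_power[of "inverse x" "nat (- n)"]
  by (cases "n \<ge> 0") (simp_all add: power_int_def val_inverse)

lemma vge_0 [simp]: "vge n 0" by (simp add: vge_def)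

lemma vge_minus [simp]: "vge n (- x) \<longleftrightarrow> vge n x" by (simp add: vge_def)

lemma vge_add: "vge n x \<Longrightarrow> vge n y \<Longrightarrow> vge n (x + y)"
  using val_add[of x y] unfolding vge_def by (cases "x = 0"; cases "y = 0"; cases "x + y = 0") auto

lemma vge_diff: "vge n x \<Longrightarrow> vge n y \<Longrightarrow> vge n (x - y)"
  using vge_add[of n x "- y"] by simp

lemma vge_diff_commute: "vge n (x - y) \<longleftrightarrow> vge n (y - x)"
  using vge_minus[of n "x - y"] by simp

lemma vge_mono: "vge n x \<Longrightarrow> m \<le> n \<Longrightarrow> vge m x" by (auto simp: vge_def)

lemma vge_times_iff: "a \<noteq> 0 \<Longrightarrow> vge n (a * x) \<longleftrightarrow> vge (n - val a) x"
  by (cases "x = 0") (auto simp: vge_def val_mult)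

lemma vge_mult: "vge n x \<Longrightarrow> vge m y \<Longrightarrow> vge (n + m) (x * y)"
  by (cases "x = 0"; cases "y = 0") (auto simp: vge_def val_mult)

text \<open>In an ultrametric sum the term of strictly smaller valuation wins; the upper bound comes
  from writing x as (x + y) - y.\<close>

lemma val_add_eq:
  assumes "x \<noteq> 0" "vge (val x + 1) y"
  shows "x + y \<noteq> 0 \<and> val (x + y) = val x"
proof (cases "y = 0")
  case False
  then have y: "val y > val x" using assms by (auto simp: vge_def)
  have ne: "x + y \<noteq> 0"
    using y by (metis add_eq_0_iff less_irrefl val_minus)
  have 1: "val x \<le> val (x + y)" using val_add[OF assms(1) False ne] y by simp
  have "min (val (x + y)) (val y) \<le> val x"
    using val_add[OF ne, of "- y"] False assms(1) by simp
  then show ?thesis using 1 y ne by auto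
qed (use assms in auto)

lemma vball_iff: "y \<in> vball x n \<longleftrightarrow> vge n (y - x)" by (simp add: vball_def)

lemma vball_centre [simp]: "x \<in> vball x n" by (simp add: vball_iff)

lemma vball_sym: "y \<in> vball x n \<longleftrightarrow> x \<in> vball y n"
  by (simp add: vball_iff vge_diff_commute)

lemma vball_trans: "y \<in> vball x n \<Longrightarrow> z \<in> vball y n \<Longrightarrow> z \<in> vball x n"
  using vge_add[of n "z - y" "y - x"] by (simp add: vball_iff)

lemma vball_mono: "m \<le> n \<Longrightarrow> vball x n \<subseteq> vball x m"
  by (auto simp: vball_iff intro: vge_mono)

lemma vball_subset: "y \<in> vball x m \<Longrightarrow> m \<le> n \<Longrightarrow> vball y n \<subseteq> vball x m"
  using vball_mono vball_trans by blast

lemma vball_eq: "y \<in> vball x n \<Longrightarrow> vball y n = vball x n"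
  using vball_subset vball_sym by blast

text \<open>Two balls are nested or disjoint, and the larger of the two radii, that is the smaller
  exponent, decides which.\<close>

lemma vball_disjnt_iff: "vball x n \<inter> vball y m = {} \<longleftrightarrow> y \<notin> vball x (min n m)"
proof
  assume "vball x n \<inter> vball y m = {}"
  then show "y \<notin> vball x (min n m)"
    using vball_centre[of y m] vball_centre[of x n] vball_sym[of x y m]
    by (cases "n \<le> m") (auto simp: min_def simp del: vball_centre)
next
  assume *: "y \<notin> vball x (min n m)"
  show "vball x n \<inter> vball y m = {}"
  proof (rule ccontr)
    assume "vball x n \<inter> vball y m \<noteq> {}"
    then obtain z where "z \<in> vball x n" "z \<in> vball y m" by blast
    then have "z \<in> vball x (min n m)" "z \<in> vball y (min n m)"
      using vball_mono[of "min n m" n x] vball_mono[of "min n m" m y] by auto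
    then have "z \<in> vball x (min n m)" "y \<in> vball z (min n m)"
      using vball_sym by auto
    then show False using * vball_trans by blast
  qed
qed

lemma vball_translate: "(+) a ` vball x n = vball (a + x) n"
proof -
  have "y \<in> (+) a ` vball x n" if "y \<in> vball (a + x) n" for y
    using that by (intro image_eqI[of _ _ "y - a"]) (auto simp: vball_iff algebra_simps)
  then show ?thesis by (auto simp: vball_iff)
qed

lemma uniformizer_exists: "\<exists>\<pi>::'k::discretely_valued_field. uniformizer \<pi>"
  using val_surj unfolding uniformizer_def by blast

lemma exists_val: "\<exists>x::'k::discretely_valued_field. x \<noteq> 0 \<and> val x = n"
proof -
  obtain \<pi> :: 'k where "\<pi> \<noteq> 0" "val \<pi> = 1" using val_surj by blast
  then have "\<pi> powi n \<noteq> 0 \<and> val (\<pi> powi n) = n" by (simp add: val_powi)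
  then show ?thesis by blast
qed

text \<open>Residue classes are traded for a transversal inside the ring of integers; scaled by an
  element of valuation n, it splits a ball of exponent n into balls of the next exponent.\<close>

lemma residue_reps:
  "\<exists>R::'k::nonarch_local_field set. finite R \<and> card R = card (residue_classes :: 'k set set) \<and>
     (\<forall>r\<in>R. vge 0 r) \<and> (\<forall>x. vge 0 x \<longrightarrow> (\<exists>!r. r \<in> R \<and> vge 1 (x - r)))"
proof -
  let ?O = "ring_of_integers :: 'k set"
  let ?r = "{(x, y). x \<in> ?O \<and> y \<in> ?O \<and> x - y \<in> maximal_ideal}"
  have O: "x \<in> ?O \<longleftrightarrow> vge 0 x" for x by (simp add: ring_of_integers_def vge_def)
  have P: "x \<in> maximal_ideal \<longleftrightarrow> vge 1 x" for x :: 'k by (simp add: maximal_ideal_def vge_def)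
  have eq: "equiv ?O ?r"
  proof (rule equivI)
    show "?r \<subseteq> ?O \<times> ?O" by auto
    show "refl_on ?O ?r" by (auto simp: refl_on_def O P)
    show "sym ?r" by (auto simp: sym_def P vge_diff_commute)
    show "trans ?r" using vge_add[of 1 "x - y" "y - z" for x y z :: 'k] by (auto simp: trans_def P)
  qed
  define c where "c C = (SOME x. x \<in> C)" for C :: "'k set"
  have c: "c C \<in> C" if "C \<in> ?O // ?r" for C
    using in_quotient_imp_non_empty[OF eq that] by (auto simp: c_def intro: someI)
  have cO: "c C \<in> ?O" if "C \<in> ?O // ?r" for C
    using c[OF that] in_quotient_imp_subset[OF eq that] by blast
  have inj: "inj_on c (?O // ?r)"
  proof (rule inj_onI)
    fix C D assume CD: "C \<in> ?O // ?r" "D \<in> ?O // ?r" "c C = c D"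
    have "c C \<in> C \<inter> D" using c[OF CD(1)] c[OF CD(2)] CD(3) by simp
    then show "C = D" using quotient_disj[OF eq CD(1,2)] by blast
  qed
  have Q: "residue_classes = ?O // ?r" by (simp add: residue_classes_def)
  show ?thesis
  proof (intro exI[of _ "c ` residue_classes"] conjI allI impI ballI)
    show "finite (c ` residue_classes)" using finite_residue_classes[where 'a='k] by simp
    show "card (c ` residue_classes) = card (residue_classes :: 'k set set)"
      using inj by (simp add: Q card_image)
    show "vge 0 r" if "r \<in> c ` residue_classes" for r
      using that cO by (auto simp: Q O[symmetric])
    fix x :: 'k assume "vge 0 x"
    then have x: "x \<in> ?O" by (simp add: O)
    let ?C = "?r `` {x}"
    have C: "?C \<in> ?O // ?r" using x by (rule quotientI)
    show "\<exists>!r. r \<in> c ` residue_classes \<and> vge 1 (x - r)"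
    proof (intro ex1I conjI)
      show "c ?C \<in> c ` residue_classes" using C by (simp add: Q)
      show "vge 1 (x - c ?C)" using c[OF C] unfolding Image_singleton_iff mem_Collect_eq prod.case P by blast
      fix r assume "r \<in> c ` residue_classes \<and> vge 1 (x - r)"
      then obtain D where D: "D \<in> ?O // ?r" "r = c D" "vge 1 (x - c D)" by (auto simp: Q)
      then have "c D \<in> ?C" using x cO by (auto simp: P)
      then have "D = ?C" using quotient_disj[OF eq D(1) C] c[OF D(1)] by blast
      then show "r = c ?C" using D by simp
    qed
  qed
qed

lemma resq_gt_1: "resq TYPE('k::nonarch_local_field) > 1"
proof -
  obtain R :: "'k set" where R: "finite R" "card R = card (residue_classes :: 'k set set)"
     "\<forall>x. vge 0 x \<longrightarrow> (\<exists>!r. r \<in> R \<and> vge 1 (x - r))" using residue_reps by blast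
  have v: "vge 0 (1::'k)" "\<not> vge 1 (1::'k)" by (auto simp: vge_def)
  obtain r0 where r0: "r0 \<in> R" "vge 1 (0 - r0)" using R(3) vge_0 by blast
  obtain r1 where r1: "r1 \<in> R" "vge 1 (1 - r1)" using R(3) v by blast
  have "r0 \<noteq> r1" using r0 r1 v vge_diff[of 1 "1 - r1" "0 - r1"] by auto
  then have "card {r0, r1} \<le> card R" using R r0 r1 by (intro card_mono) auto
  with \<open>r0 \<noteq> r1\<close> show ?thesis using R(2) by simp
qed

lemma resq_gt_0: "resq TYPE('k::nonarch_local_field) > 0"
  using resq_gt_1[where 'k='k] by linarith

lemma absval_eq: "x \<noteq> 0 \<Longrightarrow> absval x = resq TYPE('k) powr (- real_of_int (val x))"
  for x :: "'k::nonarch_local_field"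
  using resq_gt_0[where 'k='k] by (simp add: absval_def powr_real_of_int' flip: of_int_minus)

lemma absval_0 [simp]: "absval 0 = 0" by (simp add: absval_def)

lemma absval_pos: "x \<noteq> 0 \<Longrightarrow> absval x > 0" for x :: "'k::nonarch_local_field"
  using resq_gt_0[where 'k='k] by (simp add: absval_eq)

lemma absval_nonneg: "absval x \<ge> 0" for x :: "'k::nonarch_local_field"
  using absval_pos[of x] by (cases "x = 0") auto

lemma absval_mult: "absval (x * y) = absval x * absval y" for x :: "'k::nonarch_local_field"
  using resq_gt_0[where 'k='k]
  by (cases "x = 0"; cases "y = 0") (auto simp: absval_eq val_mult powr_add[symmetric])

lemma absval_powr: "x \<noteq> 0 \<Longrightarrow> absval x powr s = resq TYPE('k) powr (- real_of_int (val x) * s)"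
  for x :: "'k::nonarch_local_field"
  by (simp add: absval_eq powr_powr)

lemma absval_le_iff: "absval x \<le> resq TYPE('k) powr (- real_of_int n) \<longleftrightarrow> vge n x"
  for x :: "'k::nonarch_local_field"
  using resq_gt_1[where 'k='k] by (cases "x = 0") (auto simp: absval_eq vge_def)

section \<open>The topology in terms of balls\<close>

lemma dist_le_iff: "dist x y \<le> resq TYPE('k) powr (- real_of_int n) \<longleftrightarrow> x \<in> vball y n"
  for x :: "'k::nonarch_local_field"
  by (simp add: dist_absval absval_le_iff vball_iff)

lemma exists_powr_less:
  assumes "e > 0" shows "\<exists>n::int. resq TYPE('k::nonarch_local_field) powr (- real_of_int n) < e"
proof -
  let ?q = "resq TYPE('k)"
  obtain n where "1 / e < ?q ^ n" using real_arch_pow[OF resq_gt_1] by blast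
  then have "?q powr (- real n) < e"
    using assms resq_gt_0[where 'k='k] by (simp add: powr_minus powr_realpow field_simps)
  then show ?thesis by (intro exI[of _ "int n"]) simp
qed

text \<open>The balls of integer exponent form a neighbourhood base, which turns every limit
  statement into one about valuations.\<close>

lemma eventually_nhds_vball: "eventually P (nhds x) \<longleftrightarrow> (\<exists>n. \<forall>y\<in>vball x n. P y)"
  for x :: "'k::nonarch_local_field"
proof
  assume "eventually P (nhds x)"
  then obtain d where d: "d > 0" "\<And>y. dist y x < d \<Longrightarrow> P y"
    unfolding eventually_nhds_metric by blast
  obtain n where "resq TYPE('k) powr (- real_of_int n) < d" using exists_powr_less[OF d(1)] by blast
  then show "\<exists>n. \<forall>y\<in>vball x n. P y"
    using d(2) by (intro exI[of _ n]) (auto simp flip: dist_le_iff)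
next
  assume "\<exists>n. \<forall>y\<in>vball x n. P y"
  then obtain n where n: "\<And>y. y \<in> vball x n \<Longrightarrow> P y" by blast
  show "eventually P (nhds x)" unfolding eventually_nhds_metric
    using n resq_gt_0[where 'k='k]
    by (intro exI[of _ "resq TYPE('k) powr (- real_of_int n)"]) (auto simp flip: dist_le_iff)
qed

lemma tendsto_vball_iff: "(f \<longlongrightarrow> l) F \<longleftrightarrow> (\<forall>n. eventually (\<lambda>z. f z \<in> vball l n) F)"
  for l :: "'k::nonarch_local_field"
proof
  assume "(f \<longlongrightarrow> l) F"
  moreover have "eventually (\<lambda>y. y \<in> vball l n) (nhds l)" for n
    using eventually_nhds_vball by blast
  ultimately show "\<forall>n. eventually (\<lambda>z. f z \<in> vball l n) F"
    unfolding filterlim_iff by blast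
next
  assume *: "\<forall>n. eventually (\<lambda>z. f z \<in> vball l n) F"
  show "(f \<longlongrightarrow> l) F" unfolding filterlim_iff eventually_nhds_vball
  proof (intro allI impI)
    fix P assume "\<exists>n. \<forall>y\<in>vball l n. P y"
    then obtain n where "\<And>y. y \<in> vball l n \<Longrightarrow> P y" by blast
    with *[rule_format, of n] show "eventually (\<lambda>x. P (f x)) F" by (auto elim: eventually_mono)
  qed
qed

lemma open_vball: "open (vball x n)" for x :: "'k::nonarch_local_field"
proof -
  have "eventually (\<lambda>z. z \<in> vball x n) (nhds y)" if "y \<in> vball x n" for y
    unfolding eventually_nhds_vball using that vball_trans by blast
  then show ?thesis unfolding open_subopen[of "vball x n"] eventually_nhds by (meson subsetI)
qed

lemma closed_vball: "closed (vball x n)" for x :: "'k::nonarch_local_field"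
proof -
  have "- vball x n = (\<Union>y\<in>- vball x n. vball y n)"
  proof -
    have "z \<notin> vball x n" if "y \<notin> vball x n" "z \<in> vball y n" for y z
      using that vball_trans vball_sym by blast
    then show ?thesis using vball_centre by blast
  qed
  then show ?thesis unfolding closed_def using open_vball by (metis open_UN)
qed

text \<open>The class provides only a metric given by the absolute value; continuity of the field
  operations is derived from the ultrametric inequality, so that limits can be computed by the
  general rules.\<close>

instance nonarch_local_field \<subseteq> topological_group_add
proof
  fix a b :: 'a
  show "((\<lambda>x. fst x + snd x) \<longlongrightarrow> a + b) (nhds a \<times>\<^sub>F nhds b)"
    unfolding tendsto_vball_iff
  proof
    fix n
    have "eventually (\<lambda>x. x \<in> vball a n) (nhds a)" "eventually (\<lambda>x. x \<in> vball b n) (nhds b)"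
      using eventually_nhds_vball by blast+
    from eventually_prodI[OF this]
    show "\<forall>\<^sub>F x in nhds a \<times>\<^sub>F nhds b. fst x + snd x \<in> vball (a + b) n"
    proof (rule eventually_mono)
      fix x assume "fst x \<in> vball a n \<and> snd x \<in> vball b n"
      then show "fst x + snd x \<in> vball (a + b) n"
        using vge_add[of n "fst x - a" "snd x - b"] by (simp add: vball_iff algebra_simps)
    qed
  qed
  show "(uminus \<longlongrightarrow> - a) (nhds a)"
    unfolding tendsto_vball_iff
  proof
    fix n
    have "eventually (\<lambda>x. x \<in> vball a n) (nhds a)" using eventually_nhds_vball by blast
    then show "eventually (\<lambda>x. - x \<in> vball (- a) n) (nhds a)"
      by (rule eventually_mono) (simp add: vball_iff vge_diff_commute)
  qed
qed

instance nonarch_local_field \<subseteq> topological_semigroup_mult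
proof
  fix a b :: 'a
  show "((\<lambda>x. fst x * snd x) \<longlongrightarrow> a * b) (nhds a \<times>\<^sub>F nhds b)"
    unfolding tendsto_vball_iff
  proof
    fix n
    \<comment> \<open>In the expansion around (a, b) the product of the two errors needs m above n
      and 0, and the two cross terms need m to absorb the valuations of a and b.\<close>
    obtain m where m: "m \<ge> n" "m \<ge> 0" "vge (n - m) a" "vge (n - m) b"
    proof -
      define m where "m = max (max n 0) (max (n - val a) (n - val b))"
      show ?thesis by (rule that[of m]) (auto simp: vge_def m_def)
    qed
    have "eventually (\<lambda>x. x \<in> vball a m) (nhds a)" "eventually (\<lambda>x. x \<in> vball b m) (nhds b)"
      using eventually_nhds_vball by blast+
    from eventually_prodI[OF this]
    show "\<forall>\<^sub>F x in nhds a \<times>\<^sub>F nhds b. fst x * snd x \<in> vball (a * b) n"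
    proof (rule eventually_mono)
      fix x assume "fst x \<in> vball a m \<and> snd x \<in> vball b m"
      then have x: "vge m (fst x - a)" "vge m (snd x - b)" by (auto simp: vball_iff)
      have 1: "vge n ((fst x - a) * (snd x - b))"
        using vge_mult[OF x] m by (auto intro: vge_mono)
      have 2: "vge n ((fst x - a) * b)" "vge n (a * (snd x - b))"
        using vge_mult[OF x(1) m(4)] vge_mult[OF m(3) x(2)] by auto
      have "fst x * snd x - a * b = (fst x - a) * (snd x - b) + (fst x - a) * b + a * (snd x - b)"
        by (simp add: algebra_simps)
      then show "fst x * snd x \<in> vball (a * b) n"
        using vge_add[OF vge_add[OF 1 2(1)] 2(2)] by (simp add: vball_iff)
    qed
  qed
qed

section \<open>Haar measure of balls\<close>

text \<open>A transversal R of the balls of exponent m inside the ball of exponent n around x, that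
  is of the cosets of one power of the maximal ideal in another, translated by x.\<close>

definition vreps :: "'k::discretely_valued_field \<Rightarrow> int \<Rightarrow> int \<Rightarrow> 'k set \<Rightarrow> bool" where
  "vreps x n m R \<longleftrightarrow> finite R \<and> R \<subseteq> vball x n \<and> (\<forall>y\<in>vball x n. \<exists>r\<in>R. y \<in> vball r m) \<and>
     (\<forall>r\<in>R. \<forall>s\<in>R. s \<in> vball r m \<longrightarrow> s = r)"

lemma vreps_step:
  "\<exists>R::'k::nonarch_local_field set. card R = card (residue_classes :: 'k set set) \<and>
     vreps x n (n + 1) R"
proof -
  obtain R :: "'k set" where R: "finite R" "card R = card (residue_classes :: 'k set set)"
    "\<And>r. r \<in> R \<Longrightarrow> vge 0 r" "\<And>x. vge 0 x \<Longrightarrow> \<exists>!r. r \<in> R \<and> vge 1 (x - r)"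
    using residue_reps by metis
  obtain p :: 'k where p: "p \<noteq> 0" "val p = n" using exists_val by blast
  let ?h = "\<lambda>r. x + p * r"
  have inj: "inj_on ?h R" using p by (auto simp: inj_on_def)
  have sub: "?h ` R \<subseteq> vball x n" using R(3) p by (auto simp: vball_iff vge_times_iff)
  have key: "y \<in> vball (?h r) (n + 1) \<longleftrightarrow> vge 1 ((y - x) / p - r)" for r y
  proof -
    have "y - ?h r = p * ((y - x) / p - r)" using p by (simp add: field_simps)
    then show ?thesis using p by (simp add: vball_iff vge_times_iff)
  qed
  have ex: "\<exists>r\<in>?h ` R. y \<in> vball r (n + 1)" if y: "y \<in> vball x n" for y
  proof -
    have "y - x = p * ((y - x) / p)" using p by simp
    then have "vge 0 ((y - x) / p)" using y p vge_times_iff[of p n "(y - x) / p"] by (simp add: vball_iff)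
    then obtain r where "r \<in> R" "vge 1 ((y - x) / p - r)" using R(4) by metis
    then show ?thesis using key by blast
  qed
  have un: "?h s = ?h r" if "r \<in> R" "s \<in> R" "?h s \<in> vball (?h r) (n + 1)" for r s
  proof -
    have "vge 1 (s - r)" using that(3) p unfolding key by simp
    moreover have "vge 1 (s - s)" by simp
    ultimately show ?thesis using R(4)[OF R(3)[OF that(2)]] that by metis
  qed
  show ?thesis unfolding vreps_def
  proof (intro exI[of _ "?h ` R"] conjI)
    show "card (?h ` R) = card (residue_classes :: 'k set set)" using inj R(2) by (simp add: card_image)
    show "\<forall>r\<in>?h ` R. \<forall>s\<in>?h ` R. s \<in> vball r (n + 1) \<longrightarrow> s = r" using un by blast
  qed (use R(1) sub ex in blast)+
qed

lemma vrepsD: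
  assumes "vreps x n m R"
  shows "finite R" "R \<subseteq> vball x n" "y \<in> vball x n \<Longrightarrow> \<exists>r\<in>R. y \<in> vball r m"
    "r \<in> R \<Longrightarrow> s \<in> R \<Longrightarrow> s \<in> vball r m \<Longrightarrow> s = r"
  using assms unfolding vreps_def by simp_all

lemma vreps_disjoint: "vreps x n m R \<Longrightarrow> disjoint_family_on (\<lambda>r. vball r m) R"
  unfolding disjoint_family_on_def vreps_def vball_disjnt_iff by auto

lemma vreps_UN: "vreps x n m R \<Longrightarrow> n \<le> m \<Longrightarrow> (\<Union>r\<in>R. vball r m) = vball x n"
  using vball_subset[of _ x n m] unfolding vreps_def by blast

lemma vreps_extend:
  assumes R: "vreps x n m R" and S: "\<And>r. vreps r m l (S r)" and "n \<le> m" "m \<le> l"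
  shows "vreps x n l (\<Union>r\<in>R. S r)"
  unfolding vreps_def
proof (intro conjI ballI impI)
  have sub: "vball s l \<subseteq> vball r m" if "s \<in> S r" for r s
    using S[of r] that \<open>m \<le> l\<close> unfolding vreps_def by (intro vball_subset) auto
  show "finite (\<Union>r\<in>R. S r)" using R S by (simp add: vreps_def)
  show "(\<Union>r\<in>R. S r) \<subseteq> vball x n"
    using vrepsD(2)[OF S] vreps_UN[OF R \<open>n \<le> m\<close>] by blast
  show "\<exists>r\<in>\<Union>r\<in>R. S r. y \<in> vball r l" if "y \<in> vball x n" for y
  proof -
    obtain r where r: "r \<in> R" "y \<in> vball r m" using vrepsD(3)[OF R \<open>y \<in> vball x n\<close>] by blast
    then obtain s where "s \<in> S r" "y \<in> vball s l" using vrepsD(3)[OF S[of r]] by blast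
    then show ?thesis using r by blast
  qed
  fix s s' assume "s \<in> (\<Union>r\<in>R. S r)" "s' \<in> (\<Union>r\<in>R. S r)" and ss: "s' \<in> vball s l"
  then obtain r r' where r: "r \<in> R" "s \<in> S r" "r' \<in> R" "s' \<in> S r'" by blast
  have "s' \<in> vball r m" "s' \<in> vball r' m"
    using sub[OF r(2)] ss sub[OF r(4)] vball_centre by blast+
  then have "r' = r" using vreps_disjoint[OF R] r unfolding disjoint_family_on_def by blast
  then show "s' = s" using vrepsD(4)[OF S[of r], of s s'] r ss by simp
qed

lemma vreps_exists_nat: "\<exists>R::'k::nonarch_local_field set. vreps x n (n + int k) R"
proof (induction k)
  case 0
  have "vreps x n n {x}" unfolding vreps_def by auto
  then show ?case by auto
next
  case (Suc k)
  then obtain R :: "'k set" where R: "vreps x n (n + int k) R" by blast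
  obtain S :: "'k \<Rightarrow> 'k set" where S: "\<And>r. vreps r (n + int k) (n + int k + 1) (S r)"
    using vreps_step[of _ "n + int k"] by metis
  show ?case using vreps_extend[OF R S] by (auto simp: add.assoc add.commute[of 1])
qed

lemma vreps_exists: "n \<le> m \<Longrightarrow> \<exists>R::'k::nonarch_local_field set. vreps x n m R"
  using vreps_exists_nat[of x n "nat (m - n)"] by simp

text \<open>A closed ball is complete, and finitely many subballs of any given radius cover it
  because the residue field is finite.\<close>

lemma compact_vball: "compact (vball x n)" for x :: "'k::nonarch_local_field"
  unfolding compact_eq_totally_bounded
proof (intro conjI allI impI)
  show "complete (vball x n)" using closed_vball complete_eq_closed by blast
  fix e :: real assume "e > 0"
  then obtain m0 where m0: "resq TYPE('k) powr (- real_of_int m0) < e" using exists_powr_less by blast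
  define m where "m = max m0 n"
  have "resq TYPE('k) powr (- real_of_int m) \<le> resq TYPE('k) powr (- real_of_int m0)"
    using resq_gt_1[where 'k='k] by (intro powr_mono) (auto simp: m_def)
  then have m: "resq TYPE('k) powr (- real_of_int m) < e" using m0 by linarith
  obtain R :: "'k set" where R: "finite R" "\<And>y. y\<in>vball x n \<Longrightarrow> \<exists>r. r \<in> R \<and> y \<in> vball r m"
    using vreps_exists[of n m x] unfolding m_def vreps_def by force
  have "vball r m \<subseteq> ball r e" for r :: 'k
    using m by (auto simp: dist_commute simp flip: dist_le_iff)
  then show "\<exists>k. finite k \<and> vball x n \<subseteq> (\<Union>x\<in>k. ball x e)"
    using R by (intro exI[of _ R]) blast
qed

definition volball :: "'k::nonarch_local_field measure \<Rightarrow> int \<Rightarrow> real" where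
  "volball M n = measure M (vball 0 n)"

lemma haar_sets: "haar_measure M \<Longrightarrow> sets M = sets borel"
  by (simp add: haar_measure_def)

lemma haar_space: "haar_measure M \<Longrightarrow> space M = UNIV"
  using haar_sets[THEN sets_eq_imp_space_eq] by simp

lemma haar_translate:
  "haar_measure M \<Longrightarrow> A \<in> sets M \<Longrightarrow> emeasure M ((+) x ` A) = emeasure M A"
  by (simp add: haar_measure_def)

lemma haar_compact: "haar_measure M \<Longrightarrow> compact K \<Longrightarrow> emeasure M K < \<infinity>"
  by (simp add: haar_measure_def)

lemma haar_open: "haar_measure M \<Longrightarrow> open U \<Longrightarrow> x \<in> U \<Longrightarrow> emeasure M U > 0"
  unfolding haar_measure_def by (metis empty_iff)

lemma vball_haar [simp]: "haar_measure M \<Longrightarrow> vball x n \<in> sets M"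
  by (simp add: haar_sets borel_open open_vball)

lemma emeasure_vball:
  assumes "haar_measure M" shows "emeasure M (vball x n) = ennreal (volball M n)"
proof -
  have "emeasure M (vball x n) = emeasure M (vball 0 n)"
    using haar_translate[OF assms vball_haar[OF assms], of x 0 n] by (simp add: vball_translate)
  also have "\<dots> = ennreal (volball M n)"
    using haar_compact[OF assms compact_vball] unfolding volball_def
    by (intro emeasure_eq_ennreal_measure) (metis less_irrefl infinity_ennreal_def)
  finally show ?thesis .
qed

lemma measure_vball:
  assumes "haar_measure M" shows "measure M (vball x n) = volball M n"
  by (simp add: measure_def emeasure_vball[OF assms]) (simp add: volball_def)

lemma volball_pos:
  assumes "haar_measure M" shows "volball M n > 0"
proof -
  have "emeasure M (vball 0 n) > 0"
    using haar_open[OF assms open_vball vball_centre] .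
  then show ?thesis unfolding emeasure_vball[OF assms] by simp
qed

text \<open>The ball splits into as many translates of the next smaller ball as there are residue
  classes.\<close>

lemma volball_step:
  fixes M :: "'k::nonarch_local_field measure"
  assumes M: "haar_measure M"
  shows "volball M n = resq TYPE('k) * volball M (n + 1)"
proof -
  obtain R :: "'k set" where R: "card R = card (residue_classes :: 'k set set)" "vreps 0 n (n + 1) R"
    using vreps_step[of 0 n] by blast
  have eq: "vball 0 n = (\<Union>r\<in>R. vball r (n + 1))" using vreps_UN[OF R(2)] by simp
  have "finite R" using R by (simp add: vreps_def)
  have "disjoint_family_on (\<lambda>r. vball r (n + 1)) R" by (rule vreps_disjoint[OF R(2)])
  then have "measure M (vball 0 n) = (\<Sum>r\<in>R. measure M (vball r (n + 1)))"
    unfolding eq using \<open>finite R\<close> M by (intro measure_finite_Union) (auto simp: emeasure_vball)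
  then show ?thesis by (simp add: measure_vball[OF M] R(1))
qed

lemma volball_eq:
  fixes M :: "'k::nonarch_local_field measure"
  assumes M: "haar_measure M"
  shows "volball M n = volball M 0 * resq TYPE('k) powr (- real_of_int n)"
proof (induction n rule: int_induct[where k = 0])
  case (step1 i)
  then show ?case using volball_step[OF M, of i] resq_gt_0[where 'k='k]
    by (simp add: powr_diff powr_add powr_minus field_simps)
next
  case (step2 i)
  then show ?case using volball_step[OF M, of "i - 1"] resq_gt_0[where 'k='k]
    by (simp add: powr_diff powr_add powr_minus field_simps)
qed (use resq_gt_0[where 'k='k] in simp)

section \<open>Quadratic extensions\<close>

locale quad_ext =
  fixes \<iota> :: "'f::nonarch_local_field \<Rightarrow> 'e::nonarch_local_field"
  assumes quad: "quadratic_extension \<iota>"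
begin

lemma ext_one [simp]: "\<iota> 1 = 1" and ext_add: "\<iota> (x + y) = \<iota> x + \<iota> y"
  and ext_mult: "\<iota> (x * y) = \<iota> x * \<iota> y" and ext_cont: "continuous_on UNIV \<iota>"
  using quad by (auto simp: quadratic_extension_def)

lemma ext_zero [simp]: "\<iota> 0 = 0"
  using ext_add[of 0 0] by (metis add_0 add_cancel_right_right)

lemma ext_minus: "\<iota> (- x) = - \<iota> x"
  using ext_add[of x "- x"] by (simp add: minus_unique)

lemma ext_diff: "\<iota> (x - y) = \<iota> x - \<iota> y"
  using ext_add[of x "- y"] by (simp add: ext_minus)

lemma ext_eq_0_iff [simp]: "\<iota> x = 0 \<longleftrightarrow> x = 0"
proof
  assume "\<iota> x = 0"
  then have "\<iota> (x * inverse x) = 0" by (simp add: ext_mult)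
  then show "x = 0" by (metis ext_one right_inverse zero_neq_one)
qed simp

lemma ext_inverse: "\<iota> (inverse x) = inverse (\<iota> x)"
proof (cases "x = 0")
  case False
  then have "\<iota> x * \<iota> (inverse x) = 1" by (simp flip: ext_mult)
  then show ?thesis by (metis inverse_unique)
qed simp

lemma ext_divide: "\<iota> (x / y) = \<iota> x / \<iota> y"
  by (simp add: divide_inverse ext_mult ext_inverse)

lemma ext_power: "\<iota> (x ^ n) = \<iota> x ^ n"
  by (induction n) (auto simp: ext_mult)

lemma ext_powi: "\<iota> (x powi n) = \<iota> x powi n"
  by (simp add: power_int_def ext_power ext_inverse)

text \<open>The ramification index, read off from one chosen uniformizer; \<open>val_ext\<close>
  shows that every non-zero element gives the same factor.\<close>

definition ram :: int where "ram = val (\<iota> (SOME p. uniformizer p))"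

text \<open>Continuity of the embedding sends elements of a fixed large valuation N into the maximal
  ideal. A unit u with image of negative valuation would violate this along p u^n, where p has
  valuation N. Hence units go to units, and the valuation is multiplied by a constant.\<close>

lemma ram_pos: "ram > 0" and val_ext: "x \<noteq> 0 \<Longrightarrow> val (\<iota> x) = ram * val x"
proof -
  have "(\<iota> \<longlongrightarrow> 0) (nhds 0)"
  proof -
    have "\<iota> \<midarrow>0\<rightarrow> \<iota> 0" using ext_cont by (simp add: continuous_on_def del: ext_zero)
    then show ?thesis unfolding tendsto_at_iff_tendsto_nhds by simp
  qed
  then have "eventually (\<lambda>y. \<iota> y \<in> vball 0 1) (nhds 0)"
    by (simp add: tendsto_vball_iff)
  then obtain N0 where N0: "\<And>y. y \<in> vball 0 N0 \<Longrightarrow> \<iota> y \<in> vball 0 1"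
    unfolding eventually_nhds_vball by blast
  define N where "N = max N0 1"
  obtain p :: 'f where p: "p \<noteq> 0" "val p = N" using exists_val by blast
  have N: "1 \<le> val (\<iota> y)" if "y \<noteq> 0" "val y = N" for y
    using N0[of y] that by (auto simp: vball_iff vge_def N_def)
  have unit_ge: "0 \<le> val (\<iota> u)" if u: "u \<noteq> 0" "val u = 0" for u
  proof (rule ccontr)
    assume neg: "\<not> 0 \<le> val (\<iota> u)"
    \<comment> \<open>With this exponent the image of p u^n has valuation at most 0, although p u^n
      still has valuation N.\<close>
    define n where "n = nat (val (\<iota> p))"
    have "1 \<le> val (\<iota> (p * u ^ n))" using p u by (intro N) (auto simp: val_mult val_power)
    then have 1: "1 \<le> val (\<iota> p) + int n * val (\<iota> u)"
      using p u by (simp add: ext_mult ext_power val_mult val_power)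
    have "int n * val (\<iota> u) \<le> int n * (-1)" using neg by (intro mult_left_mono) auto
    then show False using 1 N[OF p] by (simp add: n_def)
  qed
  have unit: "val (\<iota> u) = 0" if u: "u \<noteq> 0" "val u = 0" for u
    using unit_ge[OF u] unit_ge[of "inverse u"] u by (simp add: val_inverse ext_inverse)
  let ?p = "SOME p. uniformizer p"
  have P: "?p \<noteq> (0::'f)" "val ?p = 1"
    using someI_ex[OF uniformizer_exists] unfolding uniformizer_def by auto
  show val_ext: "val (\<iota> x) = ram * val x" if x: "x \<noteq> 0" for x
  proof -
    let ?u = "x * ?p powi (- val x)"
    have "val ?u = 0" "?u \<noteq> 0" using P x by (auto simp: val_mult val_powi)
    then have "val (\<iota> ?u) = 0" by (intro unit)
    then show ?thesis using P x by (simp add: ext_mult ext_powi val_mult val_powi ram_def)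
  qed
  have "1 \<le> ram * N" using N[OF p] val_ext[OF p(1)] p by simp
  moreover have "N \<ge> 1" by (simp add: N_def)
  ultimately show "ram > 0" using zero_less_mult_pos2[of ram N] by simp
qed

lemma vge_ext: "vge n x \<Longrightarrow> vge (ram * n) (\<iota> x)"
  using ram_pos by (cases "x = 0") (auto simp: vge_def val_ext)

lemma vge_ext_iff: "vge (ram * n) (\<iota> x) \<longleftrightarrow> vge n x"
  using ram_pos by (cases "x = 0") (auto simp: vge_def val_ext)

section \<open>The degree formula by comparison of Haar volumes\<close>

lemma ext_basis:
  "\<exists>v1 v2. (\<forall>y. \<exists>a b. y = \<iota> a * v1 + \<iota> b * v2) \<and> (\<forall>a b. \<iota> a * v1 + \<iota> b * v2 = 0 \<longrightarrow> a = 0 \<and> b = 0)"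
proof -
  interpret vs: vector_space "\<lambda>a x. \<iota> a * x"
    by unfold_locales (auto simp: ext_mult ext_add algebra_simps)
  have dim: "vs.dim UNIV = 2" using quad by (simp add: quadratic_extension_def)
  obtain B where B: "vs.independent B" "UNIV \<subseteq> vs.span B" "card B = 2"
    using vs.basis_exists[of UNIV] dim by metis
  obtain v1 v2 where v: "B = {v1, v2}" "v1 \<noteq> v2" using B(3) by (auto simp: card_2_iff)
  have 1: "\<exists>a b. y = \<iota> a * v1 + \<iota> b * v2" for y
  proof -
    have "y \<in> vs.span {v1, v2}" using B v by auto
    then obtain a where "y - \<iota> a * v1 \<in> vs.span {v2}" unfolding vs.span_insert by blast
    then obtain b where "y - \<iota> a * v1 = \<iota> b * v2" unfolding vs.span_singleton by blast
    then show ?thesis by (metis add.commute diff_eq_eq)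
  qed
  have 2: "a = 0 \<and> b = 0" if z: "\<iota> a * v1 + \<iota> b * v2 = 0" for a b
  proof -
    let ?u = "\<lambda>v. if v = v1 then a else b"
    have s: "(\<Sum>v\<in>{v1, v2}. \<iota> (?u v) * v) = 0" using v z by simp
    show ?thesis
      using vs.independentD[OF B(1)[unfolded v(1)], of "{v1, v2}" ?u v1]
        vs.independentD[OF B(1)[unfolded v(1)], of "{v1, v2}" ?u v2] s v by simp
  qed
  show ?thesis using 1 2 by blast
qed

text \<open>Small vectors have integral coordinates. The norm of a combination of v1 and v2 attains
  a positive minimum on the compact set of coordinate pairs of sup norm exactly 1, and a
  non-integral pair is such a pair times a scalar of negative valuation.\<close>

lemma lattice_ball:
  assumes T0: "\<And>a b. \<iota> a * v1 + \<iota> b * v2 = 0 \<Longrightarrow> a = 0 \<and> b = 0"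
  shows "\<exists>N. \<forall>a b. vge N (\<iota> a * v1 + \<iota> b * v2) \<longrightarrow> vge 0 a \<and> vge 0 b"
proof -
  define T where "T = (\<lambda>p. \<iota> (fst p) * v1 + \<iota> (snd p) * v2)"
  define S :: "('f \<times> 'f) set" where "S = vball 0 0 \<times> vball 0 0 - vball 0 1 \<times> (vball 0 1 :: 'f set)"
  have cT: "continuous_on S (\<lambda>p. dist (T p) 0)"
    unfolding T_def
    by (intro continuous_intros continuous_on_compose2[OF ext_cont]) auto
  have S: "compact S" unfolding S_def
    by (intro compact_diff compact_Times compact_vball open_Times open_vball)
  have "(1, 0) \<in> S" by (auto simp: S_def vball_iff vge_def)
  then obtain p where p: "p \<in> S" "\<And>p'. p' \<in> S \<Longrightarrow> dist (T p) 0 \<le> dist (T p') 0"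
    using continuous_attains_inf[OF S _ cT] by blast
  have "p \<noteq> (0, 0)" using p(1) by (auto simp: S_def)
  then have "T p \<noteq> 0" using T0[of "fst p" "snd p"] by (auto simp: T_def prod_eq_iff)
  then have "dist (T p) 0 > 0" by simp
  then obtain N where N: "resq TYPE('e) powr (- real_of_int N) < dist (T p) 0"
    using exists_powr_less by blast
  have not_S: "\<not> vge N (T p')" if "p' \<in> S" for p'
    using p(2)[OF that] N by (simp add: dist_absval flip: absval_le_iff)
  show ?thesis
  proof (intro exI[of _ N] allI impI, rule ccontr)
    fix a b assume v: "vge N (\<iota> a * v1 + \<iota> b * v2)" and n: "\<not> (vge 0 a \<and> vge 0 b)"
    define m where "m = min (if a = 0 then 0 else val a) (if b = 0 then 0 else val b)"
    have m: "m < 0" "vge m a" "vge m b" "\<not> (vge (m + 1) a \<and> vge (m + 1) b)"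
      using n by (auto simp: m_def vge_def split: if_splits)
    obtain c :: 'f where c: "c \<noteq> 0" "val c = - m" using exists_val by blast
    have "(c * a, c * b) \<in> S"
      using m c by (auto simp: S_def vball_iff vge_times_iff add.commute)
    moreover have "T (c * a, c * b) = \<iota> c * (\<iota> a * v1 + \<iota> b * v2)"
      by (simp add: T_def ext_mult algebra_simps)
    moreover have "vge (N - val (\<iota> c)) (\<iota> a * v1 + \<iota> b * v2)"
      using v c m ram_pos by (intro vge_mono[OF v]) (auto simp: val_ext mult_le_0_iff)
    ultimately show False using not_S c by (metis ext_eq_0_iff vge_times_iff)
  qed
qed

end

lemma power_sandwich_eq_1:
  fixes y :: real
  assumes "y > 0" "a > 0" and "\<And>k. a \<le> y ^ k" "\<And>k. y ^ k \<le> b"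
  shows "y = 1"
proof (rule ccontr)
  assume "y \<noteq> 1"
  then consider "y < 1" | "y > 1" by linarith
  then show False
  proof cases
    case 1
    then obtain n where "y ^ n < a" using real_arch_pow_inv[OF \<open>a > 0\<close>] by blast
    then show False using assms(3)[of n] by simp
  next
    case 2
    then obtain n where "b < y ^ n" using real_arch_pow by blast
    then show False using assms(4)[of n] by simp
  qed
qed

context quad_ext begin

text \<open>This is ef = 2 in the form q_E^e = q_F^2. When k grows by 1, the lattice
  \<open>L k\<close> loses a factor q_F^2 of Haar measure, while a ball whose exponent grows by
  \<open>ram\<close> loses a factor q_E^e. Each lattice lies between two balls of exponent
  \<open>ram * k\<close> up to shifts independent of k, so the two factors agree.\<close>

lemma resq_ext:
  fixes dE :: "'e measure"
  assumes M: "haar_measure dE"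
  shows "resq TYPE('e) powr (real_of_int ram) = (resq TYPE('f))\<^sup>2"
proof -
  let ?Q = "resq TYPE('e)" and ?q = "resq TYPE('f)"
  obtain v1 v2 where v: "\<And>y. \<exists>a b. y = \<iota> a * v1 + \<iota> b * v2"
    "\<And>a b. \<iota> a * v1 + \<iota> b * v2 = 0 \<Longrightarrow> a = 0 \<and> b = 0"
    using ext_basis by blast
  define T where "T = (\<lambda>p. \<iota> (fst p) * v1 + \<iota> (snd p) * v2)"
  define L where "L k = T ` (vball 0 k \<times> vball 0 k)" for k
  have Tadd: "T (a + c, b + d) = T (a, b) + T (c, d)" for a b c d
    by (simp add: T_def ext_add algebra_simps)
  have Tinj: "T p = T p' \<Longrightarrow> p = p'" for p p'
    using v(2)[of "fst p - fst p'" "snd p - snd p'"]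
    by (auto simp: T_def ext_diff algebra_simps prod_eq_iff)
  have cL: "compact (L k)" for k
    unfolding L_def T_def
    by (intro compact_continuous_image compact_Times compact_vball continuous_intros
        continuous_on_compose2[OF ext_cont]) auto
  have sL: "L k \<in> sets dE" for k
    using cL by (simp add: haar_sets[OF M] compact_imp_closed borel_closed)
  have fL: "emeasure dE (L k) < \<infinity>" for k using haar_compact[OF M cL] .
  \<comment> \<open>The product of two balls splits into q_F^2 translates of the next smaller
    product, and \<open>T\<close> carries translates to translates.\<close>
  have step: "measure dE (L k) = ?q\<^sup>2 * measure dE (L (k + 1))" for k
  proof -
    obtain R :: "'f set" where R: "card R = card (residue_classes :: 'f set set)" "vreps 0 k (k + 1) R"
      using vreps_step[of 0 k] by blast
    have "finite R" using R by (simp add: vreps_def)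
    have D: "vball r (k + 1) \<inter> vball s (k + 1) = {}" if "r \<in> R" "s \<in> R" "r \<noteq> s" for r s
      using vreps_disjoint[OF R(2)] that by (simp add: disjoint_family_on_def)
    have U: "vball 0 k \<times> vball 0 k = (\<Union>p\<in>R \<times> R. vball (fst p) (k + 1) \<times> vball (snd p) (k + 1))"
      unfolding vreps_UN[OF R(2), symmetric, simplified] by auto
    have tr: "T ` (vball (fst p) (k + 1) \<times> vball (snd p) (k + 1)) = (+) (T p) ` L (k + 1)" for p
    proof -
      have "vball (fst p) (k + 1) \<times> vball (snd p) (k + 1) = (\<lambda>z. (fst p + fst z, snd p + snd z)) ` (vball 0 (k + 1) \<times> vball 0 (k + 1))"
      proof -
        have "f ` A \<times> g ` B = (\<lambda>z. (f (fst z), g (snd z))) ` (A \<times> B)" for f g :: "'f \<Rightarrow> 'f" and A B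
          by force
        from this[of "(+) (fst p)" "vball 0 (k + 1)" "(+) (snd p)" "vball 0 (k + 1)"]
        show ?thesis by (simp add: vball_translate)
      qed
      moreover have "T (fst p + fst z, snd p + snd z) = T p + T z" for z
        using Tadd[of "fst p" "fst z" "snd p" "snd z"] by simp
      ultimately show ?thesis by (simp add: L_def image_image)
    qed
    have "L k = (\<Union>p\<in>R \<times> R. (+) (T p) ` L (k + 1))"
      unfolding L_def[of k] U image_UN tr ..
    moreover have "disjoint_family_on (\<lambda>p. (+) (T p) ` L (k + 1)) (R \<times> R)"
      unfolding disjoint_family_on_def
    proof (intro ballI impI)
      fix p p' assume p: "p \<in> R \<times> R" "p' \<in> R \<times> R" "p \<noteq> p'"
      have "(vball (fst p) (k + 1) \<times> vball (snd p) (k + 1)) \<inter> (vball (fst p') (k + 1) \<times> vball (snd p') (k + 1)) = {}"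
      proof (cases "fst p = fst p'")
        case True
        then have "snd p \<noteq> snd p'" using p(3) by (simp add: prod_eq_iff)
        then have "vball (snd p) (k + 1) \<inter> vball (snd p') (k + 1) = {}"
          using p by (intro D) auto
        then show ?thesis by blast
      next
        case False
        then have "vball (fst p) (k + 1) \<inter> vball (fst p') (k + 1) = {}"
          using p by (intro D) auto
        then show ?thesis by blast
      qed
      then show "(+) (T p) ` L (k + 1) \<inter> (+) (T p') ` L (k + 1) = {}"
        unfolding tr[symmetric] using Tinj by blast
    qed
    moreover have em: "emeasure dE ((+) (T p) ` L (k + 1)) = emeasure dE (L (k + 1))" for p
      using haar_translate[OF M sL] .
    moreover have "(+) (T p) ` L (k + 1) \<in> sets dE" for p
      using compact_continuous_image[OF _ cL[of "k + 1"], of "(+) (T p)"]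
      by (simp add: haar_sets[OF M] compact_imp_closed borel_closed continuous_intros)
    ultimately have "measure dE (L k) = (\<Sum>p\<in>R \<times> R. measure dE ((+) (T p) ` L (k + 1)))"
      using \<open>finite R\<close> fL[of "k + 1"] by (auto intro!: measure_finite_Union)
    also have "\<dots> = ?q\<^sup>2 * measure dE (L (k + 1))"
      using em by (simp add: measure_def R(1) power2_eq_square card_cartesian_product)
    finally show ?thesis .
  qed
  have stepk: "measure dE (L 0) = (?q\<^sup>2) ^ k * measure dE (L (int k))" for k
    by (induction k) (auto simp: step[of "int k" for k] algebra_simps)
  obtain N where N: "\<And>a b. vge N (\<iota> a * v1 + \<iota> b * v2) \<Longrightarrow> vge 0 a \<and> vge 0 b"
    using lattice_ball[OF v(2)] by blast
  have lower: "vball 0 (N + ram * k) \<subseteq> L k" for k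
  proof
    fix y :: 'e assume y: "y \<in> vball 0 (N + ram * k)"
    obtain c :: 'f where c: "c \<noteq> 0" "val c = k" using exists_val by blast
    obtain a b where ab: "y / \<iota> c = \<iota> a * v1 + \<iota> b * v2" using v(1) by blast
    have yc: "y = \<iota> c * (y / \<iota> c)" using c by simp
    have "vge N (y / \<iota> c)"
      using y vge_times_iff[of "\<iota> c" "N + ram * k" "y / \<iota> c"] c by (simp add: val_ext vball_iff)
    then have "vge 0 a \<and> vge 0 b" using N ab by metis
    moreover have "y = T (c * a, c * b)" using yc ab by (simp add: T_def ext_mult algebra_simps)
    ultimately show "y \<in> L k" using c by (auto simp: L_def vball_iff vge_times_iff)
  qed
  define N' where "N' = min (val v1) (val v2)"
  have v12: "vge N' v1" "vge N' v2" by (auto simp: vge_def N'_def)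
  have upper: "L k \<subseteq> vball 0 (ram * k + N')" for k
    unfolding L_def T_def by (auto simp: vball_iff intro!: vge_add vge_mult vge_ext v12)
  have lo: "volball dE (N + ram * k) \<le> measure dE (L k)" for k
    using measure_mono_fmeasurable[OF lower, of k dE] sL fL M
    by (simp add: measure_vball[OF M] fmeasurableI)
  have up: "measure dE (L k) \<le> volball dE (ram * k + N')" for k
    using measure_mono_fmeasurable[OF upper, of k dE] sL M
    by (simp add: measure_vball[OF M] fmeasurableI emeasure_vball[OF M])
  \<comment> \<open>The quotient of the two scaling factors; its powers stay between two positive
    constants, which forces it to be 1.\<close>
  let ?y = "?q\<^sup>2 / ?Q powr (real_of_int ram)"
  define V where "V = volball dE 0"
  have V: "V > 0" using volball_pos[OF M] by (simp add: V_def)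
  have q0: "?q > 0" "?Q > 0" using resq_gt_0 by auto
  have vb: "volball dE (n + ram * int k) = V * ?Q powr (- real_of_int n) / (?Q powr (real_of_int ram)) ^ k" for n k
  proof -
    have "(?Q powr (real_of_int ram)) ^ k = ?Q powr (real k * real_of_int ram)"
      using q0 by (simp add: powr_powr mult.commute flip: powr_realpow)
    then show ?thesis
      unfolding volball_eq[OF M, of "n + ram * int k"] by (simp add: V_def algebra_simps powr_diff)
  qed
  define m where "m = measure dE (L 0)"
  have mk: "measure dE (L (int k)) = m / (?q\<^sup>2) ^ k" for k
    using stepk[of k] q0 by (simp add: m_def field_simps)
  have 1: "V * ?Q powr (- real_of_int N) * ?y ^ k \<le> m" for k
    using lo[of "int k"] q0 unfolding vb mk by (simp add: field_simps)
  have 2: "m \<le> V * ?Q powr (- real_of_int N') * ?y ^ k" for k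
    using up[of "int k"] q0 unfolding add.commute[of "ram * int k"] vb mk by (simp add: field_simps)
  have A: "V * ?Q powr (- real_of_int N) > 0" "V * ?Q powr (- real_of_int N') > 0"
    using V q0 by auto
  have m0: "m > 0" using 1[of 0] A by simp
  have "?y = 1"
  proof (rule power_sandwich_eq_1)
    show "?y > 0" using q0 by simp
    show "m / (V * ?Q powr (- real_of_int N')) > 0" using A m0 by simp
    show "m / (V * ?Q powr (- real_of_int N')) \<le> ?y ^ k" for k using 2[of k] A by (simp add: field_simps)
    show "?y ^ k \<le> m / (V * ?Q powr (- real_of_int N))" for k using 1[of k] A by (simp add: field_simps)
  qed
  then show ?thesis using q0 by (simp add: field_simps)
qed

end

section \<open>Hilbert spaces\<close>

lemma scaleC_minus_one [simp]: "(-1) *\<^sub>C x = - x" for x :: "'h::complex_hilbert"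
  using scaleC_of_real[of "-1" x] by simp

lemma cinner_scaleC_right: "cinner x (c *\<^sub>C y) = cnj c * cinner x y"
  for x :: "'h::complex_hilbert"
  by (metis cinner_commute cinner_scaleC_left complex_cnj_mult)

lemma cinner_add_right: "cinner x (y + z) = cinner x y + cinner x z"
  for x :: "'h::complex_hilbert"
  by (metis cinner_commute cinner_add_left complex_cnj_add)

lemma cinner_minus_left: "cinner (- x) y = - cinner x y" for x :: "'h::complex_hilbert"
  using cinner_scaleC_left[of "-1" x y] by simp

lemma cinner_minus_right: "cinner x (- y) = - cinner x y" for x :: "'h::complex_hilbert"
  using cinner_scaleC_right[of x "-1" y] by simp

lemma cinner_diff_left: "cinner (x - y) z = cinner x z - cinner y z" for x :: "'h::complex_hilbert"
  using cinner_add_left[of x "- y" z] by (simp add: cinner_minus_left)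

lemma cinner_diff_right: "cinner x (y - z) = cinner x y - cinner x z" for x :: "'h::complex_hilbert"
  using cinner_add_right[of x y "- z"] by (simp add: cinner_minus_right)

lemma norm_sq_cinner: "(norm x)\<^sup>2 = Re (cinner x x)" for x :: "'h::complex_hilbert"
  by (simp add: cinner_self)

lemma norm_diff_sq_cinner:
  "(norm (x - y))\<^sup>2 = Re (cinner x x) - Re (cinner x y) - Re (cinner y x) + Re (cinner y y)"
  for x :: "'h::complex_hilbert"
  by (simp add: norm_sq_cinner cinner_diff_left cinner_diff_right)

lemma norm_scaleC: "norm (c *\<^sub>C x) = cmod c * norm x" for x :: "'h::complex_hilbert"
proof -
  have "complex_of_real ((norm (c *\<^sub>C x))\<^sup>2) = complex_of_real ((cmod c * norm x)\<^sup>2)"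
    unfolding cinner_self[symmetric] cinner_scaleC_left cinner_scaleC_right
    using complex_norm_square[of c] by (simp add: cinner_self power_mult_distrib mult_ac)
  then have "(norm (c *\<^sub>C x))\<^sup>2 = (cmod c * norm x)\<^sup>2" using of_real_eq_iff by blast
  then show ?thesis by simp
qed

lemma scaleC_diff_right: "c *\<^sub>C (x - y) = c *\<^sub>C x - c *\<^sub>C y" for x :: "'h::complex_hilbert"
proof -
  have "c *\<^sub>C (- y) = - (c *\<^sub>C y)"
    using scaleC_scaleC[of c "-1" y] scaleC_scaleC[of "-1" c y] by simp
  then show ?thesis using scaleC_add_right[of c x "- y"] by simp
qed

lemma tendsto_scaleC:
  fixes l :: "'h::complex_hilbert"
  assumes "(f \<longlongrightarrow> l) F" shows "((\<lambda>n. c *\<^sub>C f n) \<longlongrightarrow> c *\<^sub>C l) F"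
proof -
  have "((\<lambda>n. cmod c * norm (f n - l)) \<longlongrightarrow> cmod c * 0) F"
    by (intro tendsto_mult tendsto_const tendsto_norm_zero) (use assms LIM_zero in blast)
  then have "((\<lambda>n. norm (c *\<^sub>C f n - c *\<^sub>C l)) \<longlongrightarrow> 0) F"
    by (simp add: norm_scaleC flip: scaleC_diff_right)
  then show ?thesis using LIM_zero_cancel tendsto_norm_zero_iff by blast
qed

lemma Re_cinner_polarization:
  "Re (cinner x y) = ((norm (x + y))\<^sup>2 - (norm x)\<^sup>2 - (norm y)\<^sup>2) / 2" for x :: "'h::complex_hilbert"
proof -
  have "Re (cinner y x) = Re (cinner x y)" by (metis cinner_commute complex_cnj(1) cnj.sel(1))
  then show ?thesis by (simp add: norm_sq_cinner cinner_add_left cinner_add_right)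
qed

lemma Im_cinner: "Im (cinner x y) = Re (cinner x (\<i> *\<^sub>C y))" for x :: "'h::complex_hilbert"
  by (simp add: cinner_scaleC_right)

text \<open>Polarization expresses the real part by norms, and multiplying the second argument by i
  recovers the imaginary part, so continuity of the norm is enough.\<close>

lemma tendsto_cinner:
  fixes x :: "'h::complex_hilbert"
  assumes "(f \<longlongrightarrow> x) F" "(g \<longlongrightarrow> y) F"
  shows "((\<lambda>n. cinner (f n) (g n)) \<longlongrightarrow> cinner x y) F"
proof -
  have Re: "((\<lambda>n. Re (cinner (f n) (h n))) \<longlongrightarrow> Re (cinner x z)) F" if "(h \<longlongrightarrow> z) F" for h z
    unfolding Re_cinner_polarization using assms(1) that by (intro tendsto_intros) auto
  show ?thesis
    unfolding tendsto_complex_iff Im_cinner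
    using Re[OF assms(2)] Re[OF tendsto_scaleC[OF assms(2)]] by blast
qed

text \<open>Preserving inner products already forces linearity: the squared norms of the additivity
  and homogeneity defects expand to 0.\<close>

lemma isometric_mapI:
  fixes U :: "'k::complex_hilbert \<Rightarrow> 'h::complex_hilbert"
  assumes U: "\<And>x y. cinner (U x) (U y) = cinner x y"
  shows "isometric_map U"
proof -
  have "norm (U (x + y) - (U x + U y)) ^ 2 = 0" for x y
    by (simp add: norm_diff_sq_cinner U cinner_add_left cinner_add_right)
  moreover have "norm (U (c *\<^sub>C x) - c *\<^sub>C U x) ^ 2 = 0" for c x
    by (simp add: norm_diff_sq_cinner U cinner_scaleC_left cinner_scaleC_right algebra_simps)
  ultimately show ?thesis using U by (simp add: isometric_map_def)
qed

lemma isometric_map_dist: "isometric_map U \<Longrightarrow> dist (U x) (U y) = dist x y"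
proof -
  assume U: "isometric_map U"
  have "(norm (U x - U y))\<^sup>2 = (norm (x - y))\<^sup>2"
    using U by (simp add: norm_diff_sq_cinner isometric_map_def)
  then show ?thesis by (simp add: dist_norm)
qed

lemma isometric_map_continuous: "isometric_map U \<Longrightarrow> continuous_on A U"
  unfolding continuous_on_iff by (metis isometric_map_dist)

lemma closed_range_isometric:
  assumes "isometric_map U" shows "closed (range U)"
proof -
  have "complete (range U)"
  proof (rule completeI)
    fix f assume f: "\<forall>n. f n \<in> range U" "Cauchy f"
    then have "\<forall>n. \<exists>x. f n = U x" by blast
    then obtain x where x: "\<And>n. f n = U (x n)" by metis
    have "Cauchy x" using f(2) unfolding Cauchy_def x isometric_map_dist[OF assms] .
    then obtain l where "x \<longlonglongrightarrow> l" using Cauchy_convergent convergent_def by blast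
    then have "(\<lambda>n. U (x n)) \<longlonglongrightarrow> U l"
      by (intro continuous_on_tendsto_compose[OF isometric_map_continuous[OF assms, of UNIV]]) auto
    then show "\<exists>l\<in>range U. f \<longlonglongrightarrow> l" unfolding x[symmetric] by blast
  qed
  then show ?thesis using complete_eq_closed by blast
qed

text \<open>The squared norm of p n - p m expands into four inner products, all close to l, with
  signs that cancel.\<close>

lemma isometric_limit_Cauchy:
  fixes p :: "nat \<Rightarrow> 'h::complex_hilbert"
  assumes "\<And>e. e > 0 \<Longrightarrow> \<exists>N. \<forall>n\<ge>N. \<forall>m\<ge>N. cmod (cinner (p n) (p m) - l) < e"
  shows "Cauchy p"
proof (rule CauchyI)
  fix e :: real assume e: "e > 0"
  then have "e\<^sup>2 / 4 > 0" by simp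
  from assms[OF this] obtain N where
    N: "\<And>n m. n \<ge> N \<Longrightarrow> m \<ge> N \<Longrightarrow> cmod (cinner (p n) (p m) - l) < e\<^sup>2 / 4" by blast
  have "norm (p n - p m) < e" if "n \<ge> N" "m \<ge> N" for n m
  proof -
    have R: "\<bar>Re (cinner (p i) (p j)) - Re l\<bar> < e\<^sup>2 / 4" if "i \<ge> N" "j \<ge> N" for i j
      using N[OF that] abs_Re_le_cmod[of "cinner (p i) (p j) - l"] by simp
    have "(norm (p n - p m))\<^sup>2 < e\<^sup>2"
      unfolding norm_diff_sq_cinner using R[of n n] R[of n m] R[of m n] R[of m m] that by argo
    then show ?thesis using e power2_less_imp_less by fastforce
  qed
  then show "\<exists>M. \<forall>m\<ge>M. \<forall>n\<ge>M. norm (p m - p n) < e" by blast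
qed

text \<open>The families \<open>p i\<close> only need to be asymptotically isometric to the vectors \<open>a i\<close>, jointly in
  both indices; this makes each \<open>p i\<close> a Cauchy sequence.\<close>

lemma isometry_from_limits:
  fixes a :: "'i \<Rightarrow> 'k::complex_hilbert" and p :: "'i \<Rightarrow> nat \<Rightarrow> 'h::complex_hilbert"
  assumes lim: "\<And>i j e. i \<in> I \<Longrightarrow> j \<in> I \<Longrightarrow> e > 0 \<Longrightarrow>
      \<exists>N. \<forall>n\<ge>N. \<forall>m\<ge>N. cmod (cinner (p i n) (p j m) - cinner (a i) (a j)) < e"
    and dense: "closure (a ` I) = UNIV"
  shows "\<exists>U. isometric_map U \<and> (\<forall>i\<in>I. p i \<longlonglongrightarrow> U (a i))"
proof -
  have "convergent (p i)" if "i \<in> I" for i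
    using isometric_limit_Cauchy[of "p i" "cinner (a i) (a i)"] lim[OF that that] Cauchy_convergent by blast
  then obtain b where b: "\<And>i. i \<in> I \<Longrightarrow> p i \<longlonglongrightarrow> b i" unfolding convergent_def by metis
  have bb: "cinner (b i) (b j) = cinner (a i) (a j)" if ij: "i \<in> I" "j \<in> I" for i j
  proof -
    have "(\<lambda>n. cinner (p i n) (p j n)) \<longlonglongrightarrow> cinner (a i) (a j)"
      unfolding LIMSEQ_iff using lim[OF ij] by meson
    then show ?thesis using tendsto_cinner[OF b[OF ij(1)] b[OF ij(2)]] LIMSEQ_unique by blast
  qed
  have dist: "dist (b i) (b j) = dist (a i) (a j)" if "i \<in> I" "j \<in> I" for i j
  proof -
    have "(norm (b i - b j))\<^sup>2 = (norm (a i - a j))\<^sup>2"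
      unfolding norm_diff_sq_cinner using that by (simp add: bb)
    then show ?thesis by (simp add: dist_norm)
  qed
  \<comment> \<open>The map \<open>a\<close> need not be injective: different indices may stand for
    the same vector. The equality of distances just shown makes the choice harmless, so the limit
    depends on the vector only.\<close>
  define f where "f x = b (SOME i. i \<in> I \<and> a i = x)" for x
  have f: "f (a i) = b i" if "i \<in> I" for i
  proof -
    have "\<exists>j. j \<in> I \<and> a j = a i" using that by blast
    from someI_ex[OF this] have "dist (f (a i)) (b i) = 0"
      unfolding f_def using that by (simp add: dist)
    then show ?thesis by simp
  qed
  have "uniformly_continuous_on (a ` I) f"
    unfolding uniformly_continuous_on_def
  proof (intro allI impI)
    fix e :: real assume "e > 0"
    then show "\<exists>d>0. \<forall>x\<in>a ` I. \<forall>x'\<in>a ` I. dist x' x < d \<longrightarrow> dist (f x') (f x) < e"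
      by (intro exI[of _ e]) (auto simp: f dist)
  qed
  from uniformly_continuous_on_extension_on_closure[OF this]
  obtain U where U: "uniformly_continuous_on UNIV U" "\<And>x. x \<in> a ` I \<Longrightarrow> f x = U x"
    unfolding dense by metis
  have Ua: "U (a i) = b i" if "i \<in> I" for i using U(2)[of "a i"] f[OF that] that by simp
  have cont: "(\<lambda>n. U (x n)) \<longlonglongrightarrow> U l" if "x \<longlonglongrightarrow> l" for x l
    by (intro continuous_on_tendsto_compose[OF uniformly_continuous_imp_continuous[OF U(1)] that]) auto
  have appr: "\<exists>i. (\<forall>n. i n \<in> I) \<and> (\<lambda>n. a (i n)) \<longlonglongrightarrow> x" for x
  proof -
    have "x \<in> closure (a ` I)" using dense by simp
    then obtain y where y: "\<And>n. y n \<in> a ` I" "y \<longlonglongrightarrow> x" unfolding closure_sequential by blast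
    then have "\<forall>n. \<exists>i. i \<in> I \<and> y n = a i" by blast
    then obtain i where "\<And>n. i n \<in> I \<and> y n = a (i n)" by metis
    then show ?thesis using y(2) by (intro exI[of _ i]) (simp add: LIMSEQ_def)
  qed
  have "cinner (U x) (U y) = cinner x y" for x y
  proof -
    obtain i where i: "\<And>n. i n \<in> I" "(\<lambda>n. a (i n)) \<longlonglongrightarrow> x" using appr by blast
    obtain j where j: "\<And>n. j n \<in> I" "(\<lambda>n. a (j n)) \<longlonglongrightarrow> y" using appr by blast
    have "(\<lambda>n. cinner (U (a (i n))) (U (a (j n)))) \<longlonglongrightarrow> cinner (U x) (U y)"
      by (intro tendsto_cinner cont i j)
    moreover have "(\<lambda>n. cinner (a (i n)) (a (j n))) \<longlonglongrightarrow> cinner x y"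
      by (intro tendsto_cinner i j)
    ultimately show ?thesis using i(1) j(1) by (simp add: Ua bb LIMSEQ_unique)
  qed
  then have "isometric_map U" by (rule isometric_mapI)
  moreover have "\<forall>i\<in>I. p i \<longlonglongrightarrow> U (a i)" using b Ua by simp
  ultimately show ?thesis by blast
qed

text \<open>The range of the isometry serves as the subspace; it is closed because an isometric
  image of a complete space is complete.\<close>

lemma direct_summandI:
  assumes "isometric_map U" "\<And>g v. U (T g v) = \<rho> g (U v)"
  shows "contains_direct_summand \<rho> T"
  unfolding contains_direct_summand_def
proof (intro exI[of _ "range U"] conjI allI ballI)
  show "closed (range U)" by (rule closed_range_isometric[OF assms(1)])
  have U: "U (x + y) = U x + U y" "U (c *\<^sub>C x) = c *\<^sub>C U x" for x y c
    using assms(1) by (auto simp: isometric_map_def)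
  have "U 0 = 0" using U(1)[of 0 0] by simp
  then show "0 \<in> range U" by (metis rangeI)
  show "v + w \<in> range U" if "v \<in> range U" "w \<in> range U" for v w
    using that by (auto simp flip: U)
  show "c *\<^sub>C v \<in> range U" if "v \<in> range U" for c v
    using that by (auto simp flip: U)
  show "\<rho> g v \<in> range U" if "v \<in> range U" for g v
    using that by (auto simp flip: assms(2))
  show "\<exists>V. isometric_map V \<and> range V = range U \<and> (\<forall>g v. V (T g v) = \<rho> g (V v))"
    using assms by blast
qed

section \<open>The Riesz kernel on balls\<close>

lemma haar_measurable_cong:
  "haar_measure M \<Longrightarrow> f \<in> borel_measurable M \<longleftrightarrow> f \<in> borel_measurable borel"
  by (simp add: haar_sets cong: measurable_cong_sets)

lemma translate_measurable [measurable]: "(\<lambda>x. a + x) \<in> borel \<rightarrow>\<^sub>M (borel :: 'k::nonarch_local_field measure)"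
  by (intro borel_measurable_continuous_onI continuous_intros)

text \<open>Invariance is postulated for images of sets; restated for push-forward measures it
  yields the substitution rule for integrals.\<close>

lemma haar_distr_translate:
  fixes M :: "'k::nonarch_local_field measure"
  assumes M: "haar_measure M" shows "distr M borel ((+) a) = M"
proof (rule measure_eqI)
  show "sets (distr M borel ((+) a)) = sets M" by (simp add: haar_sets[OF M])
  fix A assume "A \<in> sets (distr M borel ((+) a))"
  then have A: "A \<in> sets M" by (simp add: haar_sets[OF M])
  have T: "(+) a \<in> M \<rightarrow>\<^sub>M borel" using haar_sets[OF M] translate_measurable by (metis measurable_cong_sets)
  have "(+) a -` A = (+) (- a) ` A"
  proof -
    have "x \<in> (+) (- a) ` A" if "a + x \<in> A" for x
      using that by (intro image_eqI[of _ _ "a + x"]) auto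
    then show ?thesis by auto
  qed
  then show "emeasure (distr M borel ((+) a)) A = emeasure M A"
    using A T haar_translate[OF M A, of "- a"]
    by (simp add: emeasure_distr haar_sets[OF M] haar_space[OF M])
qed

lemma haar_integral_translate:
  fixes M :: "'k::nonarch_local_field measure" and f :: "'k \<Rightarrow> 'b::{banach, second_countable_topology}"
  assumes M: "haar_measure M" and f: "integrable M f"
  shows "integrable M (\<lambda>x. f (a + x))" "(LINT x|M. f (a + x)) = integral\<^sup>L M f"
proof -
  have T: "(+) a \<in> M \<rightarrow>\<^sub>M borel" using haar_sets[OF M] translate_measurable by (metis measurable_cong_sets)
  have f': "f \<in> borel_measurable borel" using f by (simp add: haar_measurable_cong[OF M, symmetric])
  show "(LINT x|M. f (a + x)) = integral\<^sup>L M f"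
    using integral_distr[OF T f'] by (simp add: haar_distr_translate[OF M])
  show "integrable M (\<lambda>x. f (a + x))"
    using integrable_distr_eq[OF T f'] f by (simp add: haar_distr_translate[OF M])
qed

definition vshell :: "int \<Rightarrow> 'k::discretely_valued_field set" where
  "vshell v = {x. x \<noteq> 0 \<and> val x = v}"

lemma vshell_eq: "vshell v = vball 0 v - vball 0 (v + 1)"
  by (auto simp: vshell_def vball_iff vge_def)

lemma vshell_sets: "haar_measure M \<Longrightarrow> vshell v \<in> sets M"
  by (simp add: vshell_eq sets.Diff)

lemma emeasure_vball_finite: "haar_measure M \<Longrightarrow> emeasure M (vball x n) < \<infinity>"
  by (simp add: emeasure_vball)

lemma volball_Suc:
  fixes M :: "'k::nonarch_local_field measure"
  assumes "haar_measure M" shows "volball M (n + 1) = volball M n / resq TYPE('k)"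
  using volball_step[OF assms, of n] resq_gt_0[where 'k='k] by (simp add: field_simps)

lemma emeasure_vshell_finite: "haar_measure M \<Longrightarrow> emeasure M (vshell n) < \<infinity>"
proof -
  assume M: "haar_measure M"
  have "emeasure M (vshell n) \<le> emeasure M (vball 0 n)"
    by (intro emeasure_mono) (auto simp: vshell_eq M)
  then show ?thesis using emeasure_vball_finite[OF M, of 0 n] by (rule le_less_trans)
qed

lemma measure_vshell:
  fixes M :: "'k::nonarch_local_field measure"
  assumes M: "haar_measure M"
  shows "measure M (vshell v) = (1 - 1 / resq TYPE('k)) * volball M v"
proof -
  have "measure M (vshell v) = measure M (vball 0 v) - measure M (vball 0 (v + 1))"
    unfolding vshell_eq using emeasure_vball_finite[OF M, of 0 v] vball_mono[of v "v + 1" 0]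
    by (intro measure_Diff) (auto simp: M)
  then show ?thesis using volball_Suc[OF M, of v] by (simp add: measure_vball[OF M] algebra_simps)
qed

text \<open>A function of the valuation is constant on shells, so its integral is a series. The
  injection v lists the valuations in the support, which covers both series running into 0 and
  series running out to infinity.\<close>

lemma shell_integral:
  fixes M :: "'k::nonarch_local_field measure" and h :: "int \<Rightarrow> real" and v :: "nat \<Rightarrow> int"
  assumes M: "haar_measure M" and v: "inj v"
    and sum: "summable (\<lambda>i. \<bar>h (v i)\<bar> * volball M (v i))"
    and f: "\<And>x. f x = (if x \<noteq> 0 \<and> val x \<in> range v then h (val x) else 0)"
  shows "integrable M f"
    "(\<lambda>i. h (v i) * ((1 - 1 / resq TYPE('k)) * volball M (v i))) sums integral\<^sup>L M f"
proof -
  define F where "F i = (\<lambda>x::'k. h (v i) * indicator (vshell (v i)) x)" for i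
  have int: "integrable M (F i)" "integral\<^sup>L M (F i) = h (v i) * ((1 - 1 / resq TYPE('k)) * volball M (v i))"
    "(LINT x|M. norm (F i x)) = \<bar>h (v i)\<bar> * ((1 - 1 / resq TYPE('k)) * volball M (v i))" for i
    using emeasure_vshell_finite[OF M, of "v i"] vshell_sets[OF M, of "v i"]
    by (auto simp: F_def abs_mult measure_vshell[OF M])
  have S: "(\<lambda>i. F i x) sums f x" for x
  proof (cases "x \<noteq> 0 \<and> val x \<in> range v")
    case True
    then obtain j where j: "val x = v j" by blast
    have "F i x = (if i = j then f x else 0)" for i
      using True j v by (auto simp: F_def f vshell_def inj_eq)
    then show ?thesis using sums_single[of j "\<lambda>_. f x"] by simp
  next
    case False
    then have "F i x = 0" for i by (auto simp: F_def vshell_def indicator_def)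
    then show ?thesis using False by (auto simp: f)
  qed
  have eq: "(\<lambda>x. \<Sum>i. F i x) = f" by (rule ext) (rule sums_unique[OF S, symmetric])
  have AE: "AE x in M. summable (\<lambda>i. norm (F i x))"
  proof (rule AE_I2)
    fix x
    show "summable (\<lambda>i. norm (F i x))"
    proof (cases "x \<noteq> 0 \<and> val x \<in> range v")
      case True
      then obtain j where j: "val x = v j" by blast
      have "norm (F i x) = (if i = j then norm (f x) else 0)" for i
        using True j v by (auto simp: F_def f vshell_def inj_eq)
      then show ?thesis using sums_single[of j "\<lambda>_. norm (f x)"] sums_summable by simp
    next
      case False
      then have "F i x = 0" for i by (auto simp: F_def vshell_def indicator_def)
      then show ?thesis by simp
    qed
  qed
  have sm: "summable (\<lambda>i. LINT x|M. norm (F i x))"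
    unfolding int using summable_mult[OF sum, of "1 - 1 / resq TYPE('k)"] by (simp add: mult_ac)
  show "integrable M f" using integrable_suminf[OF int(1) AE sm] by (simp only: eq)
  show "(\<lambda>i. h (v i) * ((1 - 1 / resq TYPE('k)) * volball M (v i))) sums integral\<^sup>L M f"
    using sums_integral[OF int(1) AE sm] by (simp only: eq int)
qed

text \<open>The value of a kernel on a pair of balls: \<open>k\<close> of the valuation of the distance if they are
  disjoint, and \<open>kb\<close> of the exponent of the larger ball if they are nested.\<close>

definition bkern :: "(int \<Rightarrow> real) \<Rightarrow> (int \<Rightarrow> real) \<Rightarrow> 'k::discretely_valued_field \<Rightarrow> int \<Rightarrow> 'k \<Rightarrow> int \<Rightarrow> real" where
  "bkern k kb x n y m = (if y \<in> vball x (min n m) then kb (min n m) else k (val (y - x)))"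

text \<open>The displacement z - y is strictly smaller than y - x, so the distance to x is constant
  on a ball that misses x.\<close>

lemma val_const_off_ball:
  assumes "y \<notin> vball x n" "z \<in> vball y m" "y \<notin> vball x m"
  shows "z \<noteq> x \<and> val (z - x) = val (y - x)"
proof -
  have ne: "y - x \<noteq> 0" using assms(1) by auto
  have "vge m (z - y)" "\<not> vge m (y - x)" using assms by (auto simp: vball_iff)
  then have "vge (val (y - x) + 1) (z - y)" using ne by (auto simp: vge_def)
  from val_add_eq[OF ne this] show ?thesis by simp
qed

section \<open>Potentials and energies of balls for the Riesz kernel\<close>

definition rieszk :: "'k::nonarch_local_field itself \<Rightarrow> real \<Rightarrow> int \<Rightarrow> real" where
  "rieszk T s v = resq TYPE('k) powr (- real_of_int v * (2 * s - 1))" for T :: "'k itself"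

text \<open>The mean of the kernel over a ball, seen from one of its points, divided by the kernel
  at the largest distance in the ball: the geometric series of ratio q^(-2 s), weighted by the
  relative volume 1 - 1/q of a shell in its ball.\<close>

definition rieszA :: "'k::nonarch_local_field itself \<Rightarrow> real \<Rightarrow> real" where
  "rieszA T s = (1 - 1 / resq TYPE('k)) / (1 - resq TYPE('k) powr (- 2 * s))" for T :: "'k itself"

context
  fixes M :: "'k::nonarch_local_field measure" and s :: real
  assumes M: "haar_measure M" and s: "s > 0"
begin

lemma rieszk_eq: "x \<noteq> 0 \<Longrightarrow> absval x powr (2 * s - 1) = rieszk TYPE('k) s (val x)" for x :: 'k
  by (simp add: absval_powr rieszk_def)

lemma riesz_ball:
  "integrable M (\<lambda>u. absval u powr (2 * s - 1) * indicator (vball 0 n) u)"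
  "(LINT u|M. absval u powr (2 * s - 1) * indicator (vball 0 n) u) = rieszA TYPE('k) s * rieszk TYPE('k) s n * volball M n"
proof -
  let ?q = "resq TYPE('k)"
  let ?v = "\<lambda>i::nat. n + int i"
  have q: "?q > 1" "?q > 0" using resq_gt_1 resq_gt_0 by auto
  \<comment> \<open>Relative to shell n, the kernel on shell n + i contributes q^(-i (2 s - 1)) and
    the volume q^(-i); the ratio of the series is below 1 because s is positive.\<close>
  have trm: "rieszk TYPE('k) s (?v i) * volball M (?v i) = rieszk TYPE('k) s n * volball M n * (?q powr (- 2 * s)) ^ i" for i
  proof -
    have "(?q powr (- 2 * s)) ^ i = ?q powr (- 2 * s * real i)"
      using q by (simp add: powr_powr flip: powr_realpow)
    then show ?thesis
      unfolding rieszk_def volball_eq[OF M, of "?v i"] volball_eq[OF M, of n]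
      using q by (simp add: powr_add[symmetric] algebra_simps)
  qed
  have lt: "\<bar>?q powr (- 2 * s)\<bar> < 1" using q s by (simp add: powr_less_one)
  have gs: "(\<lambda>i. rieszk TYPE('k) s n * volball M n * (?q powr (- 2 * s)) ^ i) sums (rieszk TYPE('k) s n * volball M n * (1 / (1 - ?q powr (- 2 * s))))"
    using geometric_sums[of "?q powr (- 2 * s)"] lt by (intro sums_mult) auto
  have pos: "rieszk TYPE('k) s v \<ge> 0" for v by (simp add: rieszk_def)
  have sum: "summable (\<lambda>i. \<bar>rieszk TYPE('k) s (?v i)\<bar> * volball M (?v i))"
    using sums_summable[OF gs] pos by (simp add: trm)
  have f: "absval x powr (2 * s - 1) * indicator (vball 0 n) x =
      (if x \<noteq> 0 \<and> val x \<in> range ?v then rieszk TYPE('k) s (val x) else 0)" for x :: 'k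
  proof -
    have "val x \<in> range ?v \<longleftrightarrow> n \<le> val x" by (auto simp: image_iff intro: zle_iff_zadd[THEN iffD1])
    then show ?thesis by (auto simp: rieszk_eq vball_iff vge_def indicator_def)
  qed
  have inj: "inj ?v" by (auto simp: inj_def)
  note sh = shell_integral[OF M inj sum f]
  show "integrable M (\<lambda>u. absval u powr (2 * s - 1) * indicator (vball 0 n) u)" by (rule sh(1))
  have eq: "rieszk TYPE('k) s (?v i) * ((1 - 1 / ?q) * volball M (?v i)) =
      (1 - 1 / ?q) * (rieszk TYPE('k) s n * volball M n * (?q powr (- 2 * s)) ^ i)" for i
    unfolding trm[symmetric] by simp
  have "(\<lambda>i. rieszk TYPE('k) s (?v i) * ((1 - 1 / ?q) * volball M (?v i))) sums
      ((1 - 1 / ?q) * (rieszk TYPE('k) s n * volball M n * (1 / (1 - ?q powr (- 2 * s)))))"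
    unfolding eq by (rule sums_mult[OF gs])
  from sums_unique2[OF sh(2) this]
  show "(LINT u|M. absval u powr (2 * s - 1) * indicator (vball 0 n) u) = rieszA TYPE('k) s * rieszk TYPE('k) s n * volball M n"
    by (simp add: rieszA_def)
qed

lemma riesz_ball':
  assumes "x \<in> vball y n"
  shows "integrable M (\<lambda>u. absval (u - x) powr (2 * s - 1) * indicator (vball y n) u)"
  "(LINT u|M. absval (u - x) powr (2 * s - 1) * indicator (vball y n) u) = rieszA TYPE('k) s * rieszk TYPE('k) s n * volball M n"
proof -
  have "(indicator (vball y n) u :: real) = indicator (vball 0 n) (- x + u)" for u
    using vball_eq[OF assms] by (auto simp: vball_iff indicator_def split: if_splits)
  moreover have "absval (u - x) = absval (- x + u)" for u by simp
  ultimately show "integrable M (\<lambda>u. absval (u - x) powr (2 * s - 1) * indicator (vball y n) u)"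
    "(LINT u|M. absval (u - x) powr (2 * s - 1) * indicator (vball y n) u) = rieszA TYPE('k) s * rieszk TYPE('k) s n * volball M n"
    using haar_integral_translate[OF M riesz_ball(1), of "- x" n] riesz_ball(2)[of n] by simp_all
qed

text \<open>Off the ball the kernel is constant in u; on the ball every point is a centre, so the
  integral around the centre applies.\<close>

lemma riesz_potential:
  "integrable M (\<lambda>u. absval (x - u) powr (2 * s - 1) * indicator (vball y n) u)" (is "integrable M ?h")
  "(LINT u|M. absval (x - u) powr (2 * s - 1) * indicator (vball y n) u) =
     (if x \<in> vball y n then rieszA TYPE('k) s * rieszk TYPE('k) s n else absval (x - y) powr (2 * s - 1)) * volball M n"
    (is "_ = ?R")
proof -
  have sym: "absval (x - u) = absval (u - x)" for u
    using absval_mult[of "-1" "x - u"] by (simp add: absval_def)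
  have "integrable M ?h \<and> integral\<^sup>L M ?h = ?R"
  proof (cases "x \<in> vball y n")
    case True then show ?thesis unfolding sym by (simp add: riesz_ball')
  next
    case False
    have "?h u = rieszk TYPE('k) s (val (y - x)) * indicator (vball y n) u" for u
    proof (cases "u \<in> vball y n")
      case True
      have "y \<notin> vball x n" using False vball_sym[of x y n] by simp
      then have "u \<noteq> x \<and> val (u - x) = val (y - x)" using val_const_off_ball True by blast
      then show ?thesis using True by (simp add: sym rieszk_eq)
    qed simp
    then have eq: "?h = (\<lambda>u. rieszk TYPE('k) s (val (y - x)) * indicator (vball y n) u)" ..
    have "absval (x - y) powr (2 * s - 1) = rieszk TYPE('k) s (val (y - x))"
      using False by (subst rieszk_eq[symmetric]) (auto simp: sym)
    then show ?thesis unfolding eq using False emeasure_vball_finite[OF M, of y n] M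
      by (simp add: measure_vball[OF M])
  qed
  then show "integrable M ?h" "integral\<^sup>L M ?h = ?R" by blast+
qed

definition "riesz_pot y n x =
  (if x \<in> vball y n then rieszA TYPE('k) s * rieszk TYPE('k) s n else absval (x - y) powr (2 * s - 1)) * volball M n"

text \<open>Disjoint balls see each other at one fixed distance. For nested balls the larger one
  governs the energy, since it looks the same from every point of the smaller one.\<close>

lemma riesz_energy:
  "integrable M (\<lambda>x. riesz_pot y n x * indicator (vball z m) x)" (is "integrable M ?h")
  "(LINT x|M. riesz_pot y n x * indicator (vball z m) x) =
     volball M m * volball M n * bkern (rieszk TYPE('k) s) (\<lambda>n. rieszA TYPE('k) s * rieszk TYPE('k) s n) z m y n" (is "_ = ?R")
proof -
  have fin: "emeasure M (vball z m) < \<infinity>" "vball z m \<in> sets M" for z m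
    using emeasure_vball_finite[OF M] M by auto
  consider (disj) "y \<notin> vball z (min m n)" | (sub) "y \<in> vball z (min m n)" "n \<le> m"
    | (sup) "y \<in> vball z (min m n)" "m < n" by linarith
  then have "integrable M ?h \<and> integral\<^sup>L M ?h = ?R"
  proof cases
    case disj
    have "?h x = rieszk TYPE('k) s (val (y - z)) * volball M n * indicator (vball z m) x" for x
    proof (cases "x \<in> vball z m")
      case True
      have "x \<notin> vball y n"
        using disj True unfolding vball_disjnt_iff[symmetric] by blast
      moreover have "z \<notin> vball y m" "z \<notin> vball y (min m n)"
        using disj vball_sym vball_mono[of "min m n" m z] by auto
      then have "x \<noteq> y \<and> val (x - y) = val (z - y)" using val_const_off_ball True by blast
      ultimately show ?thesis using True
        by (simp add: riesz_pot_def rieszk_eq val_minus_commute[of y z])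
    qed simp
    then have eq: "?h = (\<lambda>x. rieszk TYPE('k) s (val (y - z)) * volball M n * indicator (vball z m) x)" ..
    show ?thesis unfolding eq using fin[of z m] disj
      by (simp add: bkern_def measure_vball[OF M])
  next
    case sub
    then have "vball z m \<subseteq> vball y n" using vball_sym[of y z n] by (intro vball_subset) auto
    then have eq: "?h = (\<lambda>x. rieszA TYPE('k) s * rieszk TYPE('k) s n * volball M n * indicator (vball z m) x)"
      by (intro ext) (auto simp: riesz_pot_def indicator_def)
    show ?thesis unfolding eq using fin[of z m] sub
      by (simp add: bkern_def measure_vball[OF M] min_absorb2)
  next
    case sup
    then have y: "y \<in> vball z m" by simp
    have "vball y n \<subseteq> vball z m" using sup by (intro vball_subset) auto
    \<comment> \<open>Outside the inner ball its potential is its volume times the kernel. Extending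
      this expression to the whole outer ball overcounts exactly the self-energy of the inner ball,
      so the first and the last term cancel after integration.\<close>
    then have eq: "?h = (\<lambda>x.
      rieszA TYPE('k) s * rieszk TYPE('k) s n * volball M n * indicator (vball y n) x
      + volball M n * (absval (x - y) powr (2 * s - 1) * indicator (vball z m) x)
      - volball M n * (absval (x - y) powr (2 * s - 1) * indicator (vball y n) x))"
      by (intro ext) (auto simp: riesz_pot_def indicator_def)
    note I = riesz_ball'[OF y] riesz_ball'[OF vball_centre[of y n]]
    have K: "integrable M (\<lambda>x. rieszA TYPE('k) s * rieszk TYPE('k) s n * volball M n * indicator (vball y n) x)"
      using fin[of y n] by simp
    show ?thesis unfolding eq using fin[of y n] sup
      by (simp add: I K bkern_def measure_vball[OF M] min_absorb1)
  qed
  then show "integrable M ?h" "integral\<^sup>L M ?h = ?R" by blast+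
qed

text \<open>The inner integral turns each ball of g into its potential and the outer one turns
  potentials into energies.\<close>

lemma complementary_form_balls:
  assumes f: "\<And>y. f (nbar y) = (\<Sum>i\<in>I. c i * indicator (vball (x i) (n i)) y)"
    and g: "\<And>y. g (nbar y) = (\<Sum>j\<in>J. d j * indicator (vball (z j) (m j)) y)"
  shows "complementary_form M s f g = (\<Sum>i\<in>I. \<Sum>j\<in>J. c i * cnj (d j) *
     of_real (volball M (n i) * volball M (m j) * bkern (rieszk TYPE('k) s) (\<lambda>n. rieszA TYPE('k) s * rieszk TYPE('k) s n) (x i) (n i) (z j) (m j)))"
proof -
  have inner: "(LINT x'|M. complex_of_real (absval (x - x') powr (2 * s - 1)) * f (nbar x) * cnj (g (nbar x')))
     = f (nbar x) * (\<Sum>j\<in>J. cnj (d j) * of_real (riesz_pot (z j) (m j) x))" for x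
  proof -
    have "complex_of_real (absval (x - x') powr (2 * s - 1)) * f (nbar x) * cnj (g (nbar x')) =
      (\<Sum>j\<in>J. f (nbar x) * cnj (d j) * of_real (absval (x - x') powr (2 * s - 1) * indicator (vball (z j) (m j)) x'))" for x'
      unfolding g cnj_sum sum_distrib_left by (intro sum.cong refl) (simp add: indicator_def)
    moreover have "integrable M (\<lambda>x'. f (nbar x) * cnj (d j) * of_real (absval (x - x') powr (2 * s - 1) * indicator (vball (z j) (m j)) x'))" for j
      using riesz_potential(1)[of x "z j" "m j"] by (intro integrable_mult_right integrable_of_real)
    ultimately have "(LINT x'|M. complex_of_real (absval (x - x') powr (2 * s - 1)) * f (nbar x) * cnj (g (nbar x')))
      = (\<Sum>j\<in>J. LINT x'|M. f (nbar x) * cnj (d j) * of_real (absval (x - x') powr (2 * s - 1) * indicator (vball (z j) (m j)) x'))"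
      by (simp add: Bochner_Integration.integral_sum)
    also have "\<dots> = f (nbar x) * (\<Sum>j\<in>J. cnj (d j) * of_real (riesz_pot (z j) (m j) x))"
      unfolding integral_mult_right_zero integral_complex_of_real riesz_potential(2) riesz_pot_def sum_distrib_left
      by (simp add: mult_ac)
    finally show ?thesis .
  qed
  have eq: "f (nbar y) * (\<Sum>j\<in>J. cnj (d j) * of_real (riesz_pot (z j) (m j) y)) =
     (\<Sum>i\<in>I. \<Sum>j\<in>J. c i * cnj (d j) * of_real (riesz_pot (z j) (m j) y * indicator (vball (x i) (n i)) y))" for y
    unfolding f sum_product by (intro sum.cong refl) (simp add: indicator_def)
  have int: "integrable M (\<lambda>y. c i * cnj (d j) * of_real (riesz_pot (z j) (m j) y * indicator (vball (x i) (n i)) y))" for i j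
    using riesz_energy(1)[of "z j" "m j" "x i" "n i"] by (intro integrable_mult_right integrable_of_real)
  have "complementary_form M s f g = (LINT y|M. (\<Sum>i\<in>I. \<Sum>j\<in>J. c i * cnj (d j) * of_real (riesz_pot (z j) (m j) y * indicator (vball (x i) (n i)) y)))"
    unfolding complementary_form_def inner eq ..
  also have "\<dots> = (\<Sum>i\<in>I. \<Sum>j\<in>J. LINT y|M. c i * cnj (d j) * of_real (riesz_pot (z j) (m j) y * indicator (vball (x i) (n i)) y))"
    using int by (simp add: Bochner_Integration.integral_sum)
  finally show ?thesis
    unfolding integral_mult_right_zero integral_complex_of_real riesz_energy(2) .
qed

end

section \<open>The Steinberg form on balls\<close>

lemma vball_complex_integral:
  assumes M: "haar_measure M"
  shows "integrable M (\<lambda>u. indicator (vball x n) u :: complex)"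
    "(LINT u|M. indicator (vball x n) u) = complex_of_real (volball M n)"
proof -
  have eq: "(indicator (vball x n) u :: complex) = of_real (indicator (vball x n) u)" for u
    by (simp add: indicator_def)
  have int: "integrable M (\<lambda>u. indicator (vball x n) u :: real)"
    using emeasure_vball_finite[OF M, of x n] M by simp
  show "integrable M (\<lambda>u. indicator (vball x n) u :: complex)"
    unfolding eq using int by (rule integrable_of_real)
  show "(LINT u|M. indicator (vball x n) u) = complex_of_real (volball M n)"
    unfolding eq integral_complex_of_real using emeasure_vball_finite[OF M, of x n] M
    by (simp add: measure_vball[OF M])
qed

lemma haar_integral_balls:
  fixes M :: "'k::nonarch_local_field measure" and c :: "'i \<Rightarrow> complex"
  assumes M: "haar_measure M"
    and f: "\<And>y. f y = (\<Sum>i\<in>I. c i * indicator (vball (x i) (n i)) y)"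
  shows "integral\<^sup>L M f = (\<Sum>i\<in>I. c i * of_real (volball M (n i)))"
proof -
  have int: "integrable M (\<lambda>y. c i * indicator (vball (x i) (n i)) y)" for i
    by (intro integrable_mult_right vball_complex_integral[OF M])
  have "integral\<^sup>L M f = (\<Sum>i\<in>I. LINT y|M. c i * indicator (vball (x i) (n i)) y)"
    unfolding f using int by (simp add: Bochner_Integration.integral_sum)
  also have "\<dots> = (\<Sum>i\<in>I. c i * of_real (volball M (n i)))"
    by (simp add: vball_complex_integral[OF M])
  finally show ?thesis .
qed

text \<open>A positive multiple of -log|x|. Against the weight 1/|u| every shell has the same mass,
  (1 - 1/q) times the volume of the ring of integers, so counting the shells on which a character is
  trivial gives a linear function of the valuation.\<close>

definition logk :: "'k::nonarch_local_field measure \<Rightarrow> int \<Rightarrow> real" where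
  "logk M v = (1 - 1 / resq TYPE('k)) * volball M 0 * real_of_int v" for M :: "'k measure"

text \<open>For disjoint balls the Fourier integral contains one further shell, on which the
  character integrates to a negative value; for nested balls this shell is cut off. The added
  constant is the contribution of that shell with the sign reversed.\<close>

definition logkb :: "'k::nonarch_local_field measure \<Rightarrow> int \<Rightarrow> real" where
  "logkb M v = logk M v + volball M 0 / resq TYPE('k)" for M :: "'k measure"

section \<open>Additive characters and their Fourier integrals\<close>

context
  fixes \<psi> :: "'k::nonarch_local_field \<Rightarrow> complex"
  assumes psi: "nontrivial_additive_character \<psi>"
begin

lemma psi_add: "\<psi> (x + y) = \<psi> x * \<psi> y" and psi_norm [simp]: "cmod (\<psi> x) = 1"
  and psi_cont: "continuous_on UNIV \<psi>" and psi_nontriv: "\<exists>x. \<psi> x \<noteq> 1"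
  using psi by (auto simp: nontrivial_additive_character_def)

lemma psi_0 [simp]: "\<psi> 0 = 1"
proof -
  have "\<psi> 0 \<noteq> 0" using psi_norm[of 0] by force
  then show ?thesis using psi_add[of 0 0] by simp
qed

lemma psi_minus: "\<psi> (- x) = cnj (\<psi> x)"
proof -
  have "\<psi> x * \<psi> (- x) = 1" using psi_add[of x "- x"] by simp
  moreover have "\<psi> x * cnj (\<psi> x) = 1" using complex_norm_square[of "\<psi> x"] by simp
  ultimately have "\<psi> x * \<psi> (- x) = \<psi> x * cnj (\<psi> x)" by simp
  moreover have "\<psi> x \<noteq> 0" using psi_norm[of x] by force
  ultimately show ?thesis by simp
qed

lemma psi_diff: "\<psi> (x - y) = \<psi> x * cnj (\<psi> y)"
  using psi_add[of x "- y"] by (simp add: psi_minus)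

text \<open>The image of a small ball is a subgroup of the circle close to 1; squaring moves elements
  away from 1, so it is trivial.\<close>

lemma psi_locally_trivial: "\<exists>N. \<forall>x\<in>vball 0 N. \<psi> x = 1"
proof -
  have "\<psi> \<midarrow>0\<rightarrow> \<psi> 0" using psi_cont by (simp add: continuous_on_def del: psi_0)
  then have "(\<psi> \<longlongrightarrow> \<psi> 0) (nhds 0)" unfolding tendsto_at_iff_tendsto_nhds .
  then have "eventually (\<lambda>x. dist (\<psi> x) 1 < 1/2) (nhds 0)"
    unfolding psi_0 by (rule tendstoD) simp
  then obtain N where N: "\<And>x. x \<in> vball 0 N \<Longrightarrow> cmod (\<psi> x - 1) < 1/2"
    unfolding eventually_nhds_vball dist_norm by blast
  have dbl: "cmod (\<psi> (x + x) - 1) \<ge> 3/2 * cmod (\<psi> x - 1)" if x: "x \<in> vball 0 N" for x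
  proof -
    have "\<psi> (x + x) - 1 = (\<psi> x - 1) * (\<psi> x + 1)" unfolding psi_add by (simp add: algebra_simps)
    moreover have "cmod (\<psi> x + 1) \<ge> 3/2"
      using N[OF x] norm_triangle_ineq2[of 2 "1 - \<psi> x"] by (simp add: norm_minus_commute add.commute)
    from mult_left_mono[OF this norm_ge_zero[of "\<psi> x - 1"]]
    have "cmod (\<psi> x - 1) * (3/2) \<le> cmod (\<psi> x - 1) * cmod (\<psi> x + 1)" .
    ultimately show ?thesis by (simp only: norm_mult mult.commute[of "3/2"])
  qed
  have iter: "\<exists>y\<in>vball 0 N. (3/2) ^ n * cmod (\<psi> x - 1) \<le> cmod (\<psi> y - 1)" if x: "x \<in> vball 0 N" for n x
  proof (induction n)
    case 0 then show ?case using x by auto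
  next
    case (Suc n)
    then obtain y where y: "y \<in> vball 0 N" "(3/2) ^ n * cmod (\<psi> x - 1) \<le> cmod (\<psi> y - 1)" by blast
    then have "y + y \<in> vball 0 N" using vge_add[of N y y] by (simp add: vball_iff)
    moreover have "(3/2) ^ Suc n * cmod (\<psi> x - 1) \<le> cmod (\<psi> (y + y) - 1)"
      using y(2) dbl[OF y(1)] by simp
    ultimately show ?case by blast
  qed
  have "\<psi> x = 1" if x: "x \<in> vball 0 N" for x
  proof (rule ccontr)
    assume "\<psi> x \<noteq> 1"
    then have p: "cmod (\<psi> x - 1) > 0" by simp
    obtain n where "1 / cmod (\<psi> x - 1) < (3/2) ^ n" using real_arch_pow[of "3/2"] by auto
    then have "1 < (3/2) ^ n * cmod (\<psi> x - 1)" using p by (simp add: field_simps)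
    then show False using iter[OF x, of n] N by fastforce
  qed
  then show ?thesis by blast
qed

text \<open>A ball on which the character is trivial is enlarged step by step; the process must stop
  because the character is not trivial everywhere. The exponent c of the last good ball is the
  conductor.\<close>

lemma conductor_exists: "\<exists>c. (\<forall>x. vge c x \<longrightarrow> \<psi> x = 1) \<and> (\<exists>x. vge (c - 1) x \<and> \<psi> x \<noteq> 1)"
proof -
  obtain N where "\<forall>x\<in>vball 0 N. \<psi> x = 1" using psi_locally_trivial ..
  then have N: "\<psi> x = 1" if "vge N x" for x using that by (simp add: vball_iff)
  obtain x where x: "\<psi> x \<noteq> 1" using psi_nontriv by blast
  define P where "P k \<longleftrightarrow> (\<forall>y. vge (N - int k) y \<longrightarrow> \<psi> y = 1)" for k
  have "P 0" using N by (simp add: P_def)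
  have "\<not> P (nat (N - val x))"
  proof -
    have "x \<noteq> 0" using x by auto
    then have "vge (N - int (nat (N - val x))) x" using N[of x] x by (auto simp: vge_def)
    then show ?thesis using x unfolding P_def by blast
  qed
  have "\<exists>k. P k \<and> \<not> P (Suc k)"
  proof (rule ccontr)
    assume no: "\<nexists>k. P k \<and> \<not> P (Suc k)"
    have "P k" for k by (induction k) (use \<open>P 0\<close> no in auto)
    then show False using \<open>\<not> P (nat (N - val x))\<close> by simp
  qed
  then obtain k where k: "P k" "\<not> P (Suc k)" by blast
  have eq: "N - int (Suc k) = N - int k - 1" by simp
  show ?thesis using k unfolding P_def eq by blast
qed

context
  fixes M :: "'k measure" and c :: int
  assumes M: "haar_measure M"
    and c1: "\<And>x. vge c x \<Longrightarrow> \<psi> x = 1" and c2: "\<exists>x. vge (c - 1) x \<and> \<psi> x \<noteq> 1"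
begin

lemma psi_mult_measurable: "(\<lambda>u. \<psi> (z * u)) \<in> borel_measurable M"
  unfolding haar_measurable_cong[OF M]
  by (intro borel_measurable_continuous_onI continuous_on_compose2[OF psi_cont] continuous_intros) auto

lemma psi_ball_integrable: "integrable M (\<lambda>u. \<psi> (z * u) * indicator (vball x n) u)"
proof (rule Bochner_Integration.integrable_bound)
  show "integrable M (\<lambda>u. indicator (vball x n) u :: real)"
    using emeasure_vball_finite[OF M, of x n] M by simp
  show "(\<lambda>u. \<psi> (z * u) * indicator (vball x n) u) \<in> borel_measurable M"
    using psi_mult_measurable M by (intro borel_measurable_times borel_measurable_indicator) auto
qed (simp add: norm_mult indicator_def)

text \<open>Orthogonality of characters: either u -> psi (z u) is trivial on the ball, or
  translation by a suitable element of the ball multiplies the integral by a number different from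
  1.\<close>

lemma psi_ball_integral_0:
  "(LINT u|M. \<psi> (z * u) * indicator (vball 0 n) u) = (if vge (c - n) z then of_real (volball M n) else 0)"
proof (cases "vge (c - n) z")
  case True
  have "\<psi> (z * u) * indicator (vball 0 n) u = indicator (vball 0 n) u" for u
  proof (cases "u \<in> vball 0 n")
    case u: True
    then have "vge c (z * u)" using vge_mult[OF True, of n u] by (simp add: vball_iff)
    then show ?thesis by (simp add: c1)
  qed simp
  then have "(LINT u|M. \<psi> (z * u) * indicator (vball 0 n) u) = (LINT u|M. indicator (vball 0 n) u)"
    by (intro Bochner_Integration.integral_cong refl)
  then show ?thesis using True by (simp add: vball_complex_integral[OF M])
next
  case False
  then have z: "z \<noteq> 0" "val z < c - n" by (auto simp: vge_def)
  obtain w where w: "vge (c - 1) w" "\<psi> w \<noteq> 1" using c2 by blast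
  \<comment> \<open>Chosen so that z a = w with psi w different from 1. Since val z is at most c - n
    - 1 and w has valuation at least c - 1, the translation stays in the ball.\<close>
  define a where "a = w / z"
  have wa: "w = z * a" using z by (simp add: a_def)
  then have "vge (c - 1 - val z) a" using w z vge_times_iff by metis
  then have a: "vge n a" using z by (elim vge_mono) auto
  define I where "I = (LINT u|M. \<psi> (z * u) * indicator (vball 0 n) u)"
  have "I = (LINT u|M. \<psi> (z * (a + u)) * indicator (vball 0 n) (a + u))"
    unfolding I_def using haar_integral_translate(2)[OF M psi_ball_integrable[of z 0 n], of a] by simp
  also have "\<dots> = (LINT u|M. \<psi> w * (\<psi> (z * u) * indicator (vball 0 n) u))"
  proof (rule Bochner_Integration.integral_cong[OF refl])
    fix u
    have "vge n (a + u) \<longleftrightarrow> vge n u" using vge_add[OF a] vge_diff[of n "a + u" a] a by auto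
    then show "\<psi> (z * (a + u)) * indicator (vball 0 n) (a + u) = \<psi> w * (\<psi> (z * u) * indicator (vball 0 n) u)"
      by (simp add: wa distrib_left psi_add indicator_def vball_iff)
  qed
  also have "\<dots> = \<psi> w * I" by (simp add: I_def)
  finally have "I = 0" using w by simp
  then show ?thesis using False by (simp add: I_def)
qed

lemma psi_ball_integral:
  "(LINT u|M. \<psi> (z * u) * indicator (vball x n) u) =
     (if vge (c - n) z then \<psi> (z * x) * of_real (volball M n) else 0)"
proof -
  have "(LINT u|M. \<psi> (z * u) * indicator (vball x n) u) = (LINT u|M. \<psi> (z * (x + u)) * indicator (vball x n) (x + u))"
    using haar_integral_translate(2)[OF M psi_ball_integrable[of z x n], of x] by simp
  also have "\<dots> = (LINT u|M. \<psi> (z * x) * (\<psi> (z * u) * indicator (vball 0 n) u))"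
    by (simp add: distrib_left psi_add indicator_def vball_iff mult.assoc)
  finally show ?thesis by (simp add: psi_ball_integral_0)
qed

lemma psi_shell:
  "integrable M (\<lambda>u. \<psi> (z * u) * indicator (vshell v) u)"
  "(LINT u|M. \<psi> (z * u) * indicator (vshell v) u) = of_real (volball M v *
     (of_bool (vge (c - v) z) - of_bool (vge (c - (v + 1)) z) / resq TYPE('k)))"
proof -
  have eq: "(\<lambda>u. \<psi> (z * u) * indicator (vshell v) u) =
    (\<lambda>u. \<psi> (z * u) * indicator (vball 0 v) u - \<psi> (z * u) * indicator (vball 0 (v + 1)) u)"
    using vball_mono[of v "v + 1" 0] by (intro ext) (auto simp: vshell_eq indicator_def)
  show "integrable M (\<lambda>u. \<psi> (z * u) * indicator (vshell v) u)"
    unfolding eq by (intro Bochner_Integration.integrable_diff psi_ball_integrable)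
  show "(LINT u|M. \<psi> (z * u) * indicator (vshell v) u) = of_real (volball M v *
     (of_bool (vge (c - v) z) - of_bool (vge (c - (v + 1)) z) / resq TYPE('k)))"
    unfolding eq Bochner_Integration.integral_diff[OF psi_ball_integrable psi_ball_integrable] psi_ball_integral_0
    by (simp add: volball_Suc[OF M] right_diff_distrib)
qed

lemma sum_of_bool_int: "(\<Sum>v\<in>{l..<N}. of_bool (w \<le> v)) = real_of_int (N - w)"
  if "l \<le> w" "w \<le> N" for l w N :: int
proof -
  have "{l..<N} \<inter> {v. w \<le> v} = {w..<N}" using that by auto
  then show ?thesis using that by simp
qed

text \<open>The weight q^v is 1/|u| on the shell, so this is the Fourier transform of 1/|u|, cut off
  near 0 at exponent N and away from 0 by the Fourier supports of the two balls. The cutoff N enters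
  only through an additive constant common to all pairs of balls.\<close>

lemma psi_annulus:
  fixes x y :: 'k
  assumes N: "c - min n m \<le> N" "x \<noteq> y \<Longrightarrow> c - val (x - y) \<le> N"
  shows "(\<Sum>v\<in>{c - min n m..<N}. of_real (resq TYPE('k) powr real_of_int v) *
        (LINT u|M. \<psi> ((x - y) * u) * indicator (vshell v) u)) =
     complex_of_real (bkern (logk M) (logkb M) x n y m + (logk M (N - c) - volball M 0 / resq TYPE('k)))"
proof -
  let ?q = "resq TYPE('k)" and ?l = "c - min n m" and ?z = "x - y"
  have q: "?q > 0" using resq_gt_0 by auto
  have V: "?q powr real_of_int v * volball M v = volball M 0" for v
    using q by (simp add: volball_eq[OF M, of v] powr_minus field_simps)
  have "(\<Sum>v\<in>{?l..<N}. of_real (?q powr real_of_int v) * (LINT u|M. \<psi> (?z * u) * indicator (vshell v) u))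
    = complex_of_real (\<Sum>v\<in>{?l..<N}. volball M 0 * (of_bool (vge (c - v) ?z) - of_bool (vge (c - (v + 1)) ?z) / ?q))"
    unfolding psi_shell(2) of_real_mult[symmetric] of_real_sum[symmetric] mult.assoc[symmetric] V ..
  also have "(\<Sum>v\<in>{?l..<N}. volball M 0 * (of_bool (vge (c - v) ?z) - of_bool (vge (c - (v + 1)) ?z) / ?q))
    = volball M 0 * ((\<Sum>v\<in>{?l..<N}. of_bool (vge (c - v) ?z)) - (\<Sum>v\<in>{?l..<N}. of_bool (vge (c - (v + 1)) ?z)) / ?q)"
    by (simp only: sum_distrib_left[symmetric] sum_subtractf sum_divide_distrib)
  also have "\<dots> = bkern (logk M) (logkb M) x n y m + (logk M (N - c) - volball M 0 / ?q)"
  proof (cases "y \<in> vball x (min n m)")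
    case True
    then have z: "vge (min n m) ?z" by (simp add: vball_iff vge_diff_commute)
    have vg: "vge (c - v) ?z" "vge (c - (v + 1)) ?z" if "v \<in> {?l..<N}" for v
      using that[unfolded atLeastLessThan_iff] by (intro vge_mono[OF z]; linarith)+
    have 1: "(\<Sum>v\<in>{?l..<N}. of_bool (vge (c - v) ?z)) = real_of_int (N - ?l)"
      using N(1) vg by simp
    have 2: "(\<Sum>v\<in>{?l..<N}. of_bool (vge (c - (v + 1)) ?z)) = real_of_int (N - ?l)"
      using N(1) vg by simp
    show ?thesis unfolding 1 2 bkern_def logkb_def logk_def using True q by (simp add: field_simps)
  next
    case False
    then have z: "?z \<noteq> 0" "val ?z < min n m" by (auto simp: vball_iff vge_def val_minus_commute[of y x])
    \<comment> \<open>From this shell inwards the character is trivial; the shell just before it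
      gives the negative term.\<close>
    let ?w = "c - val ?z"
    have "vge (c - v) ?z \<longleftrightarrow> ?w \<le> v" "vge (c - (v + 1)) ?z \<longleftrightarrow> ?w - 1 \<le> v" for v
      using z(1) by (auto simp: vge_def)
    then have 1: "(\<Sum>v\<in>{?l..<N}. of_bool (vge (c - v) ?z)) = real_of_int (N - ?w)"
      and 2: "(\<Sum>v\<in>{?l..<N}. of_bool (vge (c - (v + 1)) ?z)) = real_of_int (N - (?w - 1))"
      using z N(2) sum_of_bool_int[of ?l ?w N] sum_of_bool_int[of ?l "?w - 1" N] by simp_all
    show ?thesis unfolding 1 2 bkern_def logkb_def logk_def using False q
      by (simp add: val_minus_commute[of y x] field_simps)
  qed
  finally show ?thesis .
qed

text \<open>Mean zero of f acts twice: it makes the Fourier transform vanish near 0, so that the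
  singular weight 1/|y| is integrated over finitely many shells, and it removes the cutoff constant
  of \<open>psi_annulus\<close>.\<close>

lemma steinberg_form_balls_aux:
  assumes I: "finite I" and J: "finite J"
    and f: "\<And>y. f (nbar y) = (\<Sum>i\<in>I. a i * indicator (vball (x i) (n i)) y)"
    and g: "\<And>y. g (nbar y) = (\<Sum>j\<in>J. b j * indicator (vball (z j) (m j)) y)"
    and f0: "(\<Sum>i\<in>I. a i * of_real (volball M (n i))) = 0"
  shows "steinberg_form M \<psi> f g = (\<Sum>i\<in>I. \<Sum>j\<in>J. a i * cnj (b j) *
     of_real (volball M (n i) * volball M (m j) * bkern (logk M) (logkb M) (x i) (n i) (z j) (m j)))"
proof -
  let ?q = "resq TYPE('k)"
  have four: "fourier_nbar M \<psi> h y = (\<Sum>i\<in>K. e i * (\<psi> (y * w i) * of_real (volball M (l i)) * of_bool (vge (c - l i) y)))"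
    if h: "\<And>y. h (nbar y) = (\<Sum>i\<in>K. e i * indicator (vball (w i) (l i)) y)" for h K e w l y
  proof -
    have "fourier_nbar M \<psi> h y = (LINT u|M. (\<Sum>i\<in>K. e i * (\<psi> (y * u) * indicator (vball (w i) (l i)) u)))"
      unfolding fourier_nbar_def h
      by (intro Bochner_Integration.integral_cong refl) (simp add: sum_distrib_left mult_ac)
    also have "\<dots> = (\<Sum>i\<in>K. LINT u|M. e i * (\<psi> (y * u) * indicator (vball (w i) (l i)) u))"
      using psi_ball_integrable by (intro Bochner_Integration.integral_sum) auto
    also have "\<dots> = (\<Sum>i\<in>K. e i * (\<psi> (y * w i) * of_real (volball M (l i)) * of_bool (vge (c - l i) y)))"
      unfolding integral_mult_right_zero psi_ball_integral by (intro sum.cong refl) simp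
    finally show ?thesis .
  qed
  \<comment> \<open>The thresholds at which the characters belonging to the centres become trivial
    and the Fourier supports of the balls begin; N must dominate all of them. The element 0 keeps
    the set non-empty, so that the maximum makes sense.\<close>
  define B where "B = (\<lambda>i. c - n i) ` I \<union> (\<lambda>i. c - val (x i)) ` I \<union> (\<lambda>(i, j). c - min (n i) (m j)) ` (I \<times> J)
      \<union> (\<lambda>(i, j). c - val (x i - z j)) ` (I \<times> J) \<union> {0}"
  define N where "N = Max B"
  have B: "finite B" using I J by (simp add: B_def)
  have "b \<le> N" if "b \<in> B" for b using B that by (simp add: N_def)
  then have N: "i \<in> I \<Longrightarrow> c - n i \<le> N" "i \<in> I \<Longrightarrow> c - val (x i) \<le> N"
    "i \<in> I \<Longrightarrow> j \<in> J \<Longrightarrow> c - min (n i) (m j) \<le> N" "i \<in> I \<Longrightarrow> j \<in> J \<Longrightarrow> c - val (x i - z j) \<le> N" for i j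
    by (auto simp: B_def)
  have f_van: "fourier_nbar M \<psi> f y = 0" if y: "vge N y" for y
  proof -
    have "\<psi> (y * x i) = 1" "vge (c - n i) y" if i: "i \<in> I" for i
    proof -
      have "vge (val (x i)) (x i)" by (simp add: vge_def)
      from vge_mult[OF y this] have "vge c (y * x i)" using N(2)[OF i] by (elim vge_mono) simp
      then show "\<psi> (y * x i) = 1" by (rule c1)
      show "vge (c - n i) y" using N(1)[OF i] by (rule vge_mono[OF y])
    qed
    then have "fourier_nbar M \<psi> f y = (\<Sum>i\<in>I. a i * of_real (volball M (n i)))"
      unfolding four[OF f] by (intro sum.cong refl) simp
    then show ?thesis using f0 by simp
  qed
  define T where "T i j y = (\<Sum>v\<in>{c - min (n i) (m j)..<N}. of_real (?q powr real_of_int v) *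
        (\<psi> ((x i - z j) * y) * indicator (vshell v) y))" for i j y
  have T_eq: "T i j y = (if y \<noteq> 0 \<and> c - min (n i) (m j) \<le> val y \<and> val y < N
      then of_real (?q powr real_of_int (val y)) * \<psi> ((x i - z j) * y) else 0)" for i j y
  proof -
    have "T i j y = (\<Sum>v\<in>{c - min (n i) (m j)..<N}. if v = val y \<and> y \<noteq> 0 then
        of_real (?q powr real_of_int (val y)) * \<psi> ((x i - z j) * y) else 0)"
      unfolding T_def by (intro sum.cong refl) (auto simp: vshell_def indicator_def)
    then show ?thesis by (cases "y = 0") auto
  qed
  have key: "fourier_nbar M \<psi> f y * cnj (fourier_nbar M \<psi> g y) * complex_of_real (inverse (absval y)) =
    (\<Sum>i\<in>I. \<Sum>j\<in>J. a i * cnj (b j) * of_real (volball M (n i) * volball M (m j)) * T i j y)" for y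
  proof (cases "y = 0 \<or> N \<le> val y")
    case True
    then have "fourier_nbar M \<psi> f y = 0" by (intro f_van) (auto simp: vge_def)
    moreover have "T i j y = 0" for i j using True by (auto simp: T_eq)
    ultimately show ?thesis by simp
  next
    case False
    then have y: "y \<noteq> 0" "val y < N" by auto
    have inv: "inverse (absval y) = ?q powr real_of_int (val y)"
      using y by (simp add: absval_eq powr_minus)
    have "a i * (\<psi> (y * x i) * of_real (volball M (n i)) * of_bool (vge (c - n i) y)) *
        cnj (b j * (\<psi> (y * z j) * of_real (volball M (m j)) * of_bool (vge (c - m j) y))) *
        complex_of_real (inverse (absval y)) =
        a i * cnj (b j) * of_real (volball M (n i) * volball M (m j)) * T i j y" for i j
      using y by (cases "vge (c - n i) y"; cases "vge (c - m j) y")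
        (auto simp: T_eq inv vge_def psi_diff left_diff_distrib mult.commute[of y])
    then show ?thesis unfolding four[OF f] four[OF g] cnj_sum sum_product
      unfolding sum_distrib_right by (intro sum.cong refl)
  qed
  have intT: "integrable M (T i j)" for i j
    unfolding T_def by (intro Bochner_Integration.integrable_sum integrable_mult_right psi_shell(1))
  have LT: "integral\<^sup>L M (T i j) = of_real (bkern (logk M) (logkb M) (x i) (n i) (z j) (m j) + (logk M (N - c) - volball M 0 / ?q))"
    if "i \<in> I" "j \<in> J" for i j
  proof -
    have "integral\<^sup>L M (T i j) = (\<Sum>v\<in>{c - min (n i) (m j)..<N}. of_real (?q powr real_of_int v) *
        (LINT u|M. \<psi> ((x i - z j) * u) * indicator (vshell v) u))"
      unfolding T_def using psi_shell(1) by (simp add: Bochner_Integration.integral_sum)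
    then show ?thesis using psi_annulus N(3,4) that by simp
  qed
  \<comment> \<open>The cutoff constant; it is multiplied by the integral of f, which is 0.\<close>
  define K where "K = logk M (N - c) - volball M 0 / ?q"
  have "steinberg_form M \<psi> f g = (\<Sum>i\<in>I. \<Sum>j\<in>J. a i * cnj (b j) * of_real (volball M (n i) * volball M (m j)) * integral\<^sup>L M (T i j))"
    unfolding steinberg_form_def key using intT by (simp add: Bochner_Integration.integral_sum)
  also have "\<dots> = (\<Sum>i\<in>I. \<Sum>j\<in>J. a i * cnj (b j) *
     of_real (volball M (n i) * volball M (m j) * bkern (logk M) (logkb M) (x i) (n i) (z j) (m j))
     + (a i * of_real (volball M (n i))) * (cnj (b j) * of_real (volball M (m j)) * of_real K))"
    by (intro sum.cong refl) (simp add: LT K_def algebra_simps)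
  also have "\<dots> = (\<Sum>i\<in>I. \<Sum>j\<in>J. a i * cnj (b j) *
     of_real (volball M (n i) * volball M (m j) * bkern (logk M) (logkb M) (x i) (n i) (z j) (m j)))
     + (\<Sum>i\<in>I. a i * of_real (volball M (n i))) * (\<Sum>j\<in>J. cnj (b j) * of_real (volball M (m j)) * of_real K)"
    by (simp only: sum.distrib sum_product)
  finally show ?thesis by (simp add: f0)
qed

end
end

section \<open>The induced space and the generators of PGL(2)\<close>

abbreviation m2 :: "'k::zero \<Rightarrow> 'k \<Rightarrow> 'k \<Rightarrow> 'k \<Rightarrow> 'k^2^2" where
  "m2 a b c d \<equiv> vector [vector [a, b], vector [c, d]]"

lemma m2_nth [simp]: "m2 a b c d $ 1 $ 1 = a" "m2 a b c d $ 1 $ 2 = b"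
    "m2 a b c d $ 2 $ 1 = c" "m2 a b c d $ 2 $ 2 = d"
  by simp_all

lemma mat2_eq_iff: "A = B \<longleftrightarrow> A$1$1 = B$1$1 \<and> A$1$2 = B$1$2 \<and> A$2$1 = B$2$1 \<and> A$2$2 = B$2$2"
  for A B :: "'k^2^2"
  by (auto simp: vec_eq_iff forall_2)

lemma m2_eta: "A = m2 (A$1$1) (A$1$2) (A$2$1) (A$2$2)" for A :: "'k::zero^2^2"
  by (simp add: mat2_eq_iff)

lemma mat2_mult_nth: "(A ** B) $ i $ j = A$i$1 * B$1$j + A$i$2 * B$2$j" for A B :: "'k::semiring_1^2^2"
  by (simp add: matrix_matrix_mult_def sum_2)

lemma m2_mult: "m2 a b c d ** m2 a' b' c' d' = m2 (a*a' + b*c') (a*b' + b*d') (c*a' + d*c') (c*b' + d*d')"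
  for a :: "'k::semiring_1"
  by (simp add: mat2_eq_iff mat2_mult_nth)

lemma m2_one: "mat 1 = m2 1 0 0 (1::'k::semiring_1)"
  by (simp add: mat2_eq_iff mat_def)

lemma invertible_mat2_iff: "invertible A \<longleftrightarrow> A$1$1 * A$2$2 - A$1$2 * A$2$1 \<noteq> 0" for A :: "'k::field^2^2"
  by (simp add: invertible_det_nz det_2)

section \<open>Relations and generators\<close>

lemma pgl2_class_surj: "\<exists>A. invertible A \<and> g = pgl2_class A"
proof -
  have "proj_eq (rep_pgl2 g) (rep_pgl2 g)" "abs_pgl2 (rep_pgl2 g) = g"
    using Quotient_rep_reflp[OF Quotient_pgl2] Quotient_abs_rep[OF Quotient_pgl2] by auto
  then show ?thesis by (metis pgl2_class_eq_abs proj_eq_def)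
qed

lemma rep_pgl2_class:
  assumes A: "invertible A"
  shows "\<exists>c. c \<noteq> 0 \<and> rep_pgl2 (pgl2_class A) = mat c ** A"
proof -
  have "proj_eq (rep_pgl2 (pgl2_class A)) A"
    unfolding pgl2_class_eq_abs[OF A]
    by (rule Quotient_rep_abs[OF Quotient_pgl2 proj_eq_refl[OF A]])
  then show ?thesis unfolding proj_eq_def by blast
qed

lemma pgl2_class_mult:
  assumes "invertible A" "invertible B"
  shows "pgl2_class A * pgl2_class B = pgl2_class (A ** B)"
  using assms times_pgl2.abs_eq[OF proj_eq_refl proj_eq_refl, of A B]
  by (simp add: pgl2_class_eq_abs invertible_mult)

lemma pgl2_class_scale:
  assumes "c \<noteq> 0" "invertible (m2 x y z u)"
  shows "pgl2_class (m2 (c * x) (c * y) (c * z) (c * u)) = pgl2_class (m2 x y z u)"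
proof -
  have i: "invertible (m2 (c * x) (c * y) (c * z) (c * u))"
  proof -
    have "c * x * (c * u) - c * y * (c * z) = c * c * (x * u - y * z)" by (simp add: algebra_simps)
    then show ?thesis using assms unfolding invertible_mat2_iff m2_nth by simp
  qed
  have "m2 (c * x) (c * y) (c * z) (c * u) = mat c ** m2 x y z u"
    by (simp add: mat2_eq_iff mat_times_nth)
  then have "proj_eq (m2 (c * x) (c * y) (c * z) (c * u)) (m2 x y z u)"
    using assms i unfolding proj_eq_def by blast
  then show ?thesis
    using Quotient_rel_abs[OF Quotient_pgl2] i assms by (simp add: pgl2_class_eq_abs)
qed

lemma pgl2_class_one: "pgl2_class (mat 1) = 1"
  by (simp add: pgl2_class_eq_abs invertible_mat_1 one_pgl2.abs_eq)

lemma pgl2_inverse_unique: "g * h = 1 \<Longrightarrow> inverse g = h" for g :: "'k::field pgl2"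
  by (metis mult.assoc mult.left_neutral mult.right_neutral pgl2_left_inverse)

definition weyl :: "'k::field pgl2" where "weyl = pgl2_class (m2 0 1 1 0)"

lemma invertible_m2 [simp]: "invertible (m2 a b c d) \<longleftrightarrow> a * d - b * c \<noteq> 0" for a :: "'k::field"
  by (simp add: invertible_mat2_iff)

lemma nbar_add: "nbar x * nbar y = nbar (x + y)" for x :: "'k::field"
  by (simp add: nbar_def pgl2_class_mult m2_mult)

lemma nbar_0: "nbar 0 = 1"
  by (simp add: nbar_def m2_one[symmetric] pgl2_class_one)

lemma inverse_nbar: "inverse (nbar x) = nbar (- x)" for x :: "'k::field"
  by (rule pgl2_inverse_unique) (simp add: nbar_add nbar_0)

lemma borel_mult: "a \<noteq> 0 \<Longrightarrow> a' \<noteq> 0 \<Longrightarrow> borel_elt a b * borel_elt a' b' = borel_elt (a * a') (a * b' + b)"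
  for a :: "'k::field"
  by (simp add: borel_elt_def pgl2_class_mult m2_mult)

lemma borel_1: "borel_elt 1 0 = 1"
  by (simp add: borel_elt_def m2_one[symmetric] pgl2_class_one)

lemma inverse_borel_diag: "a \<noteq> 0 \<Longrightarrow> inverse (borel_elt a 0) = borel_elt (inverse a) 0" for a :: "'k::field"
  by (rule pgl2_inverse_unique) (simp add: borel_mult borel_1)

lemma weyl_weyl: "weyl * weyl = 1"
  by (simp add: weyl_def pgl2_class_mult m2_mult m2_one[symmetric] pgl2_class_one)

lemma inverse_weyl: "inverse weyl = weyl"
  by (rule pgl2_inverse_unique) (rule weyl_weyl)

text \<open>The Weyl element inverts the coordinate; the diagonal entry -(z z) is the source of the
  automorphy factor and of the sign \<open>ch (-1)\<close>.\<close>

lemma weyl_nbar: "z \<noteq> 0 \<Longrightarrow> weyl * nbar z = nbar (inverse z) * borel_elt (- (z * z)) (- z)" for z :: "'k::field"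
proof -
  assume z: "z \<noteq> 0"
  have "nbar (inverse z) * borel_elt (- (z * z)) (- z) = pgl2_class (m2 (- z * z) (- z * 1) (- z * 1) (- z * 0))"
    using z by (simp add: nbar_def borel_elt_def pgl2_class_mult m2_mult field_simps)
  also have "\<dots> = pgl2_class (m2 z 1 1 0)"
    using z by (intro pgl2_class_scale) auto
  also have "\<dots> = weyl * nbar z"
    by (simp add: weyl_def nbar_def pgl2_class_mult m2_mult)
  finally show ?thesis ..
qed

lemma diag_nbar: "a \<noteq> 0 \<Longrightarrow> borel_elt a 0 * nbar z = nbar (z / a) * borel_elt a 0" for z :: "'k::field"
  by (simp add: nbar_def borel_elt_def pgl2_class_mult m2_mult)

text \<open>A matrix with non-zero upper left entry factors into lower unipotent, upper unipotent
  and diagonal parts, and the upper unipotent part is a Weyl conjugate of a lower one. In the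
  remaining case an exchange of rows leads back to this one.\<close>

lemma pgl2_generators:
  fixes P :: "'k::field pgl2 \<Rightarrow> bool"
  assumes mult: "\<And>g h. P g \<Longrightarrow> P h \<Longrightarrow> P (g * h)" and n: "\<And>x. P (nbar x)"
    and d: "\<And>a. a \<noteq> 0 \<Longrightarrow> P (borel_elt a 0)" and w: "P weyl"
  shows "P g"
proof -
  have *: "P (pgl2_class (m2 a b c e))" if a: "a \<noteq> 0" and i: "invertible (m2 a b c e)" for a b c e
  proof -
    \<comment> \<open>The second pivot of Gaussian elimination. Scalars are invisible in PGL(2), so
      all entries may be divided by it, which makes the lower right entry of the diagonal factor
      1.\<close>
    define \<delta> where "\<delta> = (a * e - b * c) / a"
    have \<delta>: "\<delta> \<noteq> 0" using a i by (simp add: \<delta>_def)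
    have e: "e = \<delta> + b * c / a" using a by (simp add: \<delta>_def field_simps)
    have u: "weyl * nbar (b / \<delta>) * weyl = pgl2_class (m2 1 (b / \<delta>) 0 1)"
      by (simp add: weyl_def nbar_def pgl2_class_mult m2_mult)
    have "nbar (c / a) * (weyl * nbar (b / \<delta>) * weyl) * borel_elt (a / \<delta>) 0
       = pgl2_class (m2 (a / \<delta>) (b / \<delta>) (c / \<delta>) (e / \<delta>))"
      unfolding u using a \<delta> by (simp add: nbar_def borel_elt_def pgl2_class_mult m2_mult e field_simps)
    also have "\<dots> = pgl2_class (m2 (inverse \<delta> * a) (inverse \<delta> * b) (inverse \<delta> * c) (inverse \<delta> * e))"
      by (simp add: field_simps)
    also have "\<dots> = pgl2_class (m2 a b c e)" using \<delta> i by (intro pgl2_class_scale) auto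
    finally show ?thesis using a \<delta> by (metis mult n d w divide_eq_0_iff)
  qed
  obtain A where A: "invertible A" "g = pgl2_class A" using pgl2_class_surj by blast
  obtain a b c e where m: "A = m2 a b c e" using m2_eta by blast
  show ?thesis
  proof (cases "a = 0")
    case False then show ?thesis using * A m by blast
  next
    case True
    then have c: "c \<noteq> 0" "b \<noteq> 0" using A m by auto
    have "g = weyl * pgl2_class (m2 c e a b)"
      unfolding A(2) m weyl_def using True c by (simp add: pgl2_class_mult m2_mult)
    moreover have "P (pgl2_class (m2 c e a b))" using True c by (intro *) auto
    ultimately show ?thesis using mult w by simp
  qed
qed

section \<open>Locally constant functions\<close>

lemma absval_uminus: "absval (- x) = absval x" for x :: "'k::nonarch_local_field"
  by (simp add: absval_def)

lemma eventually_nhds_compose: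
  assumes "(h \<longlongrightarrow> h A) (nhds A)" "eventually P (nhds (h A))"
  shows "eventually (\<lambda>B. P (h B)) (nhds A)"
  using assms unfolding filterlim_iff by blast

lemma tendsto_entry: "((\<lambda>B. B $ i $ j) \<longlongrightarrow> A $ i $ j) (nhds A)"
  for A :: "'k::topological_space ^ 'n ^ 'm"
  by (intro tendsto_vec_nth filterlim_ident)

lemma tendsto_det2: "((\<lambda>B. det B) \<longlongrightarrow> det A) (nhds A)" for A :: "'k::nonarch_local_field^2^2"
  unfolding det_2 by (intro tendsto_intros tendsto_entry)

lemma eventually_val_eq:
  fixes x :: "'k::nonarch_local_field"
  assumes "x \<noteq> 0" shows "eventually (\<lambda>y. y \<noteq> 0 \<and> val y = val x) (nhds x)"
  unfolding eventually_nhds_vball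
proof (intro exI[of _ "val x + 1"] ballI)
  fix y assume "y \<in> vball x (val x + 1)"
  then show "y \<noteq> 0 \<and> val y = val x" using val_add_eq[OF assms, of "y - x"] by (simp add: vball_iff)
qed

lemma eventually_invertible: "invertible A \<Longrightarrow> eventually invertible (nhds A)"
  for A :: "'k::nonarch_local_field^2^2"
  unfolding invertible_det_nz
  by (rule eventually_nhds_compose[OF tendsto_det2], rule eventually_mono[OF eventually_val_eq]) auto

text \<open>Openness in the quotient topology is tested on representing matrices, and the invertible
  matrices form an open set; so local constancy can be checked on neighbourhoods of
  matrices.\<close>

lemma locally_constant_pgl2_iff:
  fixes f :: "'k::nonarch_local_field pgl2 \<Rightarrow> complex"
  shows "locally_constant f \<longleftrightarrow>
    (\<forall>A. invertible A \<longrightarrow> eventually (\<lambda>B. f (pgl2_class B) = f (pgl2_class A)) (nhds A))"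
proof (intro iffI allI impI)
  fix A :: "'k^2^2"
  assume f: "locally_constant f" and A: "invertible A"
  obtain U where U: "open U" "pgl2_class A \<in> U" "f constant_on U"
    using f unfolding locally_constant_def by blast
  obtain T where T: "open T" "{A. invertible A \<and> pgl2_class A \<in> U} = {A. invertible A} \<inter> T"
    using U(1) unfolding open_pgl2_def openin_open by blast
  have "A \<in> T" using T(2) A U(2) by blast
  then have "eventually (\<lambda>B. B \<in> T) (nhds A)" using T(1) by (rule eventually_nhds_in_open[rotated])
  then show "eventually (\<lambda>B. f (pgl2_class B) = f (pgl2_class A)) (nhds A)"
    using eventually_invertible[OF A]
  proof eventually_elim
    case (elim B)
    then have "pgl2_class B \<in> U" using T(2) by blast
    then show ?case using U(2,3) unfolding constant_on_def by metis
  qed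
next
  assume *: "\<forall>A. invertible A \<longrightarrow> eventually (\<lambda>B. f (pgl2_class B) = f (pgl2_class A)) (nhds A)"
  show "locally_constant f" unfolding locally_constant_def
  proof
    fix g
    define U where "U = {h. f h = f g}"
    have "open U" unfolding open_pgl2_def
    proof (subst openin_subopen, intro ballI)
      fix A assume "A \<in> {A. invertible A \<and> pgl2_class A \<in> U}"
      then have A: "invertible A" "f (pgl2_class A) = f g" by (auto simp: U_def)
      obtain T where T: "open T" "A \<in> T" "\<And>B. B \<in> T \<Longrightarrow> f (pgl2_class B) = f (pgl2_class A)"
        using *[rule_format, OF A(1)] unfolding eventually_nhds by blast
      then show "\<exists>T. openin (top_of_set {A. invertible A}) T \<and> A \<in> T \<and> T \<subseteq> {A. invertible A \<and> pgl2_class A \<in> U}"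
        using A by (intro exI[of _ "{A. invertible A} \<inter> T"]) (auto simp: U_def openin_open_Int)
    qed
    then show "\<exists>U. open U \<and> g \<in> U \<and> f constant_on U"
      by (intro exI[of _ U]) (auto simp: U_def constant_on_def)
  qed
qed

lemma locally_constant_left_translation:
  fixes f :: "'k::nonarch_local_field pgl2 \<Rightarrow> complex"
  assumes f: "locally_constant f" shows "locally_constant (left_translation g f)"
  unfolding locally_constant_pgl2_iff
proof (intro allI impI)
  fix A :: "'k^2^2" assume A: "invertible A"
  obtain G where G: "invertible G" "inverse g = pgl2_class G" using pgl2_class_surj by blast
  have eq: "left_translation g f (pgl2_class B) = f (pgl2_class (G ** B))" if "invertible B" for B
    using G that by (simp add: left_translation_def pgl2_class_mult)
  have "((\<lambda>B. G ** B) \<longlongrightarrow> G ** A) (nhds A)"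
    by (intro vec_tendstoI) (simp add: mat2_mult_nth, intro tendsto_intros tendsto_entry)
  moreover have "eventually (\<lambda>B. f (pgl2_class B) = f (pgl2_class (G ** A))) (nhds (G ** A))"
    using f A G unfolding locally_constant_pgl2_iff by (simp add: invertible_mult)
  ultimately have "eventually (\<lambda>B. f (pgl2_class (G ** B)) = f (pgl2_class (G ** A))) (nhds A)"
    by (rule eventually_nhds_compose)
  then show "eventually (\<lambda>B. left_translation g f (pgl2_class B) = left_translation g f (pgl2_class A)) (nhds A)"
    using eventually_invertible[OF A] by eventually_elim (simp add: eq A)
qed

lemma locally_constant_add: "locally_constant f \<Longrightarrow> locally_constant g \<Longrightarrow> locally_constant (\<lambda>x. f x + g x)"
  for f :: "'k::nonarch_local_field pgl2 \<Rightarrow> complex"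
  unfolding locally_constant_pgl2_iff
proof (intro allI impI)
  fix A :: "'k^2^2" assume *: "\<forall>A. invertible A \<longrightarrow> (\<forall>\<^sub>F B in nhds A. f (pgl2_class B) = f (pgl2_class A))"
    "\<forall>A. invertible A \<longrightarrow> (\<forall>\<^sub>F B in nhds A. g (pgl2_class B) = g (pgl2_class A))" "invertible A"
  then have "\<forall>\<^sub>F B in nhds A. f (pgl2_class B) = f (pgl2_class A)" "\<forall>\<^sub>F B in nhds A. g (pgl2_class B) = g (pgl2_class A)"
    by blast+
  then show "\<forall>\<^sub>F B in nhds A. f (pgl2_class B) + g (pgl2_class B) = f (pgl2_class A) + g (pgl2_class A)"
    by eventually_elim simp
qed

lemma locally_constant_cmult: "locally_constant f \<Longrightarrow> locally_constant (\<lambda>x. c * f x)"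
  for f :: "'k::nonarch_local_field pgl2 \<Rightarrow> complex"
  unfolding locally_constant_pgl2_iff by (auto elim: eventually_mono)

section \<open>Quadratic characters and induced functions supported on a ball\<close>

locale quad_character =
  fixes \<pi> :: "'k::nonarch_local_field" and chi :: "'k \<Rightarrow> complex"
  assumes unif: "uniformizer \<pi>" and uchar: "unit_character chi"
    and sq: "\<And>u. u \<in> integer_units \<Longrightarrow> (chi u)\<^sup>2 = 1"
begin

text \<open>The extension of \<open>chi\<close> to the multiplicative group with value 1 at the
  uniformizer; it is again quadratic.\<close>

definition ch :: "'k \<Rightarrow> complex" where "ch x = chi (\<pi> powi (- val x) * x)"

lemma pi: "\<pi> \<noteq> 0" "val \<pi> = 1" using unif by (auto simp: uniformizer_def)

lemma unit_part: "x \<noteq> 0 \<Longrightarrow> \<pi> powi (- val x) * x \<in> integer_units"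
  using pi by (simp add: integer_units_def val_mult val_powi)

lemma ch_mult: "x \<noteq> 0 \<Longrightarrow> y \<noteq> 0 \<Longrightarrow> ch (x * y) = ch x * ch y"
proof -
  assume xy: "x \<noteq> 0" "y \<noteq> 0"
  have "\<pi> powi (- val (x * y)) * (x * y) = (\<pi> powi (- val x) * x) * (\<pi> powi (- val y) * y)"
    using xy pi by (simp add: val_mult power_int_diff power_int_minus field_simps)
  then show ?thesis
    using uchar unit_part xy unfolding ch_def unit_character_def by metis
qed

lemma ch_sq: "x \<noteq> 0 \<Longrightarrow> ch x * ch x = 1"
  using sq[OF unit_part, of x] by (simp add: ch_def power2_eq_square)

lemma ch_neq_0 [simp]: "x \<noteq> 0 \<Longrightarrow> ch x \<noteq> 0"
  using ch_sq by force

lemma ch_1 [simp]: "ch 1 = 1"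
  using ch_mult[of 1 1] ch_sq[of 1] by simp

lemma ch_inverse: "x \<noteq> 0 \<Longrightarrow> ch (inverse x) = ch x"
  using ch_mult[of x "inverse x"] ch_sq[of x] by (metis ch_1 ch_neq_0 mult_left_cancel nonzero_imp_inverse_nonzero right_inverse)

text \<open>The only possible values are 1 and -1, and continuity at 1 excludes -1 nearby.\<close>

lemma ch_near_1: "\<exists>n. \<forall>u\<in>vball 1 n. ch u = 1"
proof -
  have 1: "1 \<in> integer_units" by (simp add: integer_units_def)
  have c1: "chi 1 = 1" using ch_1 by (simp add: ch_def)
  have "(chi \<longlongrightarrow> chi 1) (at 1 within integer_units)"
    using uchar 1 unfolding unit_character_def continuous_on_def by blast
  then have "eventually (\<lambda>u. dist (chi u) (chi 1) < 1) (at 1 within integer_units)"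
    by (rule tendstoD) simp
  then have "eventually (\<lambda>u. u \<noteq> 1 \<longrightarrow> u \<in> integer_units \<longrightarrow> dist (chi u) 1 < 1) (nhds 1)"
    by (simp add: eventually_at_filter c1)
  moreover have "eventually (\<lambda>u::'k. u \<noteq> 0 \<and> val u = val (1::'k)) (nhds 1)" by (rule eventually_val_eq) simp
  ultimately have "eventually (\<lambda>u. ch u = 1) (nhds 1)"
  proof eventually_elim
    case (elim u)
    then have u: "u \<in> integer_units" "ch u = chi u" by (auto simp: integer_units_def ch_def)
    have "chi u = 1 \<or> chi u = -1" using sq[OF u(1)] by (simp add: power2_eq_1_iff)
    then show ?case using elim u c1 by (cases "u = 1") (auto simp: dist_norm)
  qed
  then show ?thesis by (simp add: eventually_nhds_vball)
qed

lemma eventually_ch: assumes "x \<noteq> 0" shows "eventually (\<lambda>y. ch y = ch x) (nhds x)"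
proof -
  obtain n where n: "\<And>u. u \<in> vball 1 n \<Longrightarrow> ch u = 1" using ch_near_1 by blast
  have "eventually (\<lambda>y. y \<in> vball x (n + val x)) (nhds x)" using eventually_nhds_vball by blast
  then show ?thesis using eventually_val_eq[OF assms]
  proof eventually_elim
    case (elim y)
    have "x * (y / x - 1) = y - x" using assms by (simp add: field_simps)
    then have "vge n (y / x - 1)" using elim(1) vge_times_iff[OF assms, of "n + val x" "y / x - 1"]
      by (simp add: vball_iff)
    then have "ch (y / x) = 1" by (intro n) (simp add: vball_iff)
    then show ?case using ch_mult[of "y / x" x] assms elim by simp
  qed
qed

definition tw :: "real \<Rightarrow> 'k \<Rightarrow> complex" where "tw \<sigma> x = ch x * of_real (absval x powr \<sigma>)"

lemma char_twist_eq: "char_twist \<pi> chi (of_real \<sigma>) x = tw \<sigma> x"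
  by (simp add: char_twist_def tw_def ch_def powr_of_real absval_nonneg)

lemma tw_mult: "x \<noteq> 0 \<Longrightarrow> y \<noteq> 0 \<Longrightarrow> tw \<sigma> (x * y) = tw \<sigma> x * tw \<sigma> y"
  by (simp add: tw_def ch_mult absval_mult powr_mult absval_nonneg)

lemma tw_1 [simp]: "tw \<sigma> 1 = 1"
  using resq_gt_0[where 'k='k] by (simp add: tw_def absval_eq)

lemma tw_neq_0 [simp]: "x \<noteq> 0 \<Longrightarrow> tw \<sigma> x \<noteq> 0"
  using absval_pos[of x] by (simp add: tw_def)

lemma tw_inverse: "x \<noteq> 0 \<Longrightarrow> tw \<sigma> (inverse x) = inverse (tw \<sigma> x)"
  using tw_mult[of x "inverse x" \<sigma>] by (simp add: inverse_eq_divide eq_divide_eq mult.commute)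

lemma eventually_tw: assumes "x \<noteq> 0" shows "eventually (\<lambda>y. tw \<sigma> y = tw \<sigma> x) (nhds x)"
  using eventually_ch[OF assms] eventually_val_eq[OF assms]
  by eventually_elim (simp add: tw_def absval_eq assms)

text \<open>The element of the induced space whose restriction along \<open>nbar\<close> is the
  indicator of the ball. A matrix with entries a, c in the first column and a non-zero is
  \<open>nbar (c / a)\<close> times an upper triangular matrix with diagonal ratio a^2 / det, hence
  the factor; neither c / a nor det / a^2 changes when the representative is rescaled.\<close>

definition ballfun :: "real \<Rightarrow> 'k \<Rightarrow> int \<Rightarrow> 'k pgl2 \<Rightarrow> complex" where
  "ballfun \<sigma> x n g = (let A = rep_pgl2 g in
     if A$1$1 \<noteq> 0 \<and> A$2$1 / A$1$1 \<in> vball x n then tw \<sigma> (det A / (A$1$1 * A$1$1)) else 0)"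

lemma ballfun_class:
  assumes A: "invertible A"
  shows "ballfun \<sigma> x n (pgl2_class A) =
    (if A$1$1 \<noteq> 0 \<and> A$2$1 / A$1$1 \<in> vball x n then tw \<sigma> (det A / (A$1$1 * A$1$1)) else 0)"
proof -
  obtain c where c: "c \<noteq> 0" "rep_pgl2 (pgl2_class A) = mat c ** A" using rep_pgl2_class[OF A] by blast
  have "det (mat c ** A) = c * c * det A" by (simp add: det_2 mat_times_nth algebra_simps)
  then show ?thesis using c(1) unfolding ballfun_def c(2) by (simp add: mat_times_nth Let_def)
qed

lemma ballfun_nbar [simp]: "ballfun \<sigma> x n (nbar y) = indicator (vball x n) y"
  by (simp add: nbar_def ballfun_class det_2)

text \<open>For non-zero upper left entry the ball condition and the factor are locally constant in
  the entries. Near a matrix with upper left entry 0 the quotient c / a is too large to lie in the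
  ball, so the function vanishes there.\<close>

lemma ballfun_locally_constant: "locally_constant (ballfun \<sigma> x n)"
  unfolding locally_constant_pgl2_iff
proof (intro allI impI)
  fix A :: "'k^2^2" assume A: "invertible A"
  define a where "a = A$1$1" define c where "c = A$2$1"
  show "eventually (\<lambda>B. ballfun \<sigma> x n (pgl2_class B) = ballfun \<sigma> x n (pgl2_class A)) (nhds A)"
  proof (cases "a = 0")
    case False
    have cond: "c' / a' \<in> vball x n \<longleftrightarrow> vge (n + val a') (c' - x * a')" if "a' \<noteq> 0" for a' c'
    proof -
      have "c' - x * a' = a' * (c' / a' - x)" using that by (simp add: field_simps)
      then show ?thesis using that by (simp add: vball_iff vge_times_iff)
    qed
    have t: "((\<lambda>B. B$2$1 - x * B$1$1) \<longlongrightarrow> A$2$1 - x * A$1$1) (nhds A)"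
      by (intro tendsto_intros tendsto_entry)
    let ?z = "A$2$1 - x * A$1$1"
    have "eventually (\<lambda>z. z \<in> vball ?z (n + val a)) (nhds ?z)" using eventually_nhds_vball by blast
    from eventually_nhds_compose[of "\<lambda>B. B$2$1 - x * B$1$1", OF t this]
    have e1: "eventually (\<lambda>B. B$2$1 - x * B$1$1 \<in> vball ?z (n + val a)) (nhds A)" .
    have e2: "eventually (\<lambda>B. B$1$1 \<noteq> 0 \<and> val (B$1$1) = val a) (nhds A)"
      using eventually_nhds_compose[of "\<lambda>B. B$1$1", OF tendsto_entry eventually_val_eq] False by (simp add: a_def)
    have e3: "eventually (\<lambda>B. tw \<sigma> (B$1$1) = tw \<sigma> a) (nhds A)"
      using eventually_nhds_compose[of "\<lambda>B. B$1$1", OF tendsto_entry eventually_tw] False by (simp add: a_def)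
    have dA: "det A \<noteq> 0" using A by (simp add: invertible_det_nz)
    have e4: "eventually (\<lambda>B. tw \<sigma> (det B) = tw \<sigma> (det A)) (nhds A)"
      using eventually_nhds_compose[OF tendsto_det2 eventually_tw[OF dA]] .
    show ?thesis using e1 e2 e3 e4 eventually_invertible[OF A]
    proof eventually_elim
      case (elim B)
      let ?y = "B$2$1 - x * B$1$1"
      have "vge (n + val a) ?y \<longleftrightarrow> vge (n + val a) ?z"
        using elim(1) vge_add[of "n + val a" "?y - ?z" ?z] vge_diff[of "n + val a" ?y "?y - ?z"]
        by (auto simp: vball_iff)
      then have "B$2$1 / B$1$1 \<in> vball x n \<longleftrightarrow> A$2$1 / A$1$1 \<in> vball x n"
        using elim(2) False by (simp add: cond a_def)
      moreover have "tw \<sigma> (det B / (B$1$1 * B$1$1)) = tw \<sigma> (det A / (A$1$1 * A$1$1))"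
        using elim False dA
        by (simp add: divide_inverse tw_mult tw_inverse a_def invertible_det_nz)
      ultimately show ?case using elim A False by (simp add: ballfun_class a_def)
    qed
  next
    case True
    then have c: "c \<noteq> 0" using A by (auto simp: invertible_mat2_iff a_def c_def)
    \<comment> \<open>If the upper left entry is non-zero of valuation at least m, then c / a has
      valuation below \<open>min n (val x)\<close>, whereas non-zero points of the ball have at
      least this valuation.\<close>
    define m where "m = val c - min n (val x) + 1"
    have "eventually (\<lambda>z. z \<in> vball a m) (nhds a)" using eventually_nhds_vball by blast
    then have e1: "eventually (\<lambda>B. B$1$1 \<in> vball a m) (nhds A)"
      unfolding a_def by (rule eventually_nhds_compose[of "\<lambda>B. B$1$1", OF tendsto_entry])
    have e2: "eventually (\<lambda>B. B$2$1 \<noteq> 0 \<and> val (B$2$1) = val c) (nhds A)"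
      using eventually_nhds_compose[of "\<lambda>B. B$2$1", OF tendsto_entry eventually_val_eq] c by (simp add: c_def)
    show ?thesis using e1 e2 eventually_invertible[OF A]
    proof eventually_elim
      case (elim B)
      have "ballfun \<sigma> x n (pgl2_class B) = 0"
      proof (rule ccontr)
        assume "ballfun \<sigma> x n (pgl2_class B) \<noteq> 0"
        then have B: "B$1$1 \<noteq> 0" "B$2$1 / B$1$1 \<in> vball x n"
          using elim by (auto simp: ballfun_class split: if_splits)
        have "vge (min n (val x)) (B$2$1 / B$1$1 - x)" using B(2) by (auto simp: vball_iff elim: vge_mono)
        moreover have "vge (min n (val x)) x" by (simp add: vge_def)
        ultimately have "vge (min n (val x)) (B$2$1 / B$1$1)"
          using vge_add[of "min n (val x)" "B$2$1 / B$1$1 - x" x] by simp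
        then have "min n (val x) \<le> val c - val (B$1$1)" using elim B by (auto simp: vge_def val_divide)
        moreover have "m \<le> val (B$1$1)" using elim(1) B True by (simp add: vball_iff vge_def)
        ultimately show False by (simp add: m_def)
      qed
      then show ?case using A True by (simp add: ballfun_class a_def)
    qed
  qed
qed

definition "indsp s = induced_space \<pi> chi (complex_of_real s)"

lemma indsp_iff: "f \<in> indsp s \<longleftrightarrow> locally_constant f \<and>
    (\<forall>g a b. a \<noteq> 0 \<longrightarrow> f (g * borel_elt a b) = inverse (tw (s + 1/2) a) * f g)"
proof -
  have "complex_of_real s + 1/2 = complex_of_real (s + 1/2)" by simp
  then show ?thesis unfolding indsp_def induced_space_def mem_Collect_eq by (simp only: char_twist_eq)
qed

lemma ballfun_indsp: "ballfun (s + 1/2) x n \<in> indsp s"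
  unfolding indsp_iff
proof (intro conjI allI impI ballfun_locally_constant)
  fix g :: "'k pgl2" and a b :: 'k assume a: "a \<noteq> 0"
  obtain A where A: "invertible A" "g = pgl2_class A" using pgl2_class_surj by blast
  have B: "invertible (m2 a b 0 1)" using a by simp
  have g: "g * borel_elt a b = pgl2_class (A ** m2 a b 0 1)"
    using A B by (simp add: borel_elt_def pgl2_class_mult)
  have d: "det (A ** m2 a b 0 1) = det A * a" by (simp add: det_2 mat2_mult_nth algebra_simps)
  have i: "invertible (A ** m2 a b 0 1)" using A B by (rule_tac invertible_mult)
  have dA: "det A \<noteq> 0" using A by (simp add: invertible_det_nz)
  show "ballfun (s + 1/2) x n (g * borel_elt a b) = inverse (tw (s + 1/2) a) * ballfun (s + 1/2) x n g"
  proof (cases "A$1$1 \<noteq> 0 \<and> A$2$1 / A$1$1 \<in> vball x n")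
    case True
    have "det A * a / (A$1$1 * a * (A$1$1 * a)) = inverse a * (det A / (A$1$1 * A$1$1))"
      using a by (simp add: field_simps)
    then have "tw (s + 1/2) (det A * a / (A$1$1 * a * (A$1$1 * a))) =
        inverse (tw (s + 1/2) a) * tw (s + 1/2) (det A / (A$1$1 * A$1$1))"
      using a dA True tw_mult[of "inverse a" "det A / (A$1$1 * A$1$1)" "s + 1/2"] by (simp add: tw_inverse)
    then show ?thesis
      unfolding g ballfun_class[OF i] d unfolding A(2) ballfun_class[OF A(1)]
      using a True by (simp add: mat2_mult_nth)
  next
    case False
    then show ?thesis
      unfolding g ballfun_class[OF i] d unfolding A(2) ballfun_class[OF A(1)]
      using a by (auto simp: mat2_mult_nth)
  qed
qed

lemma indsp_add: "f \<in> indsp s \<Longrightarrow> g \<in> indsp s \<Longrightarrow> (\<lambda>x. f x + g x) \<in> indsp s"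
  unfolding indsp_iff by (simp add: locally_constant_add distrib_left)

lemma indsp_cmult: "f \<in> indsp s \<Longrightarrow> (\<lambda>x. c * f x) \<in> indsp s"
  unfolding indsp_iff by (simp add: locally_constant_cmult)

lemma indsp_sum: "(\<And>i. i \<in> I \<Longrightarrow> f i \<in> indsp s) \<Longrightarrow> (\<lambda>x. \<Sum>i\<in>I. f i x) \<in> indsp s"
proof (induction I rule: infinite_finite_induct)
  case (insert i I)
  then show ?case using indsp_add[of "f i" s "\<lambda>x. \<Sum>i\<in>I. f i x"] by simp
qed (use indsp_cmult[OF ballfun_indsp, of 0] in simp_all)

lemma indsp_left_translation: "f \<in> indsp s \<Longrightarrow> left_translation g f \<in> indsp s"
  unfolding indsp_iff using locally_constant_left_translation[of f g]
  by (simp add: left_translation_def flip: mult.assoc)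

section \<open>Translates of ball functions by the generators\<close>

lemma lt_nbar_ballfun: "left_translation (nbar y) (ballfun \<sigma> x n) = ballfun \<sigma> (x + y) n"
proof
  fix g :: "'k pgl2"
  obtain A where A: "invertible A" "g = pgl2_class A" using pgl2_class_surj by blast
  have i: "invertible (m2 1 0 (- y) 1)" by simp
  have ii: "invertible (m2 1 0 (- y) 1 ** A)" using i A by (rule_tac invertible_mult)
  have lt: "inverse (nbar y) * g = pgl2_class (m2 1 0 (- y) 1 ** A)"
    unfolding inverse_nbar unfolding nbar_def A(2) pgl2_class_mult[OF i A(1)] ..
  have d: "det (m2 1 0 (- y) 1 ** A) = det A" by (simp add: det_2 mat2_mult_nth algebra_simps)
  show "left_translation (nbar y) (ballfun \<sigma> x n) g = ballfun \<sigma> (x + y) n g"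
  proof (cases "A$1$1 = 0")
    case True
    then show ?thesis
      unfolding left_translation_def lt ballfun_class[OF ii] d unfolding A(2) ballfun_class[OF A(1)]
      by (simp add: mat2_mult_nth)
  next
    case False
    then have "(- (y * A$1$1) + A$2$1) / A$1$1 - x = A$2$1 / A$1$1 - (x + y)" by (simp add: field_simps)
    then show ?thesis
      unfolding left_translation_def lt ballfun_class[OF ii] d unfolding A(2) ballfun_class[OF A(1)]
      by (simp add: mat2_mult_nth vball_iff diff_diff_eq add.commute[of y])
  qed
qed

lemma lt_diag_ballfun:
  assumes a: "a \<noteq> 0"
  shows "left_translation (borel_elt a 0) (ballfun \<sigma> x n) = (\<lambda>g. tw \<sigma> a * ballfun \<sigma> (x / a) (n - val a) g)"
proof
  fix g :: "'k pgl2"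
  obtain A where A: "invertible A" "g = pgl2_class A" using pgl2_class_surj by blast
  have i: "invertible (m2 (inverse a) 0 0 1)" using a by simp
  have ii: "invertible (m2 (inverse a) 0 0 1 ** A)" using i A by (rule_tac invertible_mult)
  have lt: "inverse (borel_elt a 0) * g = pgl2_class (m2 (inverse a) 0 0 1 ** A)"
    unfolding inverse_borel_diag[OF a] unfolding borel_elt_def A(2) pgl2_class_mult[OF i A(1)] ..
  have d: "det (m2 (inverse a) 0 0 1 ** A) = inverse a * det A"
    by (simp add: det_2 mat2_mult_nth algebra_simps)
  have dA: "det A \<noteq> 0" using A by (simp add: invertible_det_nz)
  have e: "A$2$1 / (inverse a * A$1$1) \<in> vball x n \<longleftrightarrow> A$2$1 / A$1$1 \<in> vball (x / a) (n - val a)"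
  proof -
    have "A$2$1 / (inverse a * A$1$1) - x = a * (A$2$1 / A$1$1 - x / a)"
      using a by (simp add: divide_inverse right_diff_distrib)
    then show ?thesis unfolding vball_iff by (simp only: vge_times_iff[OF a])
  qed
  show "left_translation (borel_elt a 0) (ballfun \<sigma> x n) g = tw \<sigma> a * ballfun \<sigma> (x / a) (n - val a) g"
  proof (cases "A$1$1 \<noteq> 0 \<and> A$2$1 / A$1$1 \<in> vball (x / a) (n - val a)")
    case True
    have "inverse a * det A / (inverse a * A$1$1 * (inverse a * A$1$1)) = a * (det A / (A$1$1 * A$1$1))"
      using a by (simp add: field_simps)
    then have "tw \<sigma> (inverse a * det A / (inverse a * A$1$1 * (inverse a * A$1$1))) =
        tw \<sigma> a * tw \<sigma> (det A / (A$1$1 * A$1$1))"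
      using a dA True tw_mult[of a "det A / (A$1$1 * A$1$1)" \<sigma>] by simp
    then show ?thesis
      unfolding left_translation_def lt ballfun_class[OF ii] d unfolding A(2) ballfun_class[OF A(1)]
      using a True e by (simp add: mat2_mult_nth)
  next
    case False
    then show ?thesis
      unfolding left_translation_def lt ballfun_class[OF ii] d unfolding A(2) ballfun_class[OF A(1)]
      using a e by (auto simp: mat2_mult_nth)
  qed
qed

text \<open>A quadratic character is blind to squares, so only a sign and the absolute value
  remain.\<close>

lemma tw_uminus_sq: "x \<noteq> 0 \<Longrightarrow> tw \<sigma> (- (x * x)) = ch (-1) * of_real (absval x powr (2 * \<sigma>))"
proof -
  assume x: "x \<noteq> 0"
  have "ch (- (x * x)) = ch (-1)" using ch_mult[of "-1" "x * x"] ch_mult[of x x] ch_sq[of x] x by simp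
  moreover have "absval (- (x * x)) = absval x * absval x"
    using absval_mult[of x x] by (simp add: absval_uminus)
  ultimately show ?thesis using absval_pos[OF x] by (simp add: tw_def powr_mult powr_add[symmetric])
qed

text \<open>The valuation is constant on a ball that avoids 0, and 1/y - x = -(x / y) (y - 1/x).
  Both val (1/y) = val x and val y = - val x then turn the two conditions into each other, with the
  exponent shifted by 2 val x.\<close>

lemma vball_inverse:
  assumes x: "0 \<notin> vball x n"
  shows "(y \<noteq> 0 \<and> inverse y \<in> vball x n) \<longleftrightarrow> y \<in> vball (inverse x) (n - 2 * val x)"
proof -
  have x0: "x \<noteq> 0" using x by auto
  have vx: "val x < n" using x by (auto simp: vball_iff vge_def)
  have *: "vge m (inverse y - x) \<longleftrightarrow> vge (m + val y - val x) (y - inverse x)" if y: "y \<noteq> 0" for y m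
  proof -
    have eq: "inverse y - x = - (x * inverse y * (y - inverse x))" using x0 y by (simp add: field_simps)
    have ne: "x * inverse y \<noteq> 0" using x0 y by simp
    have v: "m - val (x * inverse y) = m + val y - val x" using x0 y by (simp add: val_mult val_inverse)
    show ?thesis unfolding eq vge_minus vge_times_iff[OF ne] v ..
  qed
  show ?thesis
  proof
    assume y: "y \<noteq> 0 \<and> inverse y \<in> vball x n"
    then have "vge (val x + 1) (inverse y - x)"
      using vx by (auto simp: vball_iff intro: vge_mono[of n])
    then have "val (inverse y) = val x" using val_add_eq[OF x0, of "inverse y - x"] by simp
    then have "val y = - val x" using y by (simp add: val_inverse)
    then have e: "n + val y - val x = n - 2 * val x" by simp
    show "y \<in> vball (inverse x) (n - 2 * val x)" using *[of y n, unfolded e] y by (simp add: vball_iff)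
  next
    assume y: "y \<in> vball (inverse x) (n - 2 * val x)"
    have "vge (val (inverse x) + 1) (y - inverse x)"
      using y vx x0 by (auto simp: vball_iff val_inverse intro: vge_mono[of "n - 2 * val x"])
    then have "y \<noteq> 0 \<and> val y = - val x" using val_add_eq[of "inverse x" "y - inverse x"] x0
      by (simp add: val_inverse)
    moreover from this have e: "n + val y - val x = n - 2 * val x" by simp
    ultimately show "y \<noteq> 0 \<and> inverse y \<in> vball x n" using *[of y n, unfolded e] y by (simp add: vball_iff)
  qed
qed

lemma val_vball: "0 \<notin> vball x n \<Longrightarrow> y \<in> vball x n \<Longrightarrow> y \<noteq> 0 \<and> val y = val x"
  using val_const_off_ball[of x 0 n y n] vball_sym[of 0 x n] by simp

text \<open>The automorphy factor involves a square up to sign, hence only the absolute value, which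
  is constant on a ball avoiding 0. The image is thus a scalar multiple of a single ball
  function.\<close>

lemma lt_weyl_ballfun:
  assumes x: "0 \<notin> vball x n"
  shows "left_translation weyl (ballfun \<sigma> x n) =
    (\<lambda>g. ch (-1) * of_real (absval x powr (2 * \<sigma>)) * ballfun \<sigma> (inverse x) (n - 2 * val x) g)"
proof
  fix g :: "'k pgl2"
  have x0: "x \<noteq> 0" using x by auto
  obtain A where A: "invertible A" "g = pgl2_class A" using pgl2_class_surj by blast
  have i: "invertible (m2 0 1 1 (0::'k))" by simp
  have ii: "invertible (m2 0 1 1 0 ** A)" using i A by (rule_tac invertible_mult)
  have dA: "det A \<noteq> 0" using A by (simp add: invertible_det_nz)
  let ?a = "A$1$1" and ?c = "A$2$1"
  have lt: "inverse weyl * g = pgl2_class (m2 0 1 1 0 ** A)"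
    unfolding inverse_weyl unfolding weyl_def A(2) pgl2_class_mult[OF i A(1)] ..
  have d: "det (m2 0 1 1 0 ** A) = - det A" by (simp add: det_2 mat2_mult_nth algebra_simps)
  have lhs: "left_translation weyl (ballfun \<sigma> x n) g =
    (if ?c \<noteq> 0 \<and> ?a / ?c \<in> vball x n then tw \<sigma> (- det A / (?c * ?c)) else 0)"
    unfolding left_translation_def lt ballfun_class[OF ii] d by (simp add: mat2_mult_nth)
  have rhs: "ballfun \<sigma> (inverse x) (n - 2 * val x) g =
    (if ?a \<noteq> 0 \<and> ?c / ?a \<in> vball (inverse x) (n - 2 * val x) then tw \<sigma> (det A / (?a * ?a)) else 0)"
    unfolding A(2) ballfun_class[OF A(1)] ..
  have cond: "(?c \<noteq> 0 \<and> ?a / ?c \<in> vball x n) \<longleftrightarrow> (?a \<noteq> 0 \<and> ?c / ?a \<in> vball (inverse x) (n - 2 * val x))"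
  proof (cases "?a = 0 \<or> ?c = 0")
    case True
    then show ?thesis using x vball_inverse[OF x, of 0] by auto
  next
    case False
    then show ?thesis using vball_inverse[OF x, of "?c / ?a"] by auto
  qed
  show "left_translation weyl (ballfun \<sigma> x n) g =
     ch (-1) * of_real (absval x powr (2 * \<sigma>)) * ballfun \<sigma> (inverse x) (n - 2 * val x) g"
  proof (cases "?c \<noteq> 0 \<and> ?a / ?c \<in> vball x n")
    case True
    then have ac: "?a \<noteq> 0" "?c \<noteq> 0" using cond by auto
    have "val (?a / ?c) = val x" using val_vball[OF x] True by blast
    then have "absval (?a / ?c) = absval x" using ac x0 by (simp add: absval_eq)
    moreover have "- det A / (?c * ?c) = - ((?a / ?c) * (?a / ?c)) * (det A / (?a * ?a))"
      using ac by (simp add: field_simps)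
    ultimately show ?thesis
      unfolding lhs rhs using True cond ac dA tw_uminus_sq[of "?a / ?c" \<sigma>]
        tw_mult[of "- ((?a / ?c) * (?a / ?c))" "det A / (?a * ?a)" \<sigma>] by simp
  next
    case False
    then show ?thesis unfolding lhs rhs using cond by auto
  qed
qed

lemma lt_nbar_at: "left_translation (nbar y) f (nbar z) = f (nbar (z - y))"
  by (simp add: left_translation_def inverse_nbar nbar_add)

lemma lt_diag_at:
  assumes f: "f \<in> indsp s" and a: "a \<noteq> 0"
  shows "left_translation (borel_elt a 0) f (nbar z) = tw (s + 1/2) a * f (nbar (a * z))"
proof -
  have "left_translation (borel_elt a 0) f (nbar z) = f (nbar (a * z) * borel_elt (inverse a) 0)"
    using a by (simp add: left_translation_def inverse_borel_diag diag_nbar field_simps)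
  then show ?thesis using f a by (simp add: indsp_iff tw_inverse)
qed

lemma lt_weyl_at:
  assumes f: "f \<in> indsp s" and z: "z \<noteq> 0"
  shows "left_translation weyl f (nbar z) =
    ch (-1) * of_real (absval z powr (- (2 * s + 1))) * f (nbar (inverse z))"
proof -
  have "left_translation weyl f (nbar z) = inverse (tw (s + 1/2) (- (z * z))) * f (nbar (inverse z))"
    using f z by (simp add: left_translation_def inverse_weyl weyl_nbar indsp_iff)
  also have "inverse (tw (s + 1/2) (- (z * z))) = ch (-1) * of_real (absval z powr (- (2 * s + 1)))"
  proof -
    have "inverse (ch (-1)) = ch (-1)" using ch_sq[of "-1"] by (simp add: inverse_unique)
    moreover have "2 * (s + 1/2) = 2 * s + 1" by simp
    ultimately show ?thesis unfolding tw_uminus_sq[OF z] powr_minus by simp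
  qed
  finally show ?thesis .
qed

lemma tendsto_nbar_matrix: "((\<lambda>y. m2 1 0 y 1) \<longlongrightarrow> m2 1 0 x 1) (nhds x)" for x :: 'k
proof (intro vec_tendstoI)
  fix i j :: 2
  show "((\<lambda>y. m2 1 0 y 1 $ i $ j) \<longlongrightarrow> m2 1 0 x 1 $ i $ j) (nhds x)"
    using exhaust_2[of i] exhaust_2[of j] by (auto intro: filterlim_ident)
qed

lemma indsp_nbar_locally_constant:
  assumes f: "f \<in> indsp s" shows "\<exists>n. \<forall>y\<in>vball x n. f (nbar y) = f (nbar x)"
proof -
  have "eventually (\<lambda>B. f (pgl2_class B) = f (pgl2_class (m2 1 0 x 1))) (nhds (m2 1 0 x 1))"
    using f unfolding indsp_iff locally_constant_pgl2_iff by simp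
  from eventually_nhds_compose[of "\<lambda>y. m2 1 0 y 1", OF tendsto_nbar_matrix this]
  show ?thesis unfolding nbar_def eventually_nhds_vball .
qed

text \<open>Compactness of the ball containing the support gives a common radius of constancy; n0 is
  at least R so that a small ball centred outside that ball stays outside it.\<close>

lemma indsp_uniform:
  assumes f: "f \<in> indsp s" and supp: "\<And>y. y \<notin> vball 0 R \<Longrightarrow> f (nbar y) = 0"
  shows "\<exists>n0. \<forall>n\<ge>n0. \<forall>x. \<forall>y\<in>vball x n. f (nbar y) = f (nbar x)"
proof -
  obtain N where N: "\<And>x y. y \<in> vball x (N x) \<Longrightarrow> f (nbar y) = f (nbar x)"
    using indsp_nbar_locally_constant[OF f] by metis
  obtain C where C: "finite C" "vball 0 R \<subseteq> (\<Union>x\<in>C. vball x (N x))"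
  proof -
    have "vball 0 R \<subseteq> (\<Union>x\<in>vball 0 R. vball x (N x))" by auto
    from compactE_image[OF compact_vball open_vball this] that show ?thesis by metis
  qed
  define n0 where "n0 = Max (insert R (N ` C))"
  have n0: "R \<le> n0" "\<And>x. x \<in> C \<Longrightarrow> N x \<le> n0" using C(1) by (auto simp: n0_def)
  have "f (nbar y) = f (nbar x)" if n: "n0 \<le> n" and y: "y \<in> vball x n" for n x y
  proof (cases "x \<in> vball 0 R")
    case True
    then obtain c where c: "c \<in> C" "x \<in> vball c (N c)" using C by blast
    then have "y \<in> vball c (N c)" using n0(2)[OF c(1)] n y vball_subset[OF c(2), of n] by auto
    then show ?thesis using N c by metis
  next
    case False
    have "y \<notin> vball 0 R"
    proof
      assume "y \<in> vball 0 R"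
      moreover have "x \<in> vball y n" using y vball_sym by blast
      ultimately show False using vball_subset[of y 0 R n] n n0(1) False by auto
    qed
    then show ?thesis using False supp by simp
  qed
  then show ?thesis by blast
qed

end

section \<open>Approximation by functions on the larger field\<close>

text \<open>The invariant forms enter only through their values on combinations of balls. The flag \<open>Z\<close> imposes
  mean zero: it is off for the complementary series and on for the Steinberg representation.\<close>

locale restr = quad_ext \<iota> + E: quad_character \<pi>E chi + F: quad_character \<pi>F eta
  for \<iota> :: "'f::nonarch_local_field \<Rightarrow> 'e::nonarch_local_field" and \<pi>E :: 'e and \<pi>F :: 'f
    and chi :: "'e \<Rightarrow> complex" and eta :: "'f \<Rightarrow> complex" +
  fixes dE :: "'e measure" and dF :: "'f measure" and s t :: real and Z :: bool
    and BE :: "('e pgl2 \<Rightarrow> complex) \<Rightarrow> ('e pgl2 \<Rightarrow> complex) \<Rightarrow> complex"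
    and BF :: "('f pgl2 \<Rightarrow> complex) \<Rightarrow> ('f pgl2 \<Rightarrow> complex) \<Rightarrow> complex"
    and kE kbE kF kbF :: "int \<Rightarrow> real" and C A :: real
  assumes eta_chi: "\<And>u. u \<in> integer_units \<Longrightarrow> eta u = chi (\<iota> u)"
    and compat: "compatible_uniformizers \<iota> chi \<pi>E \<pi>F"
    and dE: "haar_measure dE" and dF: "haar_measure dF"
    and t: "t = 2 * s - 1/2" "t > 0" and Zs: "Z \<Longrightarrow> s = 1/2"
    and formE: "\<And>f g I J c d x z n m. f \<in> E.indsp s \<Longrightarrow> g \<in> E.indsp s \<Longrightarrow>
        (Z \<Longrightarrow> (LINT x|dE. f (nbar x)) = 0) \<Longrightarrow> (Z \<Longrightarrow> (LINT x|dE. g (nbar x)) = 0) \<Longrightarrow>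
        finite (I :: ('f \<times> int) set) \<Longrightarrow> finite (J :: ('f \<times> int) set) \<Longrightarrow>
        (\<And>y. f (nbar y) = (\<Sum>i\<in>I. c i * indicator (vball (x i) (n i)) y)) \<Longrightarrow>
        (\<And>y. g (nbar y) = (\<Sum>j\<in>J. d j * indicator (vball (z j) (m j)) y)) \<Longrightarrow>
        BE f g = (\<Sum>i\<in>I. \<Sum>j\<in>J. c i * cnj (d j) *
          of_real (volball dE (n i) * volball dE (m j) * bkern kE kbE (x i) (n i) (z j) (m j)))"
    and formF: "\<And>f g I J c d x z n m. f \<in> F.indsp t \<Longrightarrow> g \<in> F.indsp t \<Longrightarrow>
        (Z \<Longrightarrow> (LINT x|dF. f (nbar x)) = 0) \<Longrightarrow> (Z \<Longrightarrow> (LINT x|dF. g (nbar x)) = 0) \<Longrightarrow>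
        finite (I :: ('f \<times> int) set) \<Longrightarrow> finite (J :: ('f \<times> int) set) \<Longrightarrow>
        (\<And>y. f (nbar y) = (\<Sum>i\<in>I. c i * indicator (vball (x i) (n i)) y)) \<Longrightarrow>
        (\<And>y. g (nbar y) = (\<Sum>j\<in>J. d j * indicator (vball (z j) (m j)) y)) \<Longrightarrow>
        BF f g = (\<Sum>i\<in>I. \<Sum>j\<in>J. c i * cnj (d j) *
          of_real (volball dF (n i) * volball dF (m j) * bkern kF kbF (x i) (n i) (z j) (m j)))"
    and C: "C > 0" and k_match: "\<And>v. kE (ram * v) = C * kF v"
    and kb_match: "\<And>n. \<bar>kbE (ram * n) - C * kbF n\<bar> \<le> A * resq TYPE('f) powr (- real_of_int n * (2 * t - 1))"
    and kb_lim: "(\<lambda>m. (volball dF (int m))\<^sup>2 * kbF (int m)) \<longlonglongrightarrow> 0"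
begin

definition "VE = {f \<in> E.indsp s. Z \<longrightarrow> (LINT x|dE. f (nbar x)) = 0}"
definition "VF = {f \<in> F.indsp t. Z \<longrightarrow> (LINT x|dF. f (nbar x)) = 0}"

lemma VED: "f \<in> VE \<Longrightarrow> f \<in> E.indsp s" "f \<in> VE \<Longrightarrow> Z \<Longrightarrow> (LINT x|dE. f (nbar x)) = 0"
  and VFD: "g \<in> VF \<Longrightarrow> g \<in> F.indsp t" "g \<in> VF \<Longrightarrow> Z \<Longrightarrow> (LINT x|dF. g (nbar x)) = 0"
  unfolding VE_def VF_def by blast+

lemma qgt: "resq TYPE('f) > 1" "resq TYPE('f) > 0" using resq_gt_1 resq_gt_0 by auto

section \<open>Comparison of the two fields along the embedding\<close>

lemma absval_ext_powr: "x \<noteq> 0 \<Longrightarrow> absval (\<iota> x) powr a = absval x powr (2 * a)"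
proof -
  assume x: "x \<noteq> 0"
  have "absval (\<iota> x) powr a = (resq TYPE('e) powr real_of_int ram) powr (- real_of_int (val x) * a)"
    using x by (simp add: absval_powr val_ext powr_powr algebra_simps)
  also have "\<dots> = absval x powr (2 * a)"
    unfolding resq_ext[OF dE] using x qgt by (simp add: absval_powr powr_powr mult_ac flip: powr_numeral)
  finally show ?thesis .
qed

lemma volball_ext: "volball dE (ram * n) = volball dE 0 * resq TYPE('f) powr (- 2 * real_of_int n)"
proof -
  have "resq TYPE('e) powr (- real_of_int (ram * n)) = (resq TYPE('e) powr real_of_int ram) powr (- real_of_int n)"
    by (simp add: powr_powr)
  also have "\<dots> = resq TYPE('f) powr (- 2 * real_of_int n)"
    unfolding resq_ext[OF dE] using qgt by (simp add: powr_powr flip: powr_numeral)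
  finally show ?thesis using volball_eq[OF dE, of "ram * n"] by simp
qed

text \<open>The factor that equalizes masses. A ball of exponent \<open>ram * n\<close> around an
  embedded point meets the smaller field exactly in the ball of exponent n.\<close>

definition "om n = volball dF n / volball dE (ram * n)"

lemma om_volball: "om n * volball dE (ram * n) = volball dF n"
  using volball_pos[OF dE, of "ram * n"] by (simp add: om_def)

lemma om_eq: "om n = volball dF 0 / volball dE 0 * resq TYPE('f) powr (real_of_int n)"
proof -
  have "resq TYPE('f) powr (real_of_int n) =
      resq TYPE('f) powr (- real_of_int n) / resq TYPE('f) powr (- 2 * real_of_int n)"
    by (simp flip: powr_diff)
  then show ?thesis unfolding om_def volball_ext volball_eq[OF dF, of n] by simp
qed

lemma om_shift: "om (n - v) = om n * resq TYPE('f) powr (- real_of_int v)"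
proof -
  have "resq TYPE('f) powr (real_of_int (n - v)) =
      resq TYPE('f) powr (real_of_int n) * resq TYPE('f) powr (- real_of_int v)"
    by (simp flip: powr_add)
  then show ?thesis unfolding om_eq by simp
qed

lemma volball_shift: "volball dF (n - v) = volball dF n * resq TYPE('f) powr (real_of_int v)"
  unfolding volball_eq[OF dF, of "n - v"] volball_eq[OF dF, of n]
  by (simp add: powr_add[symmetric] algebra_simps)

text \<open>Compatibility makes the extended character trivial on the image of
  \<open>\<pi>F\<close>, so the comparison reduces to units, where \<open>eta\<close> is the
  restriction of \<open>chi\<close>.\<close>

lemma E_ch_ext: assumes x: "x \<noteq> 0" shows "E.ch (\<iota> x) = F.ch x"
proof -
  let ?u = "\<pi>F powi (- val x) * x"
  have p: "E.ch (\<iota> \<pi>F) = 1" using compat by (simp add: compatible_uniformizers_def E.ch_def)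
  have pp: "\<pi>F \<noteq> 0" using F.pi by simp
  have "E.ch (\<iota> \<pi>F ^ n) = 1" for n
    by (induction n) (use p pp in \<open>auto simp: E.ch_mult\<close>)
  then have pow: "E.ch (\<iota> \<pi>F powi n) = 1" for n
    using pp E.ch_inverse[of "\<iota> \<pi>F ^ nat (- n)"] by (auto simp: power_int_def power_inverse)
  have u: "?u \<in> integer_units" "?u \<noteq> 0" using F.unit_part[OF x] x pp by auto
  have "val (\<iota> ?u) = 0" using u by (simp add: val_ext integer_units_def del: mult_eq_0_iff)
  then have "E.ch (\<iota> ?u) = F.ch x" using eta_chi[OF u(1)] by (simp add: E.ch_def F.ch_def)
  moreover have "E.ch (\<iota> ?u) = E.ch (\<iota> x)"
    using x pp E.ch_mult[of "\<iota> \<pi>F powi (- val x)" "\<iota> x"] by (simp add: ext_mult ext_powi pow)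
  ultimately show ?thesis by simp
qed

lemma ext_vball_iff: "\<iota> y \<in> vball (\<iota> x) (ram * n) \<longleftrightarrow> y \<in> vball x n"
  by (simp add: vball_iff vge_ext_iff flip: ext_diff)

definition approx :: "('f pgl2 \<Rightarrow> complex) \<Rightarrow> ('f \<times> int) set \<Rightarrow> 'e pgl2 \<Rightarrow> complex" where
  "approx f S = (\<lambda>h. \<Sum>p\<in>S. f (nbar (fst p)) * of_real (om (snd p)) *
     E.ballfun (s + 1/2) (\<iota> (fst p)) (ram * snd p) h)"

abbreviation pball :: "'f \<times> int \<Rightarrow> 'f set" where "pball p \<equiv> vball (fst p) (snd p)"

definition sys :: "('f pgl2 \<Rightarrow> complex) \<Rightarrow> ('f \<times> int) set \<Rightarrow> bool" where
  "sys f S \<longleftrightarrow> finite S \<and> disjoint_family_on pball S \<and>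
     (\<forall>p\<in>S. \<forall>y\<in>pball p. f (nbar y) = f (nbar (fst p))) \<and>
     (\<forall>y. (\<forall>p\<in>S. y \<notin> pball p) \<longrightarrow> f (nbar y) = 0)"

lemma sysD:
  assumes "sys f S"
  shows "finite S" "disjoint_family_on pball S"
    "p \<in> S \<Longrightarrow> p' \<in> S \<Longrightarrow> y \<in> pball p \<Longrightarrow> y \<in> pball p' \<Longrightarrow> p = p'"
    "p \<in> S \<Longrightarrow> y \<in> pball p \<Longrightarrow> f (nbar y) = f (nbar (fst p))"
    "(\<And>p. p \<in> S \<Longrightarrow> y \<notin> pball p) \<Longrightarrow> f (nbar y) = 0"
proof -
  show "finite S" and dis: "disjoint_family_on pball S" using assms unfolding sys_def by blast+
  show "p = p'" if "p \<in> S" "p' \<in> S" "y \<in> pball p" "y \<in> pball p'"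
  proof (rule ccontr)
    assume "p \<noteq> p'"
    then have "pball p \<inter> pball p' = {}" using dis that unfolding disjoint_family_on_def by simp
    then show False using that by (simp add: disjoint_iff)
  qed
  show "f (nbar y) = f (nbar (fst p))" if "p \<in> S" "y \<in> pball p"
    using assms that unfolding sys_def by blast
  show "f (nbar y) = 0" if "\<And>p. p \<in> S \<Longrightarrow> y \<notin> pball p"
    using assms that unfolding sys_def by blast
qed

lemma sys_sum: assumes "sys f S"
  shows "f (nbar y) = (\<Sum>p\<in>S. f (nbar (fst p)) * indicator (pball p) y)"
proof (cases "\<exists>p\<in>S. y \<in> pball p")
  case True
  then obtain p where p: "p \<in> S" "y \<in> pball p" by blast
  have "f (nbar (fst p')) * indicator (pball p') y = (if p' = p then f (nbar y) else 0)" if "p' \<in> S" for p'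
  proof (cases "y \<in> pball p'")
    case True
    then have "p' = p" using sysD(3)[OF assms that p(1) True p(2)] by simp
    then show ?thesis using sysD(4)[OF assms p] p by simp
  next
    case False
    then show ?thesis using p by auto
  qed
  then have "(\<Sum>p\<in>S. f (nbar (fst p)) * indicator (pball p) y) = (\<Sum>p'\<in>S. if p' = p then f (nbar y) else 0)"
    by (intro sum.cong refl)
  then show ?thesis using sysD(1)[OF assms] p by simp
next
  case False
  then show ?thesis using sysD(5)[OF assms, of y] by simp
qed

lemma sys_integral: assumes "sys f S"
  shows "(LINT y|dF. f (nbar y)) = (\<Sum>p\<in>S. f (nbar (fst p)) * of_real (volball dF (snd p)))"
  by (rule haar_integral_balls[OF dF sys_sum[OF assms]])

lemma sys_integrable: assumes "sys f S" shows "integrable dF (\<lambda>y. f (nbar y))"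
proof -
  have "integrable dF (\<lambda>y. \<Sum>p\<in>S. f (nbar (fst p)) * indicator (pball p) y)"
    by (intro Bochner_Integration.integrable_sum integrable_mult_right vball_complex_integral[OF dF])
  then show ?thesis by (simp only: sys_sum[OF assms, symmetric])
qed

lemma approx_nbar: "approx f S (nbar y) =
    (\<Sum>p\<in>S. f (nbar (fst p)) * of_real (om (snd p)) * indicator (vball (\<iota> (fst p)) (ram * snd p)) y)"
  by (simp add: approx_def)

text \<open>The weights \<open>om\<close> preserve the mass of each ball, hence the total integral,
  and mean zero passes to the larger field.\<close>

lemma approx_VE: assumes f: "f \<in> VF" and S: "sys f S" shows "approx f S \<in> VE"
proof -
  have "approx f S \<in> E.indsp s" unfolding approx_def
    by (intro E.indsp_sum E.indsp_cmult E.ballfun_indsp)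
  moreover have "(LINT x|dE. approx f S (nbar x)) = (LINT y|dF. f (nbar y))"
    unfolding haar_integral_balls[OF dE approx_nbar] sys_integral[OF S] mult.assoc of_real_mult[symmetric] om_volball ..
  ultimately show ?thesis using f by (simp add: VE_def VF_def)
qed

lemma pball_volume_sum:
  assumes "finite S" "disjoint_family_on pball S" "\<And>p. p \<in> S \<Longrightarrow> pball p \<subseteq> vball z r"
  shows "(\<Sum>p\<in>S. volball dF (snd p)) \<le> volball dF r"
proof -
  have "(\<Sum>p\<in>S. volball dF (snd p)) = (\<Sum>p\<in>S. measure dF (pball p))"
    by (simp add: measure_vball[OF dF])
  also have "\<dots> = measure dF (\<Union>p\<in>S. pball p)"
    using assms dF by (intro measure_finite_Union[symmetric]) (auto simp: emeasure_vball)
  also have "\<dots> \<le> measure dF (vball z r)"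
    using assms dF by (intro measure_mono_fmeasurable) (auto simp: emeasure_vball fmeasurable_def)
  finally show ?thesis by (simp add: measure_vball[OF dF])
qed

text \<open>Disjoint balls inside a ball have at most its volume in total, so p contributes at most
  its squared volume times the kernel at its radius, which is its volume times a quantity of order
  q^(-2 t n). As t is positive, this is uniformly small for n at least N.\<close>

lemma nested_sum_bound:
  assumes S: "finite S" "disjoint_family_on pball S" "\<And>p. p \<in> S \<Longrightarrow> pball p \<subseteq> vball 0 R"
    "\<And>p. p \<in> S \<Longrightarrow> N \<le> snd p"
    and S': "finite S'" "disjoint_family_on pball S'"
  shows "(\<Sum>p\<in>S. \<Sum>p'\<in>S'. if pball p' \<subseteq> pball p
      then volball dF (snd p) * volball dF (snd p') * resq TYPE('f) powr (- real_of_int (snd p) * (2 * t - 1)) else 0)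
    \<le> volball dF 0 * resq TYPE('f) powr (- 2 * t * real_of_int N) * volball dF R"
proof -
  have pos: "volball dF n \<ge> 0" for n using volball_pos[OF dF, of n] by simp
  have "(\<Sum>p'\<in>S'. if pball p' \<subseteq> pball p
      then volball dF (snd p) * volball dF (snd p') * resq TYPE('f) powr (- real_of_int (snd p) * (2 * t - 1)) else 0)
    \<le> volball dF (snd p) * (volball dF 0 * resq TYPE('f) powr (- 2 * t * real_of_int N))" (is "?L \<le> _") if p: "p \<in> S" for p
  proof -
    let ?K = "volball dF (snd p) * resq TYPE('f) powr (- real_of_int (snd p) * (2 * t - 1))"
    let ?T = "{p'\<in>S'. pball p' \<subseteq> pball p}"
    have "?L = (\<Sum>p'\<in>?T. ?K * volball dF (snd p'))"
      unfolding sum.inter_filter[OF S'(1)] by (intro sum.cong refl) (simp add: mult_ac)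
    also have "\<dots> = ?K * (\<Sum>p'\<in>?T. volball dF (snd p'))"
      by (simp only: sum_distrib_left)
    also have "\<dots> \<le> ?K * volball dF (snd p)"
      using S' pos by (intro mult_left_mono pball_volume_sum[where z = "fst p"])
        (auto intro: disjoint_family_on_mono[rotated])
    also have "?K = volball dF 0 * resq TYPE('f) powr (- 2 * t * real_of_int (snd p))"
      unfolding volball_eq[OF dF, of "snd p"] by (simp add: powr_add[symmetric] algebra_simps)
    also have "volball dF 0 * resq TYPE('f) powr (- 2 * t * real_of_int (snd p)) * volball dF (snd p) \<le>
       volball dF 0 * resq TYPE('f) powr (- 2 * t * real_of_int N) * volball dF (snd p)"
    proof -
      have "t * real_of_int N \<le> t * real_of_int (snd p)" using S(4)[OF p] t(2) by (intro mult_left_mono) auto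
      then have "resq TYPE('f) powr (- 2 * t * real_of_int (snd p)) \<le> resq TYPE('f) powr (- 2 * t * real_of_int N)"
        using qgt by (intro powr_mono) auto
      then show ?thesis using pos by (simp add: mult_left_mono mult_right_mono)
    qed
    finally show ?thesis by (simp add: mult_ac)
  qed
  then have "(\<Sum>p\<in>S. \<Sum>p'\<in>S'. if pball p' \<subseteq> pball p
      then volball dF (snd p) * volball dF (snd p') * resq TYPE('f) powr (- real_of_int (snd p) * (2 * t - 1)) else 0)
    \<le> (\<Sum>p\<in>S. volball dF (snd p) * (volball dF 0 * resq TYPE('f) powr (- 2 * t * real_of_int N)))"
    by (rule sum_mono)
  also have "\<dots> = (\<Sum>p\<in>S. volball dF (snd p)) * (volball dF 0 * resq TYPE('f) powr (- 2 * t * real_of_int N))"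
    by (simp only: sum_distrib_right)
  also have "\<dots> \<le> volball dF R * (volball dF 0 * resq TYPE('f) powr (- 2 * t * real_of_int N))"
    using pos S by (intro mult_right_mono pball_volume_sum[where z = 0]) auto
  finally show ?thesis by (simp add: mult_ac)
qed

text \<open>Disjoint pairs match exactly; for nested pairs the discrepancy is that of the two
  diagonal kernels at the larger ball. The bound is split by which ball contains the other, in the
  shape that \<open>nested_sum_bound\<close> handles; for equal balls both terms occur.\<close>

lemma bkern_diff:
  "\<bar>bkern kE kbE (\<iota> x) (ram * n) (\<iota> y) (ram * m) - C * bkern kF kbF x n y m\<bar> \<le>
    (if vball y m \<subseteq> vball x n then A * resq TYPE('f) powr (- real_of_int n * (2 * t - 1)) else 0) +
    (if vball x n \<subseteq> vball y m then A * resq TYPE('f) powr (- real_of_int m * (2 * t - 1)) else 0)"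
proof -
  \<comment> \<open>At exponent 0 the bound \<open>kb_match\<close> has weight 1 and dominates an
    absolute value.\<close>
  have A: "A \<ge> 0"
  proof -
    have "0 \<le> A * resq TYPE('f) powr (- real_of_int 0 * (2 * t - 1))" using kb_match[of 0] by linarith
    then show ?thesis using qgt by simp
  qed
  have mm: "min (ram * n) (ram * m) = ram * min n m" using ram_pos by (simp add: min_mult_distrib_left)
  show ?thesis
  proof (cases "y \<in> vball x (min n m)")
    case False
    have "bkern kE kbE (\<iota> x) (ram * n) (\<iota> y) (ram * m) = kE (ram * val (y - x))"
    proof -
      have "y - x \<noteq> 0" using False by auto
      from val_ext[OF this] False show ?thesis by (simp add: bkern_def mm ext_vball_iff flip: ext_diff)
    qed
    then show ?thesis using False A by (simp add: bkern_def k_match)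
  next
    case True
    then have eq: "bkern kE kbE (\<iota> x) (ram * n) (\<iota> y) (ram * m) - C * bkern kF kbF x n y m =
        kbE (ram * min n m) - C * kbF (min n m)"
      by (simp add: bkern_def mm ext_vball_iff)
    show ?thesis
    proof (cases "n \<le> m")
      case le: True
      then have "vball y m \<subseteq> vball x n" using True by (intro vball_subset) auto
      then show ?thesis unfolding eq using kb_match[of n] le A by (auto simp: min_absorb1 intro!: add_increasing2)
    next
      case le: False
      then have "vball x n \<subseteq> vball y m" using True vball_sym[of x y m] by (intro vball_subset) auto
      then show ?thesis unfolding eq using kb_match[of m] le A by (auto simp: min_absorb2 intro!: add_increasing)
    qed
  qed
qed

text \<open>The two systems share bounds on support, mesh and values but are otherwise unrelated.
  Applied with f = g and two different systems, this later makes the approximants of one function a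
  Cauchy sequence.\<close>

lemma form_estimate:
  assumes f: "f \<in> VF" "sys f S" "\<And>p. p \<in> S \<Longrightarrow> pball p \<subseteq> vball 0 R" "\<And>p. p \<in> S \<Longrightarrow> N \<le> snd p"
    "\<And>p. p \<in> S \<Longrightarrow> cmod (f (nbar (fst p))) \<le> K"
  and g: "g \<in> VF" "sys g S'" "\<And>p. p \<in> S' \<Longrightarrow> pball p \<subseteq> vball 0 R" "\<And>p. p \<in> S' \<Longrightarrow> N \<le> snd p"
    "\<And>p. p \<in> S' \<Longrightarrow> cmod (g (nbar (fst p))) \<le> K"
  and K: "K \<ge> 0"
  shows "cmod (BE (approx f S) (approx g S') - of_real C * BF f g) \<le>
    2 * (K * K * A * (volball dF 0 * resq TYPE('f) powr (- 2 * t * real_of_int N) * volball dF R))"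
proof -
  have fin: "finite S" "finite S'" using sysD(1) f(2) g(2) by blast+
  have pos: "volball dF n \<ge> 0" for n using volball_pos[OF dF, of n] by simp
  let ?v = "\<lambda>p. volball dF (snd p)"
  let ?bE = "\<lambda>p p'. bkern kE kbE (\<iota> (fst p)) (ram * snd p) (\<iota> (fst p')) (ram * snd p')"
  let ?bF = "\<lambda>p p'. bkern kF kbF (fst p) (snd p) (fst p') (snd p')"
  let ?c = "\<lambda>p p'. f (nbar (fst p)) * cnj (g (nbar (fst p')))"
  have "BE (approx f S) (approx g S') = (\<Sum>p\<in>S. \<Sum>p'\<in>S'.
     (f (nbar (fst p)) * of_real (om (snd p))) * cnj (g (nbar (fst p')) * of_real (om (snd p'))) *
     of_real (volball dE (ram * snd p) * volball dE (ram * snd p') * ?bE p p'))"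
    using approx_VE[OF f(1,2)] approx_VE[OF g(1,2)]
    by (intro formE approx_nbar VED fin)
  also have "\<dots> = (\<Sum>p\<in>S. \<Sum>p'\<in>S'. ?c p p' * of_real (?v p * ?v p' * ?bE p p'))"
    by (intro sum.cong refl) (simp add: om_volball[symmetric])
  finally have E: "BE (approx f S) (approx g S') = \<dots>" .
  have F: "BF f g = (\<Sum>p\<in>S. \<Sum>p'\<in>S'. ?c p p' * of_real (?v p * ?v p' * ?bF p p'))"
    using f(1) g(1) by (intro formF sys_sum f(2) g(2) VFD fin)
  have diff: "BE (approx f S) (approx g S') - of_real C * BF f g =
    (\<Sum>p\<in>S. \<Sum>p'\<in>S'. ?c p p' * of_real (?v p * ?v p' * (?bE p p' - C * ?bF p p')))"
    unfolding E F sum_distrib_left sum_subtractf[symmetric]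
    by (intro sum.cong refl) (simp add: algebra_simps)
  have "cmod (BE (approx f S) (approx g S') - of_real C * BF f g) \<le>
      (\<Sum>p\<in>S. \<Sum>p'\<in>S'. cmod (?c p p' * of_real (?v p * ?v p' * (?bE p p' - C * ?bF p p'))))"
    unfolding diff by (rule order_trans[OF norm_sum sum_mono[OF norm_sum]])
  also have "\<dots> \<le> (\<Sum>p\<in>S. \<Sum>p'\<in>S'. K * K * A *
     ((if pball p' \<subseteq> pball p then ?v p * ?v p' * resq TYPE('f) powr (- real_of_int (snd p) * (2 * t - 1)) else 0) +
      (if pball p \<subseteq> pball p' then ?v p' * ?v p * resq TYPE('f) powr (- real_of_int (snd p') * (2 * t - 1)) else 0)))"
  proof (intro sum_mono)
    fix p p' assume p: "p \<in> S" "p' \<in> S'"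
    let ?r = "(if pball p' \<subseteq> pball p then A * resq TYPE('f) powr (- real_of_int (snd p) * (2 * t - 1)) else 0) +
      (if pball p \<subseteq> pball p' then A * resq TYPE('f) powr (- real_of_int (snd p') * (2 * t - 1)) else 0)"
    have "cmod (?c p p' * of_real (?v p * ?v p' * (?bE p p' - C * ?bF p p'))) =
      (cmod (f (nbar (fst p))) * cmod (g (nbar (fst p')))) * (?v p * ?v p' * \<bar>?bE p p' - C * ?bF p p'\<bar>)"
      using pos by (simp add: norm_mult abs_mult del: of_real_mult of_real_diff)
    also have "\<dots> \<le> (K * K) * (?v p * ?v p' * ?r)"
    proof (rule mult_mono)
      show "cmod (f (nbar (fst p))) * cmod (g (nbar (fst p'))) \<le> K * K"
        using p f(5) g(5) K by (intro mult_mono) auto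
      show "?v p * ?v p' * \<bar>?bE p p' - C * ?bF p p'\<bar> \<le> ?v p * ?v p' * ?r"
        using pos by (intro mult_left_mono bkern_diff mult_nonneg_nonneg)
    qed (use K pos in auto)
    also have "\<dots> = K * K * A *
     ((if pball p' \<subseteq> pball p then ?v p * ?v p' * resq TYPE('f) powr (- real_of_int (snd p) * (2 * t - 1)) else 0) +
      (if pball p \<subseteq> pball p' then ?v p' * ?v p * resq TYPE('f) powr (- real_of_int (snd p') * (2 * t - 1)) else 0))"
      by (simp add: algebra_simps)
    finally show "cmod (?c p p' * of_real (?v p * ?v p' * (?bE p p' - C * ?bF p p'))) \<le> \<dots>" .
  qed
  also have "\<dots> = K * K * A * (
     (\<Sum>p\<in>S. \<Sum>p'\<in>S'. if pball p' \<subseteq> pball p then ?v p * ?v p' * resq TYPE('f) powr (- real_of_int (snd p) * (2 * t - 1)) else 0) +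
     (\<Sum>p'\<in>S'. \<Sum>p\<in>S. if pball p \<subseteq> pball p' then ?v p' * ?v p * resq TYPE('f) powr (- real_of_int (snd p') * (2 * t - 1)) else 0))"
    by (subst sum.swap[of _ S S']) (simp only: sum_distrib_left[symmetric] sum.distrib)
  also have "\<dots> \<le> K * K * A * (volball dF 0 * resq TYPE('f) powr (- 2 * t * real_of_int N) * volball dF R +
      volball dF 0 * resq TYPE('f) powr (- 2 * t * real_of_int N) * volball dF R)"
  proof (intro mult_left_mono add_mono nested_sum_bound)
    have "0 \<le> A * resq TYPE('f) powr (- real_of_int 0 * (2 * t - 1))" using kb_match[of 0] by linarith
    then show "0 \<le> K * K * A" using qgt K by simp
  qed (use f g sysD(1,2)[OF f(2)] sysD(1,2)[OF g(2)] in auto)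
  finally show ?thesis by (simp add: algebra_simps)
qed

text \<open>Sequences of systems with uniformly bounded support and mesh tending to 0. No particular
  sequence is singled out, so that the image of a sequence under a generator can be used for the
  translated function.\<close>

definition good :: "('f pgl2 \<Rightarrow> complex) \<Rightarrow> (nat \<Rightarrow> ('f \<times> int) set) \<Rightarrow> bool" where
  "good f S \<longleftrightarrow> f \<in> VF \<and> (\<forall>k. sys f (S k)) \<and> (\<exists>R. \<forall>k. \<forall>p\<in>S k. pball p \<subseteq> vball 0 R) \<and>
     (\<forall>N. \<exists>k0. \<forall>k\<ge>k0. \<forall>p\<in>S k. N \<le> snd p)"

lemma good_bounded: assumes "good f S" shows "\<exists>K\<ge>0. \<forall>y. cmod (f (nbar y)) \<le> K"
proof (intro exI conjI allI)
  let ?K = "\<Sum>p\<in>S 0. cmod (f (nbar (fst p)))"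
  show "?K \<ge> 0" by (intro sum_nonneg) simp
  fix y
  have "cmod (f (nbar y)) \<le> (\<Sum>p\<in>S 0. cmod (f (nbar (fst p)) * indicator (pball p) y))"
    using sys_sum[of f "S 0" y] assms norm_sum[of "\<lambda>p. f (nbar (fst p)) * indicator (pball p) y" "S 0"]
    by (simp add: good_def)
  also have "\<dots> \<le> ?K" by (intro sum_mono) (simp add: indicator_def norm_mult)
  finally show "cmod (f (nbar y)) \<le> ?K" .
qed

lemma form_limit:
  assumes f: "good f S" and g: "good g S'" and e: "e > 0"
  shows "\<exists>N. \<forall>n\<ge>N. \<forall>m\<ge>N. cmod (BE (approx f (S n)) (approx g (S' m)) - of_real C * BF f g) < e"
proof -
  obtain K1 K2 where K: "K1 \<ge> 0" "\<And>y. cmod (f (nbar y)) \<le> K1" "K2 \<ge> 0" "\<And>y. cmod (g (nbar y)) \<le> K2"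
    using good_bounded[OF f] good_bounded[OF g] by blast
  define K where "K = max K1 K2"
  obtain R1 R2 where R12: "\<And>k p. p \<in> S k \<Longrightarrow> pball p \<subseteq> vball 0 R1" "\<And>k p. p \<in> S' k \<Longrightarrow> pball p \<subseteq> vball 0 R2"
    using f g unfolding good_def by meson
  define R where "R = min R1 R2"
  have R: "pball p \<subseteq> vball 0 R" if "p \<in> S k \<or> p \<in> S' k" for k p
    using that R12[of p k] vball_mono[of R R1 0] vball_mono[of R R2 0] unfolding R_def by auto
  let ?D = "2 * (K * K * A * (volball dF 0 * volball dF R))"
  have "\<exists>N::int. \<bar>?D\<bar> * resq TYPE('f) powr (- 2 * t * real_of_int N) < e"
  proof -
    \<comment> \<open>The inequality is solved for q^(-n) and then raised to the positive power 2 t;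
      the summand 1 avoids division by 0.\<close>
    have "\<exists>n::int. resq TYPE('f) powr (- real_of_int n) < (e / (\<bar>?D\<bar> + 1)) powr (1 / (2 * t))"
      using e by (intro exists_powr_less) simp
    then obtain n :: int where n: "resq TYPE('f) powr (- real_of_int n) < (e / (\<bar>?D\<bar> + 1)) powr (1 / (2 * t))" by blast
    have "(resq TYPE('f) powr (- real_of_int n)) powr (2 * t) < ((e / (\<bar>?D\<bar> + 1)) powr (1 / (2 * t))) powr (2 * t)"
      using n t by (intro powr_less_mono2) auto
    then have "resq TYPE('f) powr (- 2 * t * real_of_int n) < e / (\<bar>?D\<bar> + 1)"
      using t(2) e by (simp add: powr_powr mult_ac)
    then have "(\<bar>?D\<bar> + 1) * resq TYPE('f) powr (- 2 * t * real_of_int n) < e" by (simp add: field_simps)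
    moreover have "resq TYPE('f) powr (- 2 * t * real_of_int n) \<ge> 0" by simp
    ultimately have "\<bar>?D\<bar> * resq TYPE('f) powr (- 2 * t * real_of_int n) < e"
      unfolding distrib_right by linarith
    then show ?thesis ..
  qed
  then obtain N where N: "\<bar>?D\<bar> * resq TYPE('f) powr (- 2 * t * real_of_int N) < e" by blast
  obtain k1 k2 where k: "\<And>k p. k \<ge> k1 \<Longrightarrow> p \<in> S k \<Longrightarrow> N \<le> snd p" "\<And>k p. k \<ge> k2 \<Longrightarrow> p \<in> S' k \<Longrightarrow> N \<le> snd p"
    using f g unfolding good_def by meson
  show ?thesis
  proof (intro exI[of _ "max k1 k2"] allI impI)
    fix n m assume nm: "max k1 k2 \<le> n" "max k1 k2 \<le> m"
    have "cmod (BE (approx f (S n)) (approx g (S' m)) - of_real C * BF f g) \<le>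
      2 * (K * K * A * (volball dF 0 * resq TYPE('f) powr (- 2 * t * real_of_int N) * volball dF R))"
    proof (rule form_estimate)
      show "cmod (f (nbar (fst p))) \<le> K" "cmod (g (nbar (fst p))) \<le> K" for p
        using K(2)[of "fst p"] K(4)[of "fst p"] by (auto simp: K_def le_max_iff_disj)
    qed (use f g R k nm K in \<open>auto simp: good_def K_def\<close>)
    also have "\<dots> = ?D * resq TYPE('f) powr (- 2 * t * real_of_int N)" by simp
    also have "\<dots> \<le> \<bar>?D\<bar> * resq TYPE('f) powr (- 2 * t * real_of_int N)" by (intro mult_right_mono) auto
    finally show "cmod (BE (approx f (S n)) (approx g (S' m)) - of_real C * BF f g) < e" using N by simp
  qed
qed

text \<open>How a generator acts on systems of balls: \<open>\<alpha>\<close> moves the balls, \<open>\<beta>\<close> is the inverse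
  substitution, \<open>\<nu>\<close> the automorphy factor, and \<open>e\<close> the factor on the side of the larger field. The
  approximants are chosen so that they are exactly, not only asymptotically, equivariant.\<close>

lemma good_translate:
  assumes S: "good f S" and inj: "\<And>k. inj_on \<alpha> (S k)"
    and ball: "\<And>k p y. p \<in> S k \<Longrightarrow> y \<in> pball (\<alpha> p) \<longleftrightarrow> Q y \<and> \<beta> y \<in> pball p"
    and at: "\<And>y. Q y \<Longrightarrow> left_translation g f (nbar y) = \<nu> y * f (nbar (\<beta> y))"
    and off: "\<And>y. \<not> Q y \<Longrightarrow> left_translation g f (nbar y) = 0"
    and const: "\<And>k p y. p \<in> S k \<Longrightarrow> y \<in> pball (\<alpha> p) \<Longrightarrow> \<nu> y = \<nu> (fst (\<alpha> p))"
    and centre: "\<And>k p. p \<in> S k \<Longrightarrow> \<beta> (fst (\<alpha> p)) = fst p"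
    and E: "\<And>k p. p \<in> S k \<Longrightarrow> left_translation g' (E.ballfun (s + 1/2) (\<iota> (fst p)) (ram * snd p)) =
        (\<lambda>h. e p * E.ballfun (s + 1/2) (\<iota> (fst (\<alpha> p))) (ram * snd (\<alpha> p)) h)"
    and match: "\<And>k p. p \<in> S k \<Longrightarrow> e p * of_real (om (snd p)) = \<nu> (fst (\<alpha> p)) * of_real (om (snd (\<alpha> p)))"
    and mean: "\<And>k p. Z \<Longrightarrow> p \<in> S k \<Longrightarrow> \<nu> (fst (\<alpha> p)) * of_real (volball dF (snd (\<alpha> p))) = \<kappa> * of_real (volball dF (snd p))"
    and bd: "\<And>k p. p \<in> S k \<Longrightarrow> pball (\<alpha> p) \<subseteq> vball 0 R'"
    and mesh: "\<And>k p. p \<in> S k \<Longrightarrow> snd p - d \<le> snd (\<alpha> p)"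
  shows "good (left_translation g f) (\<lambda>k. \<alpha> ` S k)"
    "approx (left_translation g f) (\<alpha> ` S k) = left_translation g' (approx f (S k))"
proof -
  let ?f = "left_translation g f"
  have f: "f \<in> VF" "\<And>k. sys f (S k)" using S by (auto simp: good_def)
  have cen: "?f (nbar (fst (\<alpha> p))) = \<nu> (fst (\<alpha> p)) * f (nbar (fst p))" if "p \<in> S k" for k p
    using at[of "fst (\<alpha> p)"] ball[OF that, of "fst (\<alpha> p)"] centre[OF that] by simp
  have sys: "sys ?f (\<alpha> ` S k)" for k
    unfolding sys_def
  proof (intro conjI ballI allI impI)
    show "finite (\<alpha> ` S k)" using sysD(1)[OF f(2)[of k]] by simp
    have D: "pball (\<alpha> p) \<inter> pball (\<alpha> p') = {}" if "p \<in> S k" "p' \<in> S k" "p \<noteq> p'" for p p'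
    proof -
      have "y \<notin> pball (\<alpha> p')" if y: "y \<in> pball (\<alpha> p)" for y
        using sysD(3)[OF f(2)[of k] \<open>p \<in> S k\<close> \<open>p' \<in> S k\<close>, of "\<beta> y"] y \<open>p \<noteq> p'\<close>
          ball[OF \<open>p \<in> S k\<close>] ball[OF \<open>p' \<in> S k\<close>] by blast
      then show ?thesis by auto
    qed
    show "disjoint_family_on pball (\<alpha> ` S k)" unfolding disjoint_family_on_def
    proof (intro ballI impI)
      fix m n assume "m \<in> \<alpha> ` S k" "n \<in> \<alpha> ` S k" "m \<noteq> n"
      then obtain p p' where pp: "p \<in> S k" "p' \<in> S k" "m = \<alpha> p" "n = \<alpha> p'" by blast
      then have "p \<noteq> p'" using \<open>m \<noteq> n\<close> by blast
      from D[OF pp(1,2) this] show "pball m \<inter> pball n = {}" unfolding pp(3,4) .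
    qed
    show "?f (nbar y) = ?f (nbar (fst p'))" if p': "p' \<in> \<alpha> ` S k" and y: "y \<in> pball p'" for p' y
    proof -
      obtain p where p: "p \<in> S k" "p' = \<alpha> p" using p' by blast
      have q: "Q y" "\<beta> y \<in> pball p" using ball[OF p(1), of y] y unfolding p(2) by blast+
      have "f (nbar (\<beta> y)) = f (nbar (fst p))" by (rule sysD(4)[OF f(2)[of k] p(1) q(2)])
      moreover have "\<nu> y = \<nu> (fst (\<alpha> p))" using const[OF p(1)] y unfolding p(2) .
      ultimately show ?thesis unfolding at[OF q(1)] p(2) cen[OF p(1)] by simp
    qed
    show "?f (nbar y) = 0" if "\<forall>p\<in>\<alpha> ` S k. y \<notin> pball p" for y
    proof (cases "Q y")
      case True
      then have "\<beta> y \<notin> pball p" if "p \<in> S k" for p using that \<open>\<forall>p\<in>\<alpha> ` S k. y \<notin> pball p\<close> ball by blast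
      then have "f (nbar (\<beta> y)) = 0" using sysD(5)[OF f(2)[of k]] by simp
      then show ?thesis using at[OF True] by simp
    qed (rule off)
  qed
  have "?f \<in> VF"
  proof -
    \<comment> \<open>A finite substitution rule: the mass of every ball is multiplied by the same
      factor \<open>\<kappa>\<close>, so mean zero is inherited.\<close>
    have "(LINT y|dF. ?f (nbar y)) = 0" if Z: Z
    proof -
      have "(LINT y|dF. ?f (nbar y)) = (\<Sum>p\<in>S 0. ?f (nbar (fst (\<alpha> p))) * of_real (volball dF (snd (\<alpha> p))))"
        unfolding sys_integral[OF sys[of 0]] by (simp add: sum.reindex[OF inj])
      also have "\<dots> = (\<Sum>p\<in>S 0. \<kappa> * (f (nbar (fst p)) * of_real (volball dF (snd p))))"
        using mean[OF Z] by (intro sum.cong refl) (simp add: cen mult_ac)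
      also have "\<dots> = \<kappa> * (LINT y|dF. f (nbar y))"
        unfolding sys_integral[OF f(2)[of 0]] sum_distrib_left ..
      finally show ?thesis using VFD(2)[OF f(1) Z] by simp
    qed
    then show ?thesis using f(1) by (simp add: VF_def F.indsp_left_translation)
  qed
  moreover have "\<forall>N. \<exists>k0. \<forall>k\<ge>k0. \<forall>p\<in>\<alpha> ` S k. N \<le> snd p"
  proof
    fix N
    obtain k0 where "\<And>k p. k \<ge> k0 \<Longrightarrow> p \<in> S k \<Longrightarrow> N + d \<le> snd p" using S unfolding good_def by meson
    then show "\<exists>k0. \<forall>k\<ge>k0. \<forall>p\<in>\<alpha> ` S k. N \<le> snd p" using mesh by (intro exI[of _ k0]) force
  qed
  ultimately show "good ?f (\<lambda>k. \<alpha> ` S k)"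
    using sys bd unfolding good_def by blast
  show "approx ?f (\<alpha> ` S k) = left_translation g' (approx f (S k))"
  proof
    fix h
    have "left_translation g' (approx f (S k)) h = (\<Sum>p\<in>S k. f (nbar (fst p)) * of_real (om (snd p)) *
        left_translation g' (E.ballfun (s + 1/2) (\<iota> (fst p)) (ram * snd p)) h)"
      by (simp add: left_translation_def approx_def)
    also have "\<dots> = (\<Sum>p\<in>S k. f (nbar (fst p)) * (e p * of_real (om (snd p))) *
        E.ballfun (s + 1/2) (\<iota> (fst (\<alpha> p))) (ram * snd (\<alpha> p)) h)"
      by (intro sum.cong refl) (subst E, assumption, simp)
    also have "\<dots> = (\<Sum>p\<in>S k. ?f (nbar (fst (\<alpha> p))) * of_real (om (snd (\<alpha> p))) *
        E.ballfun (s + 1/2) (\<iota> (fst (\<alpha> p))) (ram * snd (\<alpha> p)) h)"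
      by (intro sum.cong refl) (simp add: match cen mult_ac)
    also have "\<dots> = approx ?f (\<alpha> ` S k) h"
      by (simp add: approx_def sum.reindex[OF inj])
    finally show "approx ?f (\<alpha> ` S k) h = left_translation g' (approx f (S k)) h" ..
  qed
qed

lemma good_nbar:
  assumes S: "good f S"
  shows "\<exists>S'. good (left_translation (nbar a) f) S' \<and>
    (\<forall>k. approx (left_translation (nbar a) f) (S' k) = left_translation (nbar (\<iota> a)) (approx f (S k)))"
proof -
  let ?\<alpha> = "\<lambda>p. (fst p + a, snd p)"
  obtain R where R: "\<And>k p. p \<in> S k \<Longrightarrow> pball p \<subseteq> vball 0 R" using S unfolding good_def by meson
  have inj: "inj_on ?\<alpha> (S k)" for k by (auto simp: inj_on_def prod_eq_iff)
  \<comment> \<open>The bound \<open>min R (val a)\<close> is harmless for a = 0 as well, where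
    \<open>val a\<close> is arbitrary: lowering the exponent only enlarges the ball.\<close>
  note g = good_translate[OF S inj, where Q = "\<lambda>_. True" and \<beta> = "\<lambda>y. y - a" and \<nu> = "\<lambda>_. 1" and e = "\<lambda>_. 1"
      and g = "nbar a" and g' = "nbar (\<iota> a)" and \<kappa> = 1 and R' = "min R (val a)" and d = 0]
  have bd: "pball (?\<alpha> p) \<subseteq> vball 0 (min R (val a))" if "p \<in> S k" for k p
  proof
    fix y assume "y \<in> pball (?\<alpha> p)"
    then have "y - a \<in> pball p" by (simp add: vball_iff algebra_simps)
    then have "vge R (y - a)" using R[OF that] by (auto simp: vball_iff)
    then have "vge (min R (val a)) (y - a)" "vge (min R (val a)) a" by (auto simp: vge_def)
    from vge_add[OF this] show "y \<in> vball 0 (min R (val a))" by (simp add: vball_iff)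
  qed
  have "good (left_translation (nbar a) f) (\<lambda>k. ?\<alpha> ` S k) \<and>
    (\<forall>k. approx (left_translation (nbar a) f) (?\<alpha> ` S k) = left_translation (nbar (\<iota> a)) (approx f (S k)))"
    using bd by (intro conjI allI g) (auto simp: F.lt_nbar_at E.lt_nbar_ballfun ext_add vball_iff algebra_simps)
  then show ?thesis by (intro exI[of _ "\<lambda>k. ?\<alpha> ` S k"])
qed

text \<open>The relation t = 2 s - 1/2 enters here: the exponent s + 1/2 in the larger field becomes
  2 s + 1 = (t + 1/2) + 1 in the smaller one. The surplus factor |a| is the change of the weight
  \<open>om\<close> under dilation.\<close>

lemma tw_match: "a \<noteq> 0 \<Longrightarrow> E.tw (s + 1/2) (\<iota> a) = F.tw (t + 1/2) a * of_real (absval a)"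
proof -
  assume a: "a \<noteq> 0"
  have "absval (\<iota> a) powr (s + 1/2) = absval a powr (t + 1/2) * absval a powr 1"
    unfolding absval_ext_powr[OF a] powr_add[symmetric] t by (simp add: algebra_simps)
  then show ?thesis using a absval_pos[OF a] by (simp add: E.tw_def F.tw_def E_ch_ext)
qed

lemma absval_qq: "a \<noteq> 0 \<Longrightarrow> absval a = resq TYPE('f) powr (- real_of_int (val a))" for a :: 'f
  by (rule absval_eq)

lemma good_diag:
  assumes S: "good f S" and a: "a \<noteq> 0"
  shows "\<exists>S'. good (left_translation (borel_elt a 0) f) S' \<and>
    (\<forall>k. approx (left_translation (borel_elt a 0) f) (S' k) = left_translation (borel_elt (\<iota> a) 0) (approx f (S k)))"
proof -
  let ?\<alpha> = "\<lambda>p. (fst p / a, snd p - val a)"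
  obtain R where R: "\<And>k p. p \<in> S k \<Longrightarrow> pball p \<subseteq> vball 0 R" using S unfolding good_def by meson
  have inj: "inj_on ?\<alpha> (S k)" for k using a by (auto simp: inj_on_def prod_eq_iff)
  have f: "f \<in> F.indsp t" using S by (simp add: good_def VF_def)
  note g = good_translate[OF S inj, where Q = "\<lambda>_. True" and \<beta> = "\<lambda>y. a * y" and \<nu> = "\<lambda>_. F.tw (t + 1/2) a"
      and e = "\<lambda>_. E.tw (s + 1/2) (\<iota> a)"
      and g = "borel_elt a 0" and g' = "borel_elt (\<iota> a) 0" and \<kappa> = "F.ch a" and R' = "R - val a" and d = "val a"]
  have ball: "y \<in> pball (?\<alpha> p) \<longleftrightarrow> a * y \<in> pball p" for y p
  proof -
    have "a * y - fst p = a * (y - fst p / a)" using a by (simp add: right_diff_distrib)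
    then show ?thesis using a by (simp add: vball_iff vge_times_iff)
  qed
  have bd: "pball (?\<alpha> p) \<subseteq> vball 0 (R - val a)" if "p \<in> S k" for k p
  proof
    fix y assume "y \<in> pball (?\<alpha> p)"
    then have "vge R (a * y)" using R[OF that] unfolding ball by (auto simp: vball_iff)
    then show "y \<in> vball 0 (R - val a)" using a by (simp add: vball_iff vge_times_iff)
  qed
  have E: "left_translation (borel_elt (\<iota> a) 0) (E.ballfun (s + 1/2) (\<iota> (fst p)) (ram * snd p)) =
        (\<lambda>h. E.tw (s + 1/2) (\<iota> a) * E.ballfun (s + 1/2) (\<iota> (fst (?\<alpha> p))) (ram * snd (?\<alpha> p)) h)" for p
    using E.lt_diag_ballfun[of "\<iota> a"] a by (simp add: ext_divide val_ext right_diff_distrib)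
  have match: "E.tw (s + 1/2) (\<iota> a) * of_real (om (snd p)) = F.tw (t + 1/2) a * of_real (om (snd (?\<alpha> p)))" for p
    using a by (simp add: tw_match om_shift absval_qq)
  \<comment> \<open>At t = 1/2 the translation factor contains |a| to the first power, which cancels
    the change of volume and leaves the sign \<open>F.ch a\<close>.\<close>
  have mean: "F.tw (t + 1/2) a * of_real (volball dF (snd (?\<alpha> p))) = F.ch a * of_real (volball dF (snd p))" if Z for p
  proof -
    have "t + 1/2 = 1" using Zs[OF that] t by simp
    then have "F.tw (t + 1/2) a = F.ch a * of_real (resq TYPE('f) powr (- real_of_int (val a)))"
      using a absval_pos[OF a] by (simp add: F.tw_def absval_qq)
    moreover have "resq TYPE('f) powr (- real_of_int (val a)) * resq TYPE('f) powr (real_of_int (val a)) = 1"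
      using qgt by (simp flip: powr_add)
    ultimately show ?thesis by (simp add: volball_shift flip: of_real_mult)
  qed
  have "good (left_translation (borel_elt a 0) f) (\<lambda>k. ?\<alpha> ` S k) \<and>
    (\<forall>k. approx (left_translation (borel_elt a 0) f) (?\<alpha> ` S k) = left_translation (borel_elt (\<iota> a) 0) (approx f (S k)))"
    using a by (intro conjI allI g) (simp_all only: ball E match mean F.lt_diag_at[OF f a] bd, simp_all)
  then show ?thesis by (intro exI[of _ "\<lambda>k. ?\<alpha> ` S k"])
qed

text \<open>The translate is locally constant at 0, and at points near 0 it is a multiple of a value
  of f far out, where f vanishes.\<close>

lemma lt_weyl_vanishes_at_0:
  assumes f: "f \<in> F.indsp t" and R: "\<And>y. y \<notin> vball 0 R \<Longrightarrow> f (nbar y) = 0"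
  shows "left_translation weyl f (nbar 0) = 0"
proof -
  obtain n where n: "\<And>y. y \<in> vball 0 n \<Longrightarrow> left_translation weyl f (nbar y) = left_translation weyl f (nbar 0)"
    using F.indsp_nbar_locally_constant[OF F.indsp_left_translation[OF f], of 0] by blast
  \<comment> \<open>Valuation at least n puts y where the translate is constant; valuation at least
    1 - R puts its inverse outside the ball that carries f.\<close>
  obtain y :: 'f where y: "y \<noteq> 0" "val y = max n (1 - R)" using exists_val by blast
  have "left_translation weyl f (nbar y) = 0"
    unfolding F.lt_weyl_at[OF f y(1)] using y by (subst R) (auto simp: vball_iff vge_def val_inverse)
  moreover have "y \<in> vball 0 n" using y by (auto simp: vball_iff vge_def)
  ultimately show ?thesis using n by metis
qed

text \<open>Inversion is controlled only away from 0. Centres of valuation below L and exponents of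
  at least L keep 0 out of every ball, confine the images to \<open>vball 0 (- L)\<close> and lower
  exponents by less than 2 L, so that the mesh still tends to 0.\<close>

lemma good_weyl:
  assumes S: "good f S" and L: "\<And>k p. p \<in> S k \<Longrightarrow> fst p \<notin> vball 0 L" "\<And>k p. p \<in> S k \<Longrightarrow> L \<le> snd p"
  shows "\<exists>S'. good (left_translation weyl f) S' \<and>
    (\<forall>k. approx (left_translation weyl f) (S' k) = left_translation weyl (approx f (S k)))"
proof -
  let ?\<alpha> = "\<lambda>p. (inverse (fst p), snd p - 2 * val (fst p))"
  obtain R where R: "\<And>k p. p \<in> S k \<Longrightarrow> pball p \<subseteq> vball 0 R" using S unfolding good_def by meson
  have f: "f \<in> F.indsp t" using S by (simp add: good_def VF_def)
  have p0: "fst p \<noteq> 0" "val (fst p) < L" if "p \<in> S k" for k p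
    using L(1)[OF that] by (auto simp: vball_iff vge_def)
  have nz: "0 \<notin> pball p" if "p \<in> S k" for k p
    using p0[OF that] L(2)[OF that] by (auto simp: vball_iff vge_def)
  have inj: "inj_on ?\<alpha> (S k)" for k by (auto simp: inj_on_def prod_eq_iff)
  let ?\<nu> = "\<lambda>y. F.ch (-1) * of_real (absval y powr (- (2 * t + 1)))"
  let ?e = "\<lambda>p. F.ch (-1) * of_real (absval (\<iota> (fst p)) powr (2 * (s + 1/2)))"
  note g = good_translate[OF S inj, where Q = "\<lambda>y. y \<noteq> 0" and \<beta> = inverse and \<nu> = ?\<nu> and e = ?e
      and g = weyl and g' = weyl and \<kappa> = "F.ch (-1)" and R' = "- L" and d = "2 * L"]
  have ball: "y \<in> pball (?\<alpha> p) \<longleftrightarrow> y \<noteq> 0 \<and> inverse y \<in> pball p" if "p \<in> S k" for k y p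
    using F.vball_inverse[OF nz[OF that], of y] by simp
  have valp: "y \<noteq> 0 \<and> val y = - val (fst p)" if p: "p \<in> S k" and y: "y \<in> pball (?\<alpha> p)" for k p y
  proof -
    have y': "y \<noteq> 0" "inverse y \<in> pball p" using ball[OF p] y by auto
    then have "val (inverse y) = val (fst p)" using F.val_vball[OF nz[OF p]] by blast
    then show ?thesis using y' by (simp add: val_inverse)
  qed
  have bd: "pball (?\<alpha> p) \<subseteq> vball 0 (- L)" if "p \<in> S k" for k p
  proof
    fix y assume "y \<in> pball (?\<alpha> p)"
    then have "val y = - val (fst p)" using valp[OF that] by blast
    then show "y \<in> vball 0 (- L)" using p0(2)[OF that] by (simp add: vball_iff vge_def)
  qed
  have const: "?\<nu> y = ?\<nu> (fst (?\<alpha> p))" if "p \<in> S k" "y \<in> pball (?\<alpha> p)" for k p y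
    using valp[OF that] p0[OF that(1)] by (simp add: absval_eq val_inverse)
  have off: "left_translation weyl f (nbar y) = 0" if "\<not> y \<noteq> 0" for y
  proof -
    have "f (nbar y) = 0" if "y \<notin> vball 0 R" for y
    proof -
      have "sys f (S 0)" using S by (simp add: good_def)
      from sysD(5)[OF this] show ?thesis using R that by blast
    qed
    then show ?thesis using lt_weyl_vanishes_at_0[OF f] that by blast
  qed
  have E: "left_translation weyl (E.ballfun (s + 1/2) (\<iota> (fst p)) (ram * snd p)) =
        (\<lambda>h. ?e p * E.ballfun (s + 1/2) (\<iota> (fst (?\<alpha> p))) (ram * snd (?\<alpha> p)) h)" if p: "p \<in> S k" for k p
  proof -
    have "0 \<notin> vball (\<iota> (fst p)) (ram * snd p)" using nz[OF p] ext_vball_iff[of 0] by simp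
    moreover have "E.ch (-1) = F.ch (-1)" using E_ch_ext[of "-1"] by (simp add: ext_minus)
    ultimately show ?thesis using p0[OF p]
      by (simp add: E.lt_weyl_ballfun ext_inverse val_ext right_diff_distrib mult.left_commute)
  qed
  have abs: "absval (fst p) powr 2 = resq TYPE('f) powr (- real_of_int (2 * val (fst p)))" if "p \<in> S k" for k p
    using p0[OF that] by (simp add: absval_powr mult.commute)
  have nu: "?\<nu> (fst (?\<alpha> p)) = F.ch (-1) * of_real (absval (fst p) powr (2 * t + 1))" if "p \<in> S k" for k p
    using p0[OF that] by (simp add: absval_powr val_inverse algebra_simps)
  \<comment> \<open>Since 2 (2 s + 1) = (2 t + 1) + 2, the surplus is |x|^2 at the centre x, which
    is the ratio of the weights \<open>om\<close> at the exponents n - 2 val x and n.\<close>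
  have match: "?e p * of_real (om (snd p)) = ?\<nu> (fst (?\<alpha> p)) * of_real (om (snd (?\<alpha> p)))" if p: "p \<in> S k" for k p
  proof -
    have "absval (\<iota> (fst p)) powr (2 * (s + 1/2)) = absval (fst p) powr (2 * t + 1) * absval (fst p) powr 2"
      unfolding absval_ext_powr[OF p0(1)[OF p]] powr_add[symmetric] t by (simp add: algebra_simps)
    then show ?thesis unfolding nu[OF p] by (simp add: om_shift abs[OF p])
  qed
  have mean: "?\<nu> (fst (?\<alpha> p)) * of_real (volball dF (snd (?\<alpha> p))) = F.ch (-1) * of_real (volball dF (snd p))"
    if Z and p: "p \<in> S k" for k p
  proof -
    have "2 * t + 1 = 2" using Zs[OF \<open>Z\<close>] t by simp
    moreover have "resq TYPE('f) powr (- real_of_int (2 * val (fst p))) * resq TYPE('f) powr (real_of_int (2 * val (fst p))) = 1"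
      using qgt by (simp flip: powr_add)
    ultimately show ?thesis unfolding nu[OF p] by (simp add: abs[OF p] volball_shift flip: of_real_mult)
  qed
  have mesh: "snd p - 2 * L \<le> snd (?\<alpha> p)" if "p \<in> S k" for k p using p0[OF that] by simp
  have "good (left_translation weyl f) (\<lambda>k. ?\<alpha> ` S k)"
    by (rule g(1)[OF ball F.lt_weyl_at[OF f] off const _ E match mean bd mesh]) auto
  moreover have "approx (left_translation weyl f) (?\<alpha> ` S k) = left_translation weyl (approx f (S k))" for k
    by (rule g(2)[OF ball F.lt_weyl_at[OF f] off const _ E match mean bd mesh]) auto
  ultimately show ?thesis by (intro exI[of _ "\<lambda>k. ?\<alpha> ` S k"]) blast
qed

text \<open>The balls of one exponent filling \<open>vball 0 R\<close>, without those centred in K,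
  on which f is 0. From n0 on f is constant on each ball; n0 is at least R so that the subdivision
  exists, and at least L to give the bound on exponents.\<close>

lemma systems_exist:
  assumes f: "f \<in> F.indsp t" and supp: "\<forall>y. y \<notin> vball 0 R \<longrightarrow> f (nbar y) = 0"
    and K: "K = {} \<or> K = vball 0 L" and fK: "\<forall>y\<in>K. f (nbar y) = 0"
  shows "\<exists>S :: nat \<Rightarrow> ('f \<times> int) set. (\<forall>k. sys f (S k)) \<and> (\<forall>k. \<forall>p\<in>S k. pball p \<subseteq> vball 0 R) \<and>
    (\<forall>N. \<exists>k0. \<forall>k\<ge>k0. \<forall>p\<in>S k. N \<le> snd p) \<and> (\<forall>k. \<forall>p\<in>S k. fst p \<notin> K \<and> L \<le> snd p)"
proof -
  obtain n1 where n1: "\<And>n x y. n1 \<le> n \<Longrightarrow> y \<in> vball x n \<Longrightarrow> f (nbar y) = f (nbar x)"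
    using F.indsp_uniform[OF f supp[rule_format]] by metis
  define n0 where "n0 = max n1 (max R L)"
  have "\<exists>r::'f set. vreps 0 R (n0 + int k) r" for k
    by (rule vreps_exists) (auto simp: n0_def)
  then obtain r :: "nat \<Rightarrow> 'f set" where r: "\<And>k. vreps 0 R (n0 + int k) (r k)" by metis
  define S where "S k = (\<lambda>x. (x, n0 + int k)) ` (r k - K)" for k
  have S: "p \<in> S k \<longleftrightarrow> snd p = n0 + int k \<and> fst p \<in> r k - K" for p k
    by (cases p) (auto simp: S_def)
  have 1: "sys f (S k)" for k
    unfolding sys_def
  proof (intro conjI ballI allI impI)
    show "finite (S k)" using vrepsD(1)[OF r[of k]] by (simp add: S_def)
    have "pball p \<inter> pball p' = {}" if "p \<in> S k" "p' \<in> S k" "p \<noteq> p'" for p p'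
    proof -
      have "fst p \<noteq> fst p'" using that by (auto simp: S prod_eq_iff)
      then show ?thesis using vreps_disjoint[OF r[of k]] that by (simp add: S disjoint_family_on_def)
    qed
    then show "disjoint_family_on pball (S k)" unfolding disjoint_family_on_def by simp
    show "f (nbar y) = f (nbar (fst p))" if "p \<in> S k" "y \<in> pball p" for p y
      using that n1[of "n0 + int k" y "fst p"] by (simp add: S n0_def)
    show "f (nbar y) = 0" if y: "\<forall>p\<in>S k. y \<notin> pball p" for y
    proof (cases "y \<in> vball 0 R")
      case True
      then obtain x where x: "x \<in> r k" "y \<in> vball x (n0 + int k)" using vrepsD(3)[OF r[of k]] by blast
      have "x \<in> K"
      proof (rule ccontr)
        assume "x \<notin> K"
        then have "(x, n0 + int k) \<in> S k" using x by (simp add: S)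
        then show False using y x by auto
      qed
      moreover have "f (nbar y) = f (nbar x)" using x n1[of "n0 + int k" y x] by (simp add: n0_def)
      ultimately show ?thesis using fK by simp
    qed (use supp in blast)
  qed
  have 2: "pball p \<subseteq> vball 0 R" if "p \<in> S k" for k p
  proof (rule vball_subset)
    show "fst p \<in> vball 0 R" using vrepsD(2)[OF r[of k]] that by (auto simp: S)
    show "R \<le> snd p" using that by (auto simp: S n0_def)
  qed
  have 3: "\<exists>k0. \<forall>k\<ge>k0. \<forall>p\<in>S k. N \<le> snd p" for N
    by (intro exI[of _ "nat (N - n0)"]) (auto simp: S)
  have 4: "\<forall>k. \<forall>p\<in>S k. fst p \<notin> K \<and> L \<le> snd p" by (auto simp: S n0_def)
  show ?thesis
    by (rule exI[of _ S], intro conjI allI ballI) (use 1 2 3 4 in blast)+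
qed

lemma good_exists:
  assumes f: "f \<in> VF" and supp: "\<And>y. y \<notin> vball 0 R \<Longrightarrow> f (nbar y) = 0"
    and K: "K = {} \<or> K = vball 0 L" and fK: "\<And>y. y \<in> K \<Longrightarrow> f (nbar y) = 0"
  shows "\<exists>S. good f S \<and> (\<forall>k. \<forall>p\<in>S k. fst p \<notin> K \<and> L \<le> snd p)"
proof -
  have supp': "\<forall>y. y \<notin> vball 0 R \<longrightarrow> f (nbar y) = 0" using supp by blast
  have fK': "\<forall>y\<in>K. f (nbar y) = 0" using fK by blast
  obtain S :: "nat \<Rightarrow> ('f \<times> int) set" where S: "\<forall>k. sys f (S k)" "\<forall>k. \<forall>p\<in>S k. pball p \<subseteq> vball 0 R"
    "\<forall>N. \<exists>k0. \<forall>k\<ge>k0. \<forall>p\<in>S k. N \<le> snd p" "\<forall>k. \<forall>p\<in>S k. fst p \<notin> K \<and> L \<le> snd p"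
    using systems_exist[OF VFD(1)[OF f] supp' K fK'] by (elim exE conjE) (rule that)
  then have "good f S" unfolding good_def using f by blast
  then show ?thesis using S(4) by blast
qed

lemma compact_support_integrable:
  assumes f: "f \<in> F.indsp t" and supp: "\<And>y. y \<notin> vball 0 R \<Longrightarrow> f (nbar y) = 0"
  shows "integrable dF (\<lambda>y. f (nbar y))"
proof -
  have supp': "\<forall>y. y \<notin> vball 0 R \<longrightarrow> f (nbar y) = 0" using supp by blast
  obtain S :: "nat \<Rightarrow> ('f \<times> int) set" where "\<forall>k. sys f (S k)"
    using systems_exist[OF f supp', of "{}" 0] by auto
  then have "sys f (S 0)" ..
  then show ?thesis by (rule sys_integrable)
qed

end

section \<open>Density and the intertwining isometry\<close>

lemma sum_two: "a \<noteq> b \<Longrightarrow> sum h {a, b} = h a + h b"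
  by simp

context restr begin

text \<open>The coefficients of \<open>spike\<close> as a function on pairs of centre and exponent,
  the index type for which the ball formula \<open>formF\<close> is assumed.\<close>

definition corr :: "nat \<Rightarrow> 'f \<times> int \<Rightarrow> complex" where
  "corr m p = (if fst p = 0 then 1 else - of_real (volball dF (int m) / volball dF 1))"

text \<open>A small ball at 0, corrected by a fixed ball to have mean zero. Its norm tends to 0 since
  points have capacity zero, so functions can be cut off at 0, and at infinity by symmetry.\<close>

definition spike :: "nat \<Rightarrow> 'f pgl2 \<Rightarrow> complex" where
  "spike m = (\<lambda>g. F.ballfun (t + 1/2) 0 (int m) g
     + (- of_real (volball dF (int m) / volball dF 1)) * F.ballfun (t + 1/2) 1 1 g)"

lemma spike_nbar: "spike m (nbar y) = (\<Sum>p\<in>{(0, int m), (1, 1)}. corr m p * indicator (pball p) y)"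
  by (subst sum_two) (simp_all add: spike_def corr_def)

lemma spike_indsp: "spike m \<in> F.indsp t"
  unfolding spike_def by (intro F.indsp_add F.indsp_cmult F.ballfun_indsp)

lemma spike_integrable: "integrable dF (\<lambda>y. spike m (nbar y))"
  unfolding spike_def F.ballfun_nbar
  by (intro Bochner_Integration.integrable_add integrable_mult_right vball_complex_integral[OF dF])

lemma spike_mean: "(LINT y|dF. spike m (nbar y)) = 0"
  unfolding haar_integral_balls[OF dF spike_nbar]
  using volball_pos[OF dF, of 1] by (subst sum_two) (simp_all add: corr_def)

lemma spike_VF: "spike m \<in> VF"
  by (simp add: VF_def spike_indsp spike_mean)

text \<open>From m = 1 on, the ball at 0 misses the correcting ball around 1.\<close>

lemma spike_near_0: assumes "m \<ge> 1" "y \<in> vball 0 (int m)" shows "spike m (nbar y) = 1"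
proof -
  have "y \<notin> vball 1 1"
  proof
    assume "y \<in> vball 1 1"
    then have "vge 1 (y - 1)" by (simp add: vball_iff)
    moreover have "vge 1 y" using assms by (auto simp: vball_iff intro: vge_mono)
    ultimately have "vge 1 (y - (y - 1))" by (rule vge_diff[rotated])
    then show False by (simp add: vge_def)
  qed
  then show ?thesis using assms by (simp add: spike_def)
qed

lemma spike_supp: "y \<notin> vball 0 0 \<Longrightarrow> spike m (nbar y) = 0"
proof -
  assume y: "y \<notin> vball 0 0"
  have "vball 1 1 \<subseteq> vball (0::'f) 0" by (rule vball_subset) (auto simp: vball_iff vge_def)
  then have "y \<notin> vball 1 1" using y by blast
  moreover have "y \<notin> vball 0 (int m)" using y vball_mono[of 0 "int m" "0::'f"] by auto
  ultimately show ?thesis by (simp add: spike_def)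
qed

lemma volball_sq_lim: "(\<lambda>m. (volball dF (int m))\<^sup>2) \<longlonglongrightarrow> 0"
proof -
  let ?q = "resq TYPE('f)"
  have "(volball dF (int m))\<^sup>2 = (volball dF 0)\<^sup>2 * (1 / ?q\<^sup>2) ^ m" for m
  proof -
    have "?q powr (- real m) = (1 / ?q) ^ m"
      using qgt by (simp add: powr_minus powr_realpow power_one_over inverse_eq_divide)
    then show ?thesis
      by (simp add: volball_eq[OF dF, of "int m"] power_mult_distrib power_divide flip: power_mult)
        (simp add: mult.commute)
  qed
  moreover have "(\<lambda>m. (volball dF 0)\<^sup>2 * (1 / ?q\<^sup>2) ^ m) \<longlonglongrightarrow> (volball dF 0)\<^sup>2 * 0"
    using qgt by (intro tendsto_mult tendsto_const LIMSEQ_power_zero) (simp add: power_gt1_lemma)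
  ultimately show ?thesis by simp
qed

lemma spike_form:
  assumes m: "m \<ge> 1"
  shows "BF (spike m) (spike m) = of_real ((volball dF (int m))\<^sup>2 * (kbF (int m) - 2 * kF 0 + kbF 1))"
proof -
  have "BF (spike m) (spike m) = (\<Sum>i\<in>{(0, int m), (1, 1)}. \<Sum>j\<in>{(0, int m), (1, 1)}. corr m i * cnj (corr m j) *
     of_real (volball dF (snd i) * volball dF (snd j) * bkern kF kbF (fst i) (snd i) (fst j) (snd j)))"
    by (intro formF spike_nbar VFD spike_VF) auto
  moreover have "bkern kF kbF (0::'f) (int m) 1 1 = kF 0" "bkern kF kbF (1::'f) 1 0 (int m) = kF 0"
    using m by (auto simp: bkern_def vball_iff vge_def)
  moreover have "bkern kF kbF (0::'f) (int m) 0 (int m) = kbF (int m)" "bkern kF kbF (1::'f) 1 1 1 = kbF 1"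
    by (simp_all add: bkern_def)
  moreover have "(0::'f, int m) \<noteq> (1, 1)" by simp
  ultimately show ?thesis using volball_pos[OF dF, of 1]
    by (simp only: sum_two) (simp add: corr_def power2_eq_square field_simps)
qed

text \<open>The energy of the small ball tends to 0 by \<open>kb_lim\<close>, and the cross terms
  and the energy of the correcting ball carry the squared volume as a factor.\<close>

lemma spike_form_lim: "(\<lambda>m. Re (BF (spike (Suc m)) (spike (Suc m)))) \<longlonglongrightarrow> 0"
proof -
  have "(\<lambda>m. (volball dF (int m))\<^sup>2 * kbF (int m) + (volball dF (int m))\<^sup>2 * (kbF 1 - 2 * kF 0)) \<longlonglongrightarrow> 0 + 0 * (kbF 1 - 2 * kF 0)"
    by (intro tendsto_add tendsto_mult kb_lim volball_sq_lim tendsto_const)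
  from LIMSEQ_Suc[OF this] show ?thesis
    by (simp add: spike_form algebra_simps del: of_nat_Suc)
qed

text \<open>At t = 1/2 induced functions transform like densities, so inversion preserves integrals
  up to the sign \<open>F.ch (-1)\<close>. Here the translate is this sign times |y|^(-2) far out
  and 0 elsewhere, and the series over outward shells is geometric of ratio 1/q.\<close>

lemma weyl_ballfun_integral:
  assumes "t = 1/2"
  shows "integrable dF (\<lambda>y. left_translation weyl (F.ballfun (t + 1/2) 0 (int m)) (nbar y))"
    "(LINT y|dF. left_translation weyl (F.ballfun (t + 1/2) 0 (int m)) (nbar y)) = F.ch (-1) * of_real (volball dF (int m))"
proof -
  let ?q = "resq TYPE('f)"
  let ?v = "\<lambda>i::nat. - int m - int i"
  let ?h = "\<lambda>v. ?q powr (2 * real_of_int v)"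
  let ?f = "\<lambda>y::'f. if y \<noteq> 0 \<and> val y \<in> range ?v then ?h (val y) else 0"
  let ?V = "volball dF (int m)"
  have eq: "left_translation weyl (F.ballfun (t + 1/2) 0 (int m)) (nbar y) = F.ch (-1) * of_real (?f y)" for y
  proof (cases "y = 0")
    case True
    have "left_translation weyl (F.ballfun (t + 1/2) 0 (int m)) (nbar 0) = 0"
      by (rule lt_weyl_vanishes_at_0[OF F.ballfun_indsp, of "int m"]) simp
    then show ?thesis using True by simp
  next
    case False
    have "inverse y \<in> vball 0 (int m) \<longleftrightarrow> int m \<le> - val y"
      using False by (simp add: vball_iff vge_def val_inverse)
    also have "\<dots> \<longleftrightarrow> val y \<in> range ?v"
    proof
      assume "int m \<le> - val y"
      then show "val y \<in> range ?v" by (intro image_eqI[of _ _ "nat (- val y - int m)"]) auto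
    qed auto
    finally have "inverse y \<in> vball 0 (int m) \<longleftrightarrow> val y \<in> range ?v" .
    moreover have "absval y powr (- (2 * t + 1)) = ?h (val y)"
      unfolding absval_powr[OF False] assms by (simp add: mult.commute)
    ultimately show ?thesis
      using False by (simp add: F.lt_weyl_at[OF F.ballfun_indsp] indicator_def)
  qed
  have trm: "?h (?v i) * volball dF (?v i) = ?V * (1 / ?q) ^ i" for i
  proof -
    have "(1 / ?q) ^ i = ?q powr (- real i)"
      using qgt by (simp add: powr_minus powr_realpow power_one_over inverse_eq_divide)
    then show ?thesis unfolding volball_eq[OF dF, of "?v i"] volball_eq[OF dF, of "int m"]
      by (simp add: powr_add[symmetric] algebra_simps)
  qed
  have gs: "(\<lambda>i. ?V * (1 / ?q) ^ i) sums (?V * (1 / (1 - 1 / ?q)))"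
    using geometric_sums[of "1 / ?q"] qgt by (intro sums_mult) auto
  have inj: "inj ?v" by (auto simp: inj_def)
  have sum: "summable (\<lambda>i. \<bar>?h (?v i)\<bar> * volball dF (?v i))"
    using sums_summable[OF gs] by (simp only: abs_of_nonneg[OF powr_ge_zero] trm)
  note sh = shell_integral[OF dF inj, of ?h, OF sum, of ?f, OF refl]
  have trm': "?h (?v i) * ((1 - 1 / ?q) * volball dF (?v i)) = (1 - 1 / ?q) * (?V * (1 / ?q) ^ i)" for i
    unfolding trm[symmetric] by (simp only: mult_ac)
  have "(\<lambda>i. ?h (?v i) * ((1 - 1 / ?q) * volball dF (?v i))) sums ((1 - 1 / ?q) * (?V * (1 / (1 - 1 / ?q))))"
    unfolding trm' by (rule sums_mult[OF gs])
  moreover have "(1 - 1 / ?q) * (?V * (1 / (1 - 1 / ?q))) = ?V" using qgt by (simp add: field_simps)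
  ultimately have I: "integral\<^sup>L dF ?f = ?V" using sums_unique2[OF sh(2)] by simp
  show "integrable dF (\<lambda>y. left_translation weyl (F.ballfun (t + 1/2) 0 (int m)) (nbar y))"
    unfolding eq by (intro integrable_mult_right integrable_of_real sh(1))
  show "(LINT y|dF. left_translation weyl (F.ballfun (t + 1/2) 0 (int m)) (nbar y)) = F.ch (-1) * of_real ?V"
    unfolding eq integral_mult_right_zero integral_complex_of_real I ..
qed

lemma weyl_spike: "left_translation weyl (spike m) = (\<lambda>g. left_translation weyl (F.ballfun (t + 1/2) 0 (int m)) g
     + (- of_real (volball dF (int m) / volball dF 1)) * (F.ch (-1) * F.ballfun (t + 1/2) 1 1 g))"
proof -
  have "0 \<notin> vball (1::'f) 1" by (simp add: vball_iff vge_def)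
  moreover have "absval (1::'f) = 1" using qgt by (simp add: absval_eq)
  ultimately have "left_translation weyl (F.ballfun (t + 1/2) 1 1) g = F.ch (-1) * F.ballfun (t + 1/2) 1 1 g" for g
    using F.lt_weyl_ballfun[of 1 1 "t + 1/2"] by simp
  then show ?thesis by (intro ext) (simp add: left_translation_def spike_def)
qed

lemma weyl_spike_mean:
  assumes "t = 1/2"
  shows "integrable dF (\<lambda>y. left_translation weyl (spike m) (nbar y))"
    "(LINT y|dF. left_translation weyl (spike m) (nbar y)) = 0"
proof -
  have i: "integrable dF (\<lambda>y. (- of_real (volball dF (int m) / volball dF 1)) * (F.ch (-1) * F.ballfun (t + 1/2) 1 1 (nbar y)))"
    unfolding F.ballfun_nbar by (intro integrable_mult_right vball_complex_integral[OF dF])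
  show "integrable dF (\<lambda>y. left_translation weyl (spike m) (nbar y))"
    unfolding weyl_spike by (intro Bochner_Integration.integrable_add i weyl_ballfun_integral[OF assms])
  have "(LINT y|dF. left_translation weyl (spike m) (nbar y)) =
      F.ch (-1) * of_real (volball dF (int m)) +
      (LINT y|dF. (- of_real (volball dF (int m) / volball dF 1)) * (F.ch (-1) * F.ballfun (t + 1/2) 1 1 (nbar y)))"
    unfolding weyl_spike Bochner_Integration.integral_add[OF weyl_ballfun_integral(1)[OF assms] i]
      weyl_ballfun_integral(2)[OF assms] ..
  also have "(LINT y|dF. (- of_real (volball dF (int m) / volball dF 1)) * (F.ch (-1) * F.ballfun (t + 1/2) 1 1 (nbar y))) =
     (- of_real (volball dF (int m) / volball dF 1)) * (F.ch (-1) * of_real (volball dF 1))"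
    unfolding F.ballfun_nbar integral_mult_right_zero vball_complex_integral[OF dF] ..
  finally show "(LINT y|dF. left_translation weyl (spike m) (nbar y)) = 0"
    using volball_pos[OF dF, of 1] by simp
qed

lemma weyl_spike_VF: "left_translation weyl (spike m) \<in> VF"
proof -
  have "t = 1/2" if Z using Zs[OF that] t(1) by simp
  then show ?thesis
    unfolding VF_def using F.indsp_left_translation[OF spike_indsp] weyl_spike_mean(2) by blast
qed

section \<open>Dense subspaces\<close>

definition "Dcpt = {f \<in> VF. \<exists>R. \<forall>y. y \<notin> vball 0 R \<longrightarrow> f (nbar y) = 0}"
definition "Dcpt0 = {f \<in> Dcpt. \<exists>L. \<forall>y\<in>vball 0 L. f (nbar y) = 0}"

text \<open>\<open>spike\<close> is 1 near 0, so subtracting the value at 0 times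
  \<open>spike\<close> clears a neighbourhood of 0 without changing the mean.\<close>

lemma cut_at_0:
  assumes f: "f \<in> Dcpt"
  shows "\<exists>c m0. \<forall>m\<ge>m0. (\<lambda>g. f g + c * spike (Suc m) g) \<in> Dcpt0"
proof -
  obtain R where R: "\<And>y. y \<notin> vball 0 R \<Longrightarrow> f (nbar y) = 0" and fV: "f \<in> VF"
    using f unfolding Dcpt_def by blast
  obtain n where n: "\<And>y. y \<in> vball 0 n \<Longrightarrow> f (nbar y) = f (nbar 0)"
    using F.indsp_nbar_locally_constant[OF VFD(1)[OF fV]] by blast
  let ?c = "- f (nbar 0)"
  have "(\<lambda>g. f g + ?c * spike (Suc m) g) \<in> Dcpt0" if m: "nat n \<le> m" for m
  proof -
    let ?g = "\<lambda>g. f g + ?c * spike (Suc m) g"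
    have ind: "?g \<in> F.indsp t"
      by (intro F.indsp_add F.indsp_cmult spike_indsp VFD fV)
    have "(LINT y|dF. ?g (nbar y)) = (LINT y|dF. f (nbar y)) + ?c * (LINT y|dF. spike (Suc m) (nbar y))"
      using compact_support_integrable[OF VFD(1)[OF fV] R] spike_integrable[of "Suc m"]
      by simp
    then have V: "?g \<in> VF" using fV ind by (simp add: VF_def spike_mean)
    have "?g (nbar y) = 0" if "y \<notin> vball 0 (min R 0)" for y
    proof -
      have "y \<notin> vball 0 R" "y \<notin> vball 0 0"
        using that vball_mono[of "min R 0" R "0::'f"] vball_mono[of "min R 0" 0 "0::'f"] by auto
      then show ?thesis using R spike_supp by simp
    qed
    moreover have "?g (nbar y) = 0" if "y \<in> vball 0 (int (Suc m))" for y
    proof -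
      have "n \<le> int (Suc m)" using m by linarith
      then have "y \<in> vball 0 n" using that vball_mono[of n "int (Suc m)" "0::'f"] by blast
      then show ?thesis using n[of y] spike_near_0[of "Suc m" y] that by simp
    qed
    ultimately show ?thesis using V unfolding Dcpt0_def Dcpt_def by blast
  qed
  then show ?thesis by blast
qed

lemma lt_weyl_weyl: "left_translation weyl (left_translation weyl f) = f"
  for f :: "'f pgl2 \<Rightarrow> complex"
  by (rule ext) (simp add: left_translation_def inverse_weyl weyl_weyl flip: mult.assoc)

text \<open>The Weyl translate is corrected at 0 and transported back: a function vanishing near 0
  becomes one supported in a ball.\<close>

lemma cut_at_infinity:
  assumes f: "f \<in> VF"
  shows "\<exists>c m0. \<forall>m\<ge>m0. (\<lambda>g. f g + c * left_translation weyl (spike (Suc m)) g) \<in> Dcpt"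
proof -
  let ?f = "left_translation weyl f"
  have f': "?f \<in> F.indsp t" by (intro F.indsp_left_translation VFD f)
  obtain n where n: "\<And>y. y \<in> vball 0 n \<Longrightarrow> ?f (nbar y) = ?f (nbar 0)"
    using F.indsp_nbar_locally_constant[OF f'] by blast
  let ?c = "- ?f (nbar 0)"
  have "(\<lambda>g. f g + ?c * left_translation weyl (spike (Suc m)) g) \<in> Dcpt" if m: "nat n \<le> m" for m
  proof -
    let ?w = "left_translation weyl (spike (Suc m))"
    let ?g = "\<lambda>g. f g + ?c * ?w g"
    let ?h = "\<lambda>g. ?f g + ?c * spike (Suc m) g"
    have h: "?h \<in> F.indsp t" by (intro F.indsp_add F.indsp_cmult spike_indsp f')
    have ind: "?g \<in> F.indsp t" by (intro F.indsp_add F.indsp_cmult F.indsp_left_translation spike_indsp VFD f)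
    have eq: "?g = left_translation weyl ?h"
      using lt_weyl_weyl[of f] by (simp add: left_translation_def fun_eq_iff)
    have g: "?g (nbar y) = left_translation weyl ?h (nbar y)" for y
      using fun_cong[OF eq, of "nbar y"] .
    have h0: "?h (nbar y) = 0" if "y \<in> vball 0 (int (Suc m))" for y
    proof -
      have "n \<le> int (Suc m)" using m by linarith
      then have "y \<in> vball 0 n" using that vball_mono[of n "int (Suc m)" "0::'f"] by blast
      then show ?thesis using n[of y] spike_near_0[of "Suc m" y] that by simp
    qed
    have supp: "?g (nbar y) = 0" if "y \<notin> vball 0 (- int (Suc m))" for y
    proof -
      have y: "y \<noteq> 0" "val y < - int (Suc m)" using that by (auto simp: vball_iff vge_def)
      then have "inverse y \<in> vball 0 (int (Suc m))" by (simp add: vball_iff vge_def val_inverse)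
      from h0[OF this] have "left_translation weyl ?h (nbar y) = 0"
        unfolding F.lt_weyl_at[OF h y(1)] by (simp only: mult_zero_right)
      with g[of y] show ?thesis by (rule trans)
    qed
    have "(LINT y|dF. ?g (nbar y)) = 0" if Z
    proof -
      have t2: "t = 1/2" using Zs[OF that] t by simp
      have ig: "integrable dF (\<lambda>y. ?g (nbar y))" by (rule compact_support_integrable[OF ind supp])
      have iw: "integrable dF (\<lambda>y. - ?c * ?w (nbar y))"
        by (intro integrable_mult_right weyl_spike_mean t2)
      \<comment> \<open>Integrability is known for the compactly supported function and for the
        translated spike; f is recovered from these two.\<close>
      have "(LINT y|dF. f (nbar y)) = (LINT y|dF. ?g (nbar y) + (- ?c * ?w (nbar y)))"
      proof (rule Bochner_Integration.integral_cong[OF refl])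
        have "a = (a + b * c) + - b * c" for a b c :: complex by simp
        then show "f (nbar y) = ?g (nbar y) + (- ?c * ?w (nbar y))" for y .
      qed
      also have "\<dots> = (LINT y|dF. ?g (nbar y)) + (LINT y|dF. - ?c * ?w (nbar y))"
        by (rule Bochner_Integration.integral_add[OF ig iw])
      also have "(LINT y|dF. - ?c * ?w (nbar y)) = 0"
        unfolding integral_mult_right_zero weyl_spike_mean(2)[OF t2] by simp
      finally show ?thesis using VFD(2)[OF f that] by simp
    qed
    then have "?g \<in> VF" using ind unfolding VF_def by blast
    then show ?thesis using supp unfolding Dcpt_def by blast
  qed
  then show ?thesis by blast
qed

text \<open>The corrected functions lie in D and their images converge to j f; the shift by m0 skips
  the indices for which membership is not assumed.\<close>

lemma in_closure_by_correction:
  fixes j :: "('f pgl2 \<Rightarrow> complex) \<Rightarrow> 'h::complex_hilbert"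
  assumes f: "\<And>m. m \<ge> m0 \<Longrightarrow> (\<lambda>g. f g + c * r m g) \<in> D"
    and j: "\<And>m. j (\<lambda>g. f g + c * r m g) = j f + c *\<^sub>C j (r m)"
    and lim: "(\<lambda>m. norm (j (r m))) \<longlonglongrightarrow> 0"
  shows "j f \<in> closure (j ` D)"
  unfolding closure_sequential
proof (intro exI conjI allI)
  show "j (\<lambda>g. f g + c * r (m + m0) g) \<in> j ` D" for m by (intro imageI f) simp
  have "(\<lambda>m. j (r m)) \<longlonglongrightarrow> 0" using lim by (rule tendsto_norm_zero_cancel)
  then have "(\<lambda>m. j f + c *\<^sub>C j (r m)) \<longlonglongrightarrow> j f + c *\<^sub>C 0"
    by (intro tendsto_add tendsto_const tendsto_scaleC)
  moreover have "c *\<^sub>C (0::'h) = 0" using scaleC_diff_right[of c "0::'h" 0] by simp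
  ultimately have "(\<lambda>m. j (\<lambda>g. f g + c * r m g)) \<longlonglongrightarrow> j f" by (simp add: j)
  then show "(\<lambda>m. j (\<lambda>g. f g + c * r (m + m0) g)) \<longlonglongrightarrow> j f" by (rule LIMSEQ_ignore_initial_segment)
qed

lemma closure_mono_image: "j ` X \<subseteq> closure (j ` Y) \<Longrightarrow> closure (j ` X) \<subseteq> closure (j ` Y)"
  by (intro closure_minimal closed_closure)

section \<open>The embedding of groups and the intertwining map\<close>

lemma pgl2_map_mult: "pgl2_map \<iota> (g * h) = pgl2_map \<iota> g * pgl2_map \<iota> h"
proof -
  obtain A B where A: "invertible A" "g = pgl2_class A" and B: "invertible B" "h = pgl2_class B"
    using pgl2_class_surj by metis
  note c = pgl2_map_class[of \<iota>, OF ext_one ext_add ext_mult]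
  have m: "map_matrix \<iota> (A ** B) = map_matrix \<iota> A ** map_matrix \<iota> B"
    by (simp add: vec_eq_iff matrix_matrix_mult_def sum_2 ext_add ext_mult)
  have i: "invertible (map_matrix \<iota> A)" if "invertible A" for A :: "'f^2^2"
  proof -
    have "map_matrix \<iota> A $1$1 * map_matrix \<iota> A $2$2 - map_matrix \<iota> A $1$2 * map_matrix \<iota> A $2$1 =
        \<iota> (A$1$1 * A$2$2 - A$1$2 * A$2$1)"
      by (simp add: ext_diff ext_mult)
    then show ?thesis using that unfolding invertible_mat2_iff by simp
  qed
  show ?thesis
    using A B i invertible_mult[OF A(1) B(1)]
    by (simp add: pgl2_class_mult c m)
qed

lemma pgl2_map_m2:
  assumes "a * d - b * c \<noteq> 0"
  shows "pgl2_map \<iota> (pgl2_class (m2 a b c d)) = pgl2_class (m2 (\<iota> a) (\<iota> b) (\<iota> c) (\<iota> d))"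
proof -
  have "map_matrix \<iota> (m2 a b c d) = m2 (\<iota> a) (\<iota> b) (\<iota> c) (\<iota> d)"
    by (simp add: mat2_eq_iff)
  then show ?thesis using pgl2_map_class[of \<iota> "m2 a b c d", OF ext_one ext_add ext_mult] assms by simp
qed

lemma pgl2_map_nbar: "pgl2_map \<iota> (nbar a) = nbar (\<iota> a)"
  and pgl2_map_diag: "a \<noteq> 0 \<Longrightarrow> pgl2_map \<iota> (borel_elt a 0) = borel_elt (\<iota> a) 0"
  and pgl2_map_weyl: "pgl2_map \<iota> weyl = weyl"
  by (simp_all add: nbar_def borel_elt_def weyl_def pgl2_map_m2)

theorem restriction_contains:
  fixes \<rho> :: "'e pgl2 \<Rightarrow> 'h::complex_hilbert \<Rightarrow> 'h" and \<tau> :: "'f pgl2 \<Rightarrow> 'l::complex_hilbert \<Rightarrow> 'l"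
  assumes rho: "hilbert_completion VE BE \<rho>" and tau: "hilbert_completion VF BF \<tau>"
  shows "contains_direct_summand (\<lambda>g. \<rho> (pgl2_map \<iota> g)) \<tau>"
proof -
  obtain jE where urho: "unitary_rep \<rho>"
    and JE: "\<forall>f1\<in>VE. \<forall>f2\<in>VE. cinner (jE f1) (jE f2) = BE f1 f2"
      "\<forall>g. \<forall>f\<in>VE. \<rho> g (jE f) = jE (left_translation g f)"
    using rho unfolding hilbert_completion_def by (elim exE conjE) (rule that; assumption)
  note jE = JE[rule_format]
  obtain jF where utau: "unitary_rep \<tau>"
    and JF: "\<forall>f1\<in>VF. \<forall>f2\<in>VF. jF (\<lambda>g. f1 g + f2 g) = jF f1 + jF f2"
      "\<forall>c. \<forall>f\<in>VF. jF (\<lambda>g. c * f g) = c *\<^sub>C jF f"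
      "\<forall>f1\<in>VF. \<forall>f2\<in>VF. cinner (jF f1) (jF f2) = BF f1 f2"
      "closure (jF ` VF) = UNIV"
      "\<forall>g. \<forall>f\<in>VF. \<tau> g (jF f) = jF (left_translation g f)"
    using tau unfolding hilbert_completion_def by (elim exE conjE) (rule that; assumption)
  note jF = JF(1)[rule_format] JF(2)[rule_format] JF(3)[rule_format] JF(4) JF(5)[rule_format]
  have iso: "isometric_map (\<rho> g)" "isometric_map (\<tau> h)" for g h
    using urho utau by (simp_all add: unitary_rep_def)
  have mult: "\<rho> (g1 * g2) v = \<rho> g1 (\<rho> g2 v)" "\<tau> (h1 * h2) w = \<tau> h1 (\<tau> h2 w)" for g1 g2 h1 h2 v w
    using urho utau by (simp_all add: unitary_rep_def)
  have VF_cmult: "(\<lambda>g. c * f g) \<in> VF" if "f \<in> VF" for c f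
    using F.indsp_cmult[OF VFD(1)[OF that]] VFD(2)[OF that] by (simp add: VF_def)
  have jcomb: "jF (\<lambda>g. f g + c * r g) = jF f + c *\<^sub>C jF r" if "f \<in> VF" "r \<in> VF" for f c r
    using jF(1)[OF that(1) VF_cmult[OF that(2)]] jF(2)[OF that(2)] by simp

  have nlim: "(\<lambda>m. norm (jF (spike (Suc m)))) \<longlonglongrightarrow> 0"
  proof -
    have "(\<lambda>m. (norm (jF (spike (Suc m))))\<^sup>2) \<longlonglongrightarrow> 0"
      using spike_form_lim by (simp add: norm_sq_cinner jF(3) spike_VF)
    from tendsto_real_sqrt[OF this] show ?thesis by simp
  qed
  \<comment> \<open>The Weyl element acts isometrically, so a correction at infinity costs as little
    as one at 0.\<close>
  have nlim': "(\<lambda>m. norm (jF (left_translation weyl (spike (Suc m))))) \<longlonglongrightarrow> 0"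
  proof -
    have "norm (\<tau> weyl v) = norm v" for v
    proof -
      have "(norm (\<tau> weyl v))\<^sup>2 = (norm v)\<^sup>2"
        using iso(2)[of weyl] by (simp add: norm_sq_cinner isometric_map_def)
      then show ?thesis by simp
    qed
    then show ?thesis using nlim by (simp add: jF(5)[OF spike_VF, symmetric])
  qed
  have dense1: "jF ` Dcpt \<subseteq> closure (jF ` Dcpt0)"
  proof
    fix v assume "v \<in> jF ` Dcpt"
    then obtain f where f: "f \<in> Dcpt" "v = jF f" by blast
    obtain c m0 where cm: "\<And>m. m \<ge> m0 \<Longrightarrow> (\<lambda>g. f g + c * spike (Suc m) g) \<in> Dcpt0"
      using cut_at_0[OF f(1)] by blast
    have "f \<in> VF" using f(1) by (simp add: Dcpt_def)
    then show "v \<in> closure (jF ` Dcpt0)" unfolding f(2)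
      by (intro in_closure_by_correction[OF cm jcomb nlim] spike_VF)
  qed
  have dense2: "jF ` VF \<subseteq> closure (jF ` Dcpt)"
  proof
    fix v assume "v \<in> jF ` VF"
    then obtain f where f: "f \<in> VF" "v = jF f" by blast
    obtain c m0 where cm: "\<And>m. m \<ge> m0 \<Longrightarrow> (\<lambda>g. f g + c * left_translation weyl (spike (Suc m)) g) \<in> Dcpt"
      using cut_at_infinity[OF f(1)] by blast
    show "v \<in> closure (jF ` Dcpt)" unfolding f(2)
      by (intro in_closure_by_correction[OF cm jcomb nlim'] f weyl_spike_VF)
  qed
  have dense: "closure (jF ` Dcpt) = UNIV" "closure (jF ` Dcpt0) = UNIV"
    using closure_mono_image[OF dense2] closure_mono_image[OF dense1] jF(4) by auto

  \<comment> \<open>The index keeps the sequence of systems next to the function, so that different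
    sequences for one function are compared and shown to have the same limit.\<close>
  define I where "I = {(f, S). good f S}"
  define a where "a = (\<lambda>i::('f pgl2 \<Rightarrow> complex) \<times> (nat \<Rightarrow> ('f \<times> int) set). jF (fst i))"
  \<comment> \<open>The scalar compensates the factor C between the two forms.\<close>
  define p where "p = (\<lambda>(i::('f pgl2 \<Rightarrow> complex) \<times> (nat \<Rightarrow> ('f \<times> int) set)) n.
      of_real (1 / sqrt C) *\<^sub>C jE (approx (fst i) (snd i n)))"
  have goodD: "f \<in> VF" "approx f (S n) \<in> VE" if "good f S" for f S n
    using that approx_VE[of f "S n"] unfolding good_def by auto
  have good_cpt: "\<exists>S. good f S" if "f \<in> Dcpt" for f
    using that good_exists[of f _ "{}" 0] unfolding Dcpt_def by blast
  have "jF ` Dcpt \<subseteq> a ` I" using good_cpt unfolding I_def a_def by force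
  then have "closure (a ` I) = UNIV" using closure_mono[of "jF ` Dcpt" "a ` I"] dense(1) by auto
  moreover have "\<exists>N. \<forall>n\<ge>N. \<forall>m\<ge>N. cmod (cinner (p i n) (p j m) - cinner (a i) (a j)) < e"
    if ij: "i \<in> I" "j \<in> I" and e: "e > 0" for i j and e :: real
  proof -
    have gi: "good (fst i) (snd i)" "good (fst j) (snd j)" using ij by (auto simp: I_def)
    obtain N where N: "\<And>n m. n \<ge> N \<Longrightarrow> m \<ge> N \<Longrightarrow>
        cmod (BE (approx (fst i) (snd i n)) (approx (fst j) (snd j m)) - of_real C * BF (fst i) (fst j)) < e * C"
      using form_limit[OF gi, of "e * C"] e C by auto
    have "cmod (cinner (p i n) (p j m) - cinner (a i) (a j)) < e" if "n \<ge> N" "m \<ge> N" for n m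
    proof -
      let ?B = "BE (approx (fst i) (snd i n)) (approx (fst j) (snd j m))"
      have "cnj (complex_of_real (1 / sqrt C)) * complex_of_real (1 / sqrt C) = complex_of_real (1 / C)"
        using C by (simp flip: of_real_mult)
      then have "cinner (p i n) (p j m) = of_real (1 / C) * ?B"
        unfolding p_def cinner_scaleC_left cinner_scaleC_right jE(1)[OF goodD(2)[OF gi(1)] goodD(2)[OF gi(2)]]
        by (simp only: mult.assoc[symmetric])
      moreover have "cinner (a i) (a j) = BF (fst i) (fst j)"
        unfolding a_def using jF(3) goodD(1) gi by blast
      ultimately have "cinner (p i n) (p j m) - cinner (a i) (a j) = of_real (1 / C) * (?B - of_real C * BF (fst i) (fst j))"
        using C by (simp add: field_simps)
      then have "cmod (cinner (p i n) (p j m) - cinner (a i) (a j)) = (1 / C) * cmod (?B - of_real C * BF (fst i) (fst j))"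
        using C by (simp add: norm_mult norm_divide)
      also have "\<dots> < e" using N[OF that] C by (simp add: field_simps)
      finally show ?thesis .
    qed
    then show ?thesis by blast
  qed
  ultimately obtain U where U: "isometric_map U" "\<And>i. i \<in> I \<Longrightarrow> p i \<longlonglongrightarrow> U (a i)"
    using isometry_from_limits[of I p a] by blast

  define P where "P g \<longleftrightarrow> (\<forall>v. U (\<tau> g v) = \<rho> (pgl2_map \<iota> g) (U v))" for g
  \<comment> \<open>Equivariance is closed under limits, so a dense set on which the approximants
    correspond exactly is enough. The set may depend on g, because \<open>weyl\<close> requires
    functions that vanish near 0.\<close>
  have step: "P g" if D: "closure (jF ` D) = UNIV" and S: "\<And>f. f \<in> D \<Longrightarrow> \<exists>S S'. good f S \<and>
      good (left_translation g f) S' \<and>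
      (\<forall>k. approx (left_translation g f) (S' k) = left_translation (pgl2_map \<iota> g) (approx f (S k)))"
    for g and D :: "('f pgl2 \<Rightarrow> complex) set"
  proof -
    have eq: "U (\<tau> g (jF f)) = \<rho> (pgl2_map \<iota> g) (U (jF f))" if f: "f \<in> D" for f
    proof -
      obtain S S' where S: "good f S" "good (left_translation g f) S'"
        "\<And>k. approx (left_translation g f) (S' k) = left_translation (pgl2_map \<iota> g) (approx f (S k))"
        using S[OF f] by blast
      have 1: "p (f, S) \<longlonglongrightarrow> U (jF f)" using U(2)[of "(f, S)"] S by (simp add: I_def a_def)
      have 2: "p (left_translation g f, S') \<longlonglongrightarrow> U (\<tau> g (jF f))"
        using U(2)[of "(left_translation g f, S')"] S goodD(1)[OF S(1)] by (simp add: I_def a_def jF(5))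
      have "p (left_translation g f, S') = (\<lambda>k. \<rho> (pgl2_map \<iota> g) (p (f, S) k))"
        using iso(1)[of "pgl2_map \<iota> g"]
        by (simp add: p_def S(3) jE(2) isometric_map_def goodD(2)[OF S(1)])
      moreover have "(\<lambda>k. \<rho> (pgl2_map \<iota> g) (p (f, S) k)) \<longlonglongrightarrow> \<rho> (pgl2_map \<iota> g) (U (jF f))"
        by (intro continuous_on_tendsto_compose[OF isometric_map_continuous[OF iso(1), of UNIV] 1]) auto
      ultimately have "p (left_translation g f, S') \<longlonglongrightarrow> \<rho> (pgl2_map \<iota> g) (U (jF f))"
        by (simp only:)
      then show ?thesis using 2 LIMSEQ_unique by blast
    qed
    have "closed {v. U (\<tau> g v) = \<rho> (pgl2_map \<iota> g) (U v)}"
      by (intro closed_Collect_eq continuous_on_compose2[OF isometric_map_continuous[OF U(1)]]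
          continuous_on_compose2[OF isometric_map_continuous[OF iso(1)]]
          isometric_map_continuous iso U) auto
    then have "closure (jF ` D) \<subseteq> {v. U (\<tau> g v) = \<rho> (pgl2_map \<iota> g) (U v)}"
      using eq by (intro closure_minimal) auto
    then show ?thesis using D unfolding P_def by blast
  qed
  have "P g" for g
  proof (rule pgl2_generators[of P])
    show "P (g * h)" if "P g" "P h" for g h
      using that by (simp add: P_def mult pgl2_map_mult)
    show "P (nbar x)" for x
      using step[OF dense(1), of "nbar x"] good_cpt good_nbar unfolding pgl2_map_nbar by meson
    show "P (borel_elt x 0)" if "x \<noteq> 0" for x
      using step[OF dense(1), of "borel_elt x 0"] good_cpt good_diag[OF _ that] unfolding pgl2_map_diag[OF that] by meson
    show "P weyl"
    proof (rule step[OF dense(2)])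
      fix f assume "f \<in> Dcpt0"
      then obtain R L where f: "f \<in> VF" "\<And>y. y \<notin> vball 0 R \<Longrightarrow> f (nbar y) = 0"
        "\<And>y. y \<in> vball 0 L \<Longrightarrow> f (nbar y) = 0" unfolding Dcpt0_def Dcpt_def by blast
      have "\<exists>S. good f S \<and> (\<forall>k. \<forall>p\<in>S k. fst p \<notin> vball 0 L \<and> L \<le> snd p)"
        by (rule good_exists[of f R "vball 0 L" L]) (use f in auto)
      then obtain S where "good f S" and av: "\<forall>k. \<forall>p\<in>S k. fst p \<notin> vball 0 L \<and> L \<le> snd p" by (elim exE conjE)
      then have S: "good f S" "\<And>k p. p \<in> S k \<Longrightarrow> fst p \<notin> vball 0 L" "\<And>k p. p \<in> S k \<Longrightarrow> L \<le> snd p"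
        by blast+
      show "\<exists>S S'. good f S \<and> good (left_translation weyl f) S' \<and>
        (\<forall>k. approx (left_translation weyl f) (S' k) = left_translation (pgl2_map \<iota> weyl) (approx f (S k)))"
      proof -
        have "\<exists>S'. good (left_translation weyl f) S' \<and>
          (\<forall>k. approx (left_translation weyl f) (S' k) = left_translation weyl (approx f (S k)))"
          by (rule good_weyl) (fact S)+
        then show ?thesis using S(1) unfolding pgl2_map_weyl by blast
      qed
    qed
  qed
  then show ?thesis using U(1) by (intro direct_summandI[of U]) (simp_all add: P_def)
qed

end

section \<open>The two restriction theorems\<close>

lemma (in quad_ext) resq_ext_powr:
  fixes dE :: "'e measure"
  assumes M: "haar_measure dE"
  shows "resq TYPE('e) powr (real_of_int ram * a) = resq TYPE('f) powr (2 * a)"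
proof -
  have "resq TYPE('e) powr (real_of_int ram * a) = (resq TYPE('e) powr real_of_int ram) powr a"
    by (simp add: powr_powr)
  also have "\<dots> = resq TYPE('f) powr (2 * a)"
    unfolding resq_ext[OF M] using resq_gt_0[where 'k='f] by (simp add: powr_powr flip: powr_numeral)
  finally show ?thesis .
qed

section \<open>Decay of the energy of small balls\<close>

lemma volball_sq_eq:
  fixes M :: "'k::nonarch_local_field measure"
  assumes M: "haar_measure M"
  shows "(volball M (int m))\<^sup>2 = (volball M 0)\<^sup>2 * (resq TYPE('k) powr (- 2)) ^ m"
proof -
  have "(resq TYPE('k) powr (- 2)) ^ m = resq TYPE('k) powr (- 2 * real m)"
    using resq_gt_0[where 'k='k] by (simp add: powr_powr flip: powr_realpow)
  also have "\<dots> = (resq TYPE('k) powr (- real m))\<^sup>2"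
    by (simp add: power2_eq_square flip: powr_add)
  finally show ?thesis by (simp add: volball_eq[OF M, of "int m"] power_mult_distrib)
qed

text \<open>The squared volume has order q^(-2 m) and the kernel q^(-m (2 t - 1)); for t below 1/2
  the kernel grows, but more slowly than q^m.\<close>

lemma riesz_kb_lim:
  fixes M :: "'k::nonarch_local_field measure"
  assumes M: "haar_measure M" and t: "t > 0"
  shows "(\<lambda>m. (volball M (int m))\<^sup>2 * (a * rieszk TYPE('k) t (int m))) \<longlonglongrightarrow> 0"
proof -
  let ?q = "resq TYPE('k)"
  have q: "?q > 1" using resq_gt_1 by auto
  have eq: "(volball M (int m))\<^sup>2 * (a * rieszk TYPE('k) t (int m)) = (volball M 0)\<^sup>2 * a * (?q powr (- (2 * t + 1))) ^ m" for m
  proof -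
    have "(?q powr (- (2 * t + 1))) ^ m = (?q powr (- 2)) ^ m * ?q powr (- real m * (2 * t - 1))"
      using q by (simp add: powr_powr algebra_simps flip: powr_realpow powr_add)
    then show ?thesis unfolding volball_sq_eq[OF M] rieszk_def by simp
  qed
  have "(\<lambda>m. (volball M 0)\<^sup>2 * a * (?q powr (- (2 * t + 1))) ^ m) \<longlonglongrightarrow> (volball M 0)\<^sup>2 * a * 0"
    using q t by (intro tendsto_mult tendsto_const LIMSEQ_power_zero) (simp add: powr_less_one)
  then show ?thesis unfolding eq by (simp only: mult_zero_right)
qed

lemma log_kb_lim:
  fixes M :: "'k::nonarch_local_field measure"
  assumes M: "haar_measure M"
  shows "(\<lambda>m. (volball M (int m))\<^sup>2 * (a * real m + b)) \<longlonglongrightarrow> 0"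
proof -
  let ?r = "resq TYPE('k) powr (- 2)"
  have r: "norm ?r < 1" using resq_gt_1[where 'k='k] by (simp add: powr_less_one)
  have "(\<lambda>m. (volball M 0)\<^sup>2 * a * (of_nat m * ?r ^ m) + (volball M 0)\<^sup>2 * b * ?r ^ m)
      \<longlonglongrightarrow> (volball M 0)\<^sup>2 * a * 0 + (volball M 0)\<^sup>2 * b * 0"
    by (intro tendsto_add tendsto_mult tendsto_const powser_times_n_limit_0[OF r] LIMSEQ_power_zero[OF r])
  then show ?thesis by (simp add: volball_sq_eq[OF M] algebra_simps)
qed

text \<open>The conductor is chosen inside the computation; the resulting matrix depends neither on
  it nor on the character.\<close>

lemma steinberg_form_balls:
  fixes M :: "'k::nonarch_local_field measure"
  assumes psi: "nontrivial_additive_character \<psi>" and M: "haar_measure M"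
    and I: "finite I" "finite J"
    and f: "\<And>y. f (nbar y) = (\<Sum>i\<in>I. a i * indicator (vball (x i) (n i)) y)"
    and g: "\<And>y. g (nbar y) = (\<Sum>j\<in>J. b j * indicator (vball (z j) (m j)) y)"
    and f0: "(LINT x|M. f (nbar x)) = 0"
  shows "steinberg_form M \<psi> f g = (\<Sum>i\<in>I. \<Sum>j\<in>J. a i * cnj (b j) *
     of_real (volball M (n i) * volball M (m j) * bkern (logk M) (logkb M) (x i) (n i) (z j) (m j)))"
proof -
  obtain c where c: "\<And>x. vge c x \<Longrightarrow> \<psi> x = 1" "\<exists>x. vge (c - 1) x \<and> \<psi> x \<noteq> 1"
    using conductor_exists[OF psi] by (elim exE conjE) (rule that; blast)
  have s0: "(\<Sum>i\<in>I. a i * of_real (volball M (n i))) = 0"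
    using f0 haar_integral_balls[OF M f] by simp
  show ?thesis by (rule steinberg_form_balls_aux[OF psi M _ c(2) I]) (fact c(1) f g s0)+
qed

theorem theoremE:
  fixes \<iota> :: "'f::nonarch_local_field \<Rightarrow> 'e::nonarch_local_field"
    and \<pi>E :: 'e and \<pi>F :: 'f
    and dE :: "'e measure" and dF :: "'f measure"
    and \<psi>E :: "'e \<Rightarrow> complex" and \<psi>F :: "'f \<Rightarrow> complex"
    and chi :: "'e \<Rightarrow> complex" and eta :: "'f \<Rightarrow> complex"
  assumes "quadratic_extension \<iota>"
    and "uniformizer \<pi>E" and "uniformizer \<pi>F"
    and "haar_measure dE" and "haar_measure dF"
    and "nontrivial_additive_character \<psi>E" and "nontrivial_additive_character \<psi>F"
    and "unit_character chi" and "\<forall>u\<in>integer_units. (chi u)\<^sup>2 = 1"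
    and "\<forall>u\<in>integer_units. eta u = chi (\<iota> u)"
    and "compatible_uniformizers \<iota> chi \<pi>E \<pi>F"
  shows "(\<forall>s t :: real. 1/4 < s \<longrightarrow> s < 1/2 \<longrightarrow> t = 2 * s - 1/2 \<longrightarrow>
            (\<forall>(\<rho> :: 'e pgl2 \<Rightarrow> 'h::complex_hilbert \<Rightarrow> 'h) (\<tau> :: 'f pgl2 \<Rightarrow> 'k::complex_hilbert \<Rightarrow> 'k).
               complementary_series \<pi>E dE chi s \<rho> \<longrightarrow> complementary_series \<pi>F dF eta t \<tau> \<longrightarrow>
               contains_direct_summand (\<lambda>g. \<rho> (pgl2_map \<iota> g)) \<tau>)) \<and>
         (\<forall>(\<rho> :: 'e pgl2 \<Rightarrow> 'h \<Rightarrow> 'h) (\<tau> :: 'f pgl2 \<Rightarrow> 'k \<Rightarrow> 'k).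
            steinberg_rep \<pi>E dE \<psi>E chi \<rho> \<longrightarrow> steinberg_rep \<pi>F dF \<psi>F eta \<tau> \<longrightarrow>
            contains_direct_summand (\<lambda>g. \<rho> (pgl2_map \<iota> g)) \<tau>)"
proof -
  note dE = assms(4) and dF = assms(5)
  interpret quad_ext \<iota> by unfold_locales (rule assms(1))
  have units: "\<iota> u \<in> integer_units" if "u \<in> integer_units" for u
    using that by (auto simp: integer_units_def val_ext)
  have eta: "eta u = chi (\<iota> u)" if "u \<in> integer_units" for u using assms(10) that by blast
  have mult_units: "u * v \<in> integer_units" if "u \<in> integer_units" "v \<in> integer_units" for u v :: 'f
    using that by (auto simp: integer_units_def val_mult)
  have "unit_character eta"
    unfolding unit_character_def
  proof (intro conjI ballI)
    have "continuous_on integer_units (\<lambda>u. chi (\<iota> u))"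
      using assms(8) units ext_cont unfolding unit_character_def
      by (intro continuous_on_compose2[of integer_units chi integer_units \<iota>])
        (auto intro: continuous_on_subset)
    then show "continuous_on integer_units eta" by (simp add: eta cong: continuous_on_cong)
    show "eta u \<noteq> 0" if "u \<in> integer_units" for u
      using assms(8) units[OF that] eta[OF that] unfolding unit_character_def by simp
    show "eta (u * v) = eta u * eta v" if "u \<in> integer_units" "v \<in> integer_units" for u v
      using assms(8) units that eta mult_units[OF that] unfolding unit_character_def
      by (simp add: ext_mult)
  qed
  moreover have "(eta u)\<^sup>2 = 1" if "u \<in> integer_units" for u
    using assms(9) units[OF that] eta[OF that] by simp
  ultimately interpret F: quad_character \<pi>F eta
    using assms(3) by unfold_locales auto
  interpret E: quad_character \<pi>E chi
    using assms(2,8,9) by unfold_locales auto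

  have 1: "contains_direct_summand (\<lambda>g. \<rho> (pgl2_map \<iota> g)) \<tau>"
    if s: "1/4 < s" "s < 1/2" "t = 2 * s - 1/2"
      and rho: "complementary_series \<pi>E dE chi s \<rho>" and tau: "complementary_series \<pi>F dF eta t \<tau>"
    for s t and \<rho> :: "'e pgl2 \<Rightarrow> 'h \<Rightarrow> 'h" and \<tau> :: "'f pgl2 \<Rightarrow> 'k \<Rightarrow> 'k"
  proof -
    have s0: "s > 0" and t0: "t > 0" using s by auto
    let ?kE = "rieszk TYPE('e) s" and ?kF = "rieszk TYPE('f) t"
    let ?aE = "rieszA TYPE('e) s" and ?aF = "rieszA TYPE('f) t"
    have k: "?kE (ram * v) = ?kF v" for v
    proof -
      have "?kE (ram * v) = resq TYPE('e) powr (real_of_int ram * (- real_of_int v * (2 * s - 1)))"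
        unfolding rieszk_def by (simp add: algebra_simps)
      also have "\<dots> = ?kF v"
        unfolding resq_ext_powr[OF dE] rieszk_def unfolding s(3) by (simp add: algebra_simps)
      finally show ?thesis .
    qed
    have kpos: "?kF v = resq TYPE('f) powr (- real_of_int v * (2 * t - 1))" for v
      by (rule rieszk_def)
    \<comment> \<open>The kernels agree exactly, so C = 1; A is the gap between the two mean-value
      constants, which come from different residue cardinalities and parameters. Goals 8 and 9 are
      the ball formulas, 12 and 13 the comparison and the decay of energies.\<close>
    interpret R: restr \<iota> \<pi>E \<pi>F chi eta dE dF s t False "complementary_form dE s" "complementary_form dF t"
      ?kE "\<lambda>n. ?aE * ?kE n" ?kF "\<lambda>n. ?aF * ?kF n" 1 "\<bar>?aE - ?aF\<bar>"
    proof (unfold_locales, goal_cases)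
      case 8
      show ?case by (rule complementary_form_balls[OF dE s0 8(7,8)])
    next
      case 9
      show ?case by (rule complementary_form_balls[OF dF t0 9(7,8)])
    next
      case (12 n)
      have "?aE * ?kE (ram * n) - 1 * (?aF * ?kF n) = (?aE - ?aF) * ?kF n"
        unfolding k by (simp add: algebra_simps)
      then show ?case by (simp only: kpos abs_mult abs_of_nonneg[OF powr_ge_zero])
    next
      case 13
      show ?case by (rule riesz_kb_lim[OF dF t0])
    qed (use eta assms(11) dE dF s t0 k in auto)
    have "R.VE = induced_space \<pi>E chi (complex_of_real s)" "R.VF = induced_space \<pi>F eta (complex_of_real t)"
      by (simp_all add: R.VE_def R.VF_def E.indsp_def F.indsp_def)
    then show ?thesis
      using rho tau R.restriction_contains unfolding complementary_series_def by simp
  qed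

  have 2: "contains_direct_summand (\<lambda>g. \<rho> (pgl2_map \<iota> g)) \<tau>"
    if rho: "steinberg_rep \<pi>E dE \<psi>E chi \<rho>" and tau: "steinberg_rep \<pi>F dF \<psi>F eta \<tau>"
    for \<rho> :: "'e pgl2 \<Rightarrow> 'h \<Rightarrow> 'h" and \<tau> :: "'f pgl2 \<Rightarrow> 'k \<Rightarrow> 'k"
  proof -
    \<comment> \<open>Both logarithmic kernels are linear in the valuation; C is the quotient of
      their slopes times the factor \<open>ram\<close> by which the embedding stretches
      valuations.\<close>
    define a where "a = (1 - 1 / resq TYPE('f)) * volball dF 0"
    define C where "C = (1 - 1 / resq TYPE('e)) * volball dE 0 * real_of_int ram / a"
    have a: "a > 0" using resq_gt_1[where 'k='f] volball_pos[OF dF, of 0] by (simp add: a_def)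
    have C: "C > 0"
      using resq_gt_1[where 'k='e] volball_pos[OF dE, of 0] ram_pos a by (simp add: C_def)
    have "logk dF v = a * real_of_int v" for v by (simp add: logk_def a_def)
    then have k: "logk dE (ram * v) = C * logk dF v" for v
      using a by (simp add: logk_def[of dE] C_def)
    let ?A = "\<bar>volball dE 0 / resq TYPE('e) - C * (volball dF 0 / resq TYPE('f))\<bar>"
    interpret R: restr \<iota> \<pi>E \<pi>F chi eta dE dF "1/2" "1/2" True "steinberg_form dE \<psi>E" "steinberg_form dF \<psi>F"
      "logk dE" "logkb dE" "logk dF" "logkb dF" C ?A
    proof (unfold_locales, goal_cases)
      case 8
      show ?case by (rule steinberg_form_balls[OF assms(6) dE 8(5,6,7,8) 8(3)[OF TrueI]])
    next
      case 9
      show ?case by (rule steinberg_form_balls[OF assms(7) dF 9(5,6,7,8) 9(3)[OF TrueI]])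
    next
      case (12 n)
      \<comment> \<open>The gap is the same for every n, and at t = 1/2 the weight against which it
        is measured is 1.\<close>
      have "logkb dE (ram * n) - C * logkb dF n = volball dE 0 / resq TYPE('e) - C * (volball dF 0 / resq TYPE('f))"
        unfolding logkb_def k by (simp add: algebra_simps)
      then show ?case using resq_gt_0[where 'k='f] by simp
    next
      case 13
      show ?case unfolding logkb_def logk_def using log_kb_lim[OF dF, of a "volball dF 0 / resq TYPE('f)"]
        by (simp add: a_def)
    qed (use eta assms(11) dE dF C k in auto)
    have "R.VE = steinberg_space \<pi>E dE chi" "R.VF = steinberg_space \<pi>F dF eta"
      by (simp_all add: R.VE_def R.VF_def E.indsp_def F.indsp_def steinberg_space_def)
    then show ?thesis
      using rho tau R.restriction_contains unfolding steinberg_rep_def by simp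
  qed
  show ?thesis using 1 2 by blast
qed

end
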